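(* Let $X$ be a Banach space and let $T=\{T(t)\}_{t\ge 0}$ be a $C_0$-semigroup of bounded linear operators on $X$, not necessarily bounded, with growth bound $\omega_0>-\infty$ and generator $A$. Suppose $f:[0,\infty)\to(0,\infty)$ is a positive function such that $t\mapsto \log f(t)$ is concave (concave downwards) and $$\|T(t)\|\le f(t)\quad (t\ge 0),\qquad \limsup_{t\to+\infty}\frac{\|T(t)\|}{f(t)}=a>0 .$$ Assume further that for every $\lambda\in\sigma(A)\cap(\omega_0+i\mathbb{R})$ there exists a regular bounded curve $\Gamma_\lambda$ in $\mathbb{C}$ enclosing $\lambda$ such that (a) $\Gamma_\lambda\cap\sigma(A)=\emptyset$; and (b) $\displaystyle\lim_{t\to+\infty}\frac{\|T(t)P_{\Gamma_\lambda}\|}{f(t)}=0$, where $P_{\Gamma_\lambda}$ is the Riesz projection of $A$ associated with the curve $\Gamma_\lambda$. Then for every fixed $\mu\in\mathbb{C}\setminus\sigma(A)$, $$\lim_{t\to+\infty}\frac{\|T(t)R_\mu\|}{f(t)}=0,$$ where $R_\mu=(A-\mu I)^{-1}$.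
   Context: $\sigma(A)$ denotes the spectrum of the (generally unbounded) operator $A$, and $\omega_0+i\mathbb{R}=\{z\in\mathbb{C}:\operatorname{Re} z=\omega_0\}$. The growth bound of $T$ is $\omega_0=\omega_0(T)=\lim_{t\to\infty}\frac1t\log\|T(t)\|$. For $\mu\notin\sigma(A)$, $R_\mu=(A-\mu I)^{-1}$ is the resolvent of $A$ at $\mu$. A regular bounded curve enclosing $\lambda$ is understood as a (rectifiable, piecewise smooth) simple closed curve having $\lambda$ in its interior. For such a curve $\Gamma$ with $\Gamma\cap\sigma(A)=\emptyset$, traversed counterclockwise, the Riesz projection is $P_\Gamma=-\frac{1}{2\pi i}\int_\Gamma (A-\mu I)^{-1}\,d\mu$, i.e. the spectral projection of $A$ corresponding to the part of $\sigma(A)$ inside $\Gamma$. All operator norms are norms in $\mathcal{L}(X)$. *)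

theory Defs
  imports "HOL-Complex_Analysis.Complex_Analysis"
begin

class complex_normed_vector = real_normed_vector +
  fixes scaleC :: "complex \<Rightarrow> 'a \<Rightarrow> 'a" (infixr "*\<^sub>C" 75)
  assumes scaleC_add_right: "c *\<^sub>C (x + y) = c *\<^sub>C x + c *\<^sub>C y"
    and scaleC_add_left: "(c + d) *\<^sub>C x = c *\<^sub>C x + d *\<^sub>C x"
    and scaleC_scaleC: "c *\<^sub>C d *\<^sub>C x = (c * d) *\<^sub>C x"
    and scaleC_of_real: "complex_of_real r *\<^sub>C x = r *\<^sub>R x"
    and norm_scaleC: "norm (c *\<^sub>C x) = cmod c * norm x"

class complex_banach = complex_normed_vector + banach

lemma bounded_linear_scaleC: "bounded_linear (\<lambda>x :: 'a :: complex_normed_vector. c *\<^sub>C x)"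
proof (rule bounded_linear_intro[where K = "cmod c"])
  fix r and x :: 'a
  show "c *\<^sub>C r *\<^sub>R x = r *\<^sub>R c *\<^sub>C x"
    by (metis scaleC_of_real scaleC_scaleC mult.commute)
qed (simp_all add: scaleC_add_right norm_scaleC mult.commute)

instantiation blinfun :: (real_normed_vector, complex_normed_vector) complex_normed_vector
begin

lift_definition scaleC_blinfun :: "complex \<Rightarrow> 'a \<Rightarrow>\<^sub>L 'b \<Rightarrow> 'a \<Rightarrow>\<^sub>L 'b"
  is "\<lambda>c f x. c *\<^sub>C f x"
  by (rule bounded_linear_compose[OF bounded_linear_scaleC])

instance
proof
  fix c d :: complex and r :: real and F G :: "'a \<Rightarrow>\<^sub>L 'b"
  show "c *\<^sub>C (F + G) = c *\<^sub>C F + c *\<^sub>C G"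
    by transfer (simp add: scaleC_add_right)
  show "(c + d) *\<^sub>C F = c *\<^sub>C F + d *\<^sub>C F"
    by transfer (simp add: scaleC_add_left)
  show "c *\<^sub>C d *\<^sub>C F = (c * d) *\<^sub>C F"
    by transfer (simp add: scaleC_scaleC)
  show "complex_of_real r *\<^sub>C F = r *\<^sub>R F"
    by transfer (simp add: scaleC_of_real)
  have le: "norm (e *\<^sub>C H) \<le> cmod e * norm H" for e and H :: "'a \<Rightarrow>\<^sub>L 'b"
  proof (rule norm_blinfun_bound)
    fix x
    have "norm (blinfun_apply (e *\<^sub>C H) x) = cmod e * norm (blinfun_apply H x)"
      by (simp add: scaleC_blinfun.rep_eq norm_scaleC)
    also have "\<dots> \<le> cmod e * (norm H * norm x)"
      by (simp add: mult_left_mono norm_blinfun)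
    finally show "norm (blinfun_apply (e *\<^sub>C H) x) \<le> cmod e * norm H * norm x"
      by (simp add: mult.assoc)
  qed simp
  show "norm (c *\<^sub>C F) = cmod c * norm F"
  proof (cases "c = 0")
    case True
    then show ?thesis using le[of 0 F] by simp
  next
    case False
    have "inverse c *\<^sub>C c *\<^sub>C F = F"
      using False by transfer (simp add: scaleC_scaleC scaleC_of_real[of 1, simplified])
    then have "norm F \<le> norm (c *\<^sub>C F) / cmod c"
      using le[of "inverse c" "c *\<^sub>C F"] by (simp add: norm_inverse divide_inverse mult.commute)
    then have "cmod c * norm F \<le> norm (c *\<^sub>C F)"
      using False by (simp add: field_simps)
    with le[of c F] show ?thesis by simp
  qed
qed

end

text \<open>
  The type of continuous real-linear maps carries the operator norm; a bounded operator on a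
  complex space is an element that commutes with complex scalars. A semigroup is a function
  on all of \<open>real\<close> whose values at negative times are irrelevant.
\<close>

definition complex_linear ::
  "'a :: complex_normed_vector \<Rightarrow>\<^sub>L 'b :: complex_normed_vector \<Rightarrow> bool" where
  "complex_linear F \<longleftrightarrow> (\<forall>c x. blinfun_apply F (c *\<^sub>C x) = c *\<^sub>C blinfun_apply F x)"

definition C0_semigroup :: "(real \<Rightarrow> 'a :: complex_banach \<Rightarrow>\<^sub>L 'a) \<Rightarrow> bool" where
  "C0_semigroup T \<longleftrightarrow>
     (\<forall>t\<ge>0. complex_linear (T t)) \<and>
     T 0 = id_blinfun \<and>
     (\<forall>s\<ge>0. \<forall>t\<ge>0. T (s + t) = T s o\<^sub>L T t) \<and>
     (\<forall>x. ((\<lambda>t. blinfun_apply (T t) x) \<longlongrightarrow> x) (at_right 0))"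

text \<open>The logarithm of \<open>0\<close> is read as \<open>-\<infinity>\<close>.\<close>

definition growth_bound :: "(real \<Rightarrow> 'a :: complex_banach \<Rightarrow>\<^sub>L 'a) \<Rightarrow> ereal" where
  "growth_bound T =
     Lim at_top (\<lambda>t. if T t = 0 then -\<infinity> else ereal (ln (norm (T t)) / t))"

text \<open>An unbounded operator is a pair of its domain and a function, relevant only there.\<close>

type_synonym 'a unbounded_operator = "'a set \<times> ('a \<Rightarrow> 'a)"

definition generator ::
  "(real \<Rightarrow> 'a :: complex_banach \<Rightarrow>\<^sub>L 'a) \<Rightarrow> 'a unbounded_operator" where
  "generator T =
     ({x. \<exists>y. ((\<lambda>h. (blinfun_apply (T h) x - x) /\<^sub>R h) \<longlongrightarrow> y) (at_right 0)},
      \<lambda>x. Lim (at_right 0) (\<lambda>h. (blinfun_apply (T h) x - x) /\<^sub>R h))"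

definition shifted :: "'a :: complex_banach unbounded_operator \<Rightarrow> complex \<Rightarrow> 'a \<Rightarrow> 'a" where
  "shifted A \<mu> x = snd A x - \<mu> *\<^sub>C x"

definition spectrum :: "'a :: complex_banach unbounded_operator \<Rightarrow> complex set" where
  "spectrum A =
     {\<mu>. \<not> (bij_betw (shifted A \<mu>) (fst A) UNIV \<and>
             bounded_linear (inv_into (fst A) (shifted A \<mu>)))}"

definition resolvent ::
  "'a :: complex_banach unbounded_operator \<Rightarrow> complex \<Rightarrow> 'a \<Rightarrow>\<^sub>L 'a" where
  "resolvent A \<mu> = Blinfun (inv_into (fst A) (shifted A \<mu>))"

definition rectifiable :: "(real \<Rightarrow> complex) \<Rightarrow> bool" where
  "rectifiable \<gamma> \<longleftrightarrow>
     (\<exists>B. \<forall>d. d division_of {0..1} \<longrightarrow> (\<Sum>K\<in>d. norm (\<gamma> (Sup K) - \<gamma> (Inf K))) \<le> B)"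

text \<open>
  Rectifiability has to be required separately, since the derivative of a \<^const>\<open>valid_path\<close> may be
  unbounded near the finitely many exceptional points. Winding number \<open>1\<close> expresses that the curve
  is traversed counterclockwise.
\<close>

definition regular_curve_enclosing :: "(real \<Rightarrow> complex) \<Rightarrow> complex \<Rightarrow> bool" where
  "regular_curve_enclosing \<gamma> z \<longleftrightarrow>
     valid_path \<gamma> \<and> rectifiable \<gamma> \<and> simple_path \<gamma> \<and> pathfinish \<gamma> = pathstart \<gamma> \<and>
     z \<in> inside (path_image \<gamma>) \<and> winding_number \<gamma> z = 1"

text \<open>
  The contour integral of the library is confined to complex-valued integrands; here it is
  written out for integrands with values in the bounded operators under the operator norm.
\<close>

definition riesz_projection ::
  "'a :: complex_banach unbounded_operator \<Rightarrow> (real \<Rightarrow> complex) \<Rightarrow> 'a \<Rightarrow>\<^sub>L 'a" where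
  "riesz_projection A \<gamma> =
     - ((1 / (2 * complex_of_real pi * \<i>)) *\<^sub>C
         integral {0..1} (\<lambda>s. vector_derivative \<gamma> (at s within {0..1}) *\<^sub>C resolvent A (\<gamma> s)))"

end

theory Submission
  imports Defs
begin

text \<open>
  Put \<open>\<omega> = \<omega>\<^sub>0(T)\<close> and measure a family of operators by the limit superior of its norms
  divided by \<open>f(t)\<close>. Log-concavity makes \<open>f(t + s) / f(t)\<close> decrease to \<open>e\<^bsup>\<omega>s\<^esup>\<close>, so that up to the
  factor \<open>e\<^bsup>\<omega>s\<^esup>\<close> the semigroup acts isometrically for this seminorm, and the size \<open>u(z)\<close> of
  \<open>T(t) (A - z)\<^sup>-\<^sup>1\<close> is at most \<open>1 / (Re z - \<omega>)\<close> to the right of the line \<open>Re z = \<omega>\<close>. To the left, up to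
  negligible terms, \<open>T(t) (A - z)\<^sup>-\<^sup>1\<close> is the truncated Laplace integral
  \<open>\<integral>\<^sub>0\<^sup>t e\<^bsup>z(t-s)\<^esup> T(s) ds\<close>; it exists for all \<open>z\<close>, in the spectrum or not, and has size at most
  \<open>1 / (\<omega> - Re z)\<close>. At a spectral point on the line the Cauchy integral
  \<open>S(z) = (2\<pi>i)\<^sup>-\<^sup>1 \<integral>\<^sub>\<Gamma> (A - \<mu>)\<^sup>-\<^sup>1 / (\<mu> - z) d\<mu>\<close> satisfies \<open>(A - z) S(z) = I - P\<close> with the negligible
  Riesz projection \<open>P\<close>, and so continues the family analytically across the line. Hence \<open>u\<close> is
  the size of an entire function bounded by \<open>1 / |Re z - \<omega>|\<close>, and the maximum principle applied to
  \<open>(1 + (z - \<omega>)\<^sup>2 / r\<^sup>2) u(z)\<close> on discs of radius \<open>r \<rightarrow> \<infinity>\<close> forces \<open>u = 0\<close>.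
\<close>

section \<open>Circle means and a Liouville theorem\<close>

text \<open>The natural home of the argument is the space of operator families
  \<open>F(t) / f(t)\<close> modulo those tending to zero, where the glued family would be a single
  holomorphic function. That quotient is never formed: only its scalar norm is kept, and holomorphy
  survives as a submean inequality in maximum form, tested against every entire weight. The price is
  that u is not known to be semicontinuous, so extrema are only approached along sequences.

  The factor 1 + ((z - \<omega>) / r)^2 is the device known from contour proofs of Tauberian
  theorems. It vanishes at the two points where the circle meets the line, so that a local bound on
  u is enough there.

  The bounds 1 / |Re z - \<omega>| need the exact rate \<omega> on both sides of the line, and the
  curves are given only on the line of the growth bound. The asymptotic slope of log f must
  therefore be identified with the growth bound; positivity of the limsup a does this by excluding
  ||T(\<tau>)|| < exp(\<omega> \<tau>).\<close>

text \<open>Averages over finitely many nodes instead of integrals, because a limit superior commutes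
  with finite maxima only.\<close>

definition circle_mean :: "nat \<Rightarrow> real \<Rightarrow> complex \<Rightarrow> (complex \<Rightarrow> 'b :: real_vector) \<Rightarrow> 'b" where
  "circle_mean M r z F = (1 / real M) *\<^sub>R (\<Sum>j<M. F (z + of_real r * cis (2 * pi * real j / real M)))"

text \<open>Geometric sum over the powers of one root of unity q. The restriction k < M excludes
  aliasing: for k divisible by M one would have q = 1.\<close>

lemma sum_roots_of_unity_power:
  assumes "0 < k" "k < M"
  shows "(\<Sum>j<M. cis (2 * pi * real j / real M) ^ k) = 0"
proof -
  define q where "q = cis (2 * pi * real k / real M)"
  have pw: "cis (2 * pi * real j / real M) ^ k = q ^ j" for j
  proof -
    have "real k * (2 * pi * real j / real M) = real j * (2 * pi * real k / real M)"
      by simp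
    then show ?thesis
      unfolding q_def Complex.DeMoivre by metis
  qed
  have "q \<noteq> 1"
  proof
    assume "q = 1"
    then have "cos (2 * pi * real k / real M) = 1"
      unfolding q_def by (metis cis.sel(1) one_complex.sel(1))
    then obtain n :: int where "2 * pi * real k / real M = of_int n * 2 * pi"
      by (auto simp: cos_one_2pi_int)
    then have "real k = of_int n * real M"
      using assms by (simp add: field_simps)
    then have "int k = n * int M"
      by (metis of_int_eq_iff of_int_mult of_int_of_nat_eq)
    then show False
      using assms by (metis nat_dvd_not_less of_nat_dvd_iff dvd_triv_right)
  qed
  moreover have "q ^ M = 1"
    unfolding q_def Complex.DeMoivre using assms cis_multiple_2pi[of "real k"] by (simp add: mult_ac)
  ultimately show ?thesis
    by (simp add: pw geometric_sum)
qed

text \<open>By orthogonality of the nodes the mean is exact on the Taylor polynomial of degree below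
  M. Cauchy estimates on the doubled radius make the k-th term at most B / 2^k on the circle, so the
  tail from M on is at most 2 B / 2^M. The error depends on h only through B, hence one M serves a
  whole family of functions.\<close>

lemma circle_mean_holomorphic:
  assumes hol: "h holomorphic_on cball z (2 * r)" and r: "0 < r" and M: "0 < M"
    and B: "\<And>w. w \<in> cball z (2 * r) \<Longrightarrow> cmod (h w) \<le> B"
  shows "cmod (circle_mean M r z h - h z) \<le> 2 * B / 2 ^ M"
proof -
  define a where "a k = (deriv ^^ k) h z / fact k" for k
  have holb: "h holomorphic_on ball z (2 * r)"
    using hol ball_subset_cball holomorphic_on_subset by blast
  have a_le: "cmod (a k) \<le> B / (2 * r) ^ k" for k
  proof -
    have "cmod ((deriv ^^ k) h z) \<le> fact k * B / (2 * r) ^ k"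
      by (rule Cauchy_inequality[OF holb])
        (use hol holomorphic_on_imp_continuous_on r B in \<open>auto simp: dist_norm\<close>)
    then show ?thesis
      by (simp add: a_def norm_divide field_simps)
  qed
  have B0: "0 \<le> B"
    using B[of z] r norm_ge_zero order_trans by (metis centre_in_cball less_eq_real_def mult_pos_pos zero_less_numeral)
  define zj where "zj j = of_real r * cis (2 * pi * real j / real M)" for j
  have tail: "cmod (h (z + zj j) - (\<Sum>k<M. a k * zj j ^ k)) \<le> 2 * B / 2 ^ M" for j
  proof -
    have nz: "cmod (zj j) = r"
      using r by (simp add: zj_def norm_mult)
    have s: "(\<lambda>k. a k * zj j ^ k) sums h (z + zj j)"
      using holomorphic_power_series[OF holb, of "z + zj j"] nz r
      by (simp add: a_def dist_norm)
    have t: "(\<lambda>k. a (k + M) * zj j ^ (k + M)) sums (h (z + zj j) - (\<Sum>k<M. a k * zj j ^ k))"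
      using sums_split_initial_segment[OF s, of M] .
    have le: "cmod (a (k + M) * zj j ^ (k + M)) \<le> B / 2 ^ M * (1/2) ^ k" for k
    proof -
      have "cmod (a (k + M) * zj j ^ (k + M)) \<le> B / (2 * r) ^ (k + M) * r ^ (k + M)"
        unfolding norm_mult norm_power nz
        by (intro mult_right_mono a_le) (use r in auto)
      also have "\<dots> = B / 2 ^ M * (1/2) ^ k"
        using r by (simp add: power_mult_distrib power_add field_simps)
      finally show ?thesis .
    qed
    have g: "(\<lambda>k. B / 2 ^ M * (1/2) ^ k) sums (B / 2 ^ M * 2)"
      using geometric_sums[of "1/2 :: real"] by (intro sums_mult) simp
    have "cmod (h (z + zj j) - (\<Sum>k<M. a k * zj j ^ k)) \<le> B / 2 ^ M * 2"
      by (rule norm_sums_le[OF t g le])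
    then show ?thesis by (simp add: field_simps)
  qed
  have poly: "(\<Sum>j<M. \<Sum>k<M. a k * zj j ^ k) = of_nat M * h z"
  proof -
    have "(\<Sum>j<M. \<Sum>k<M. a k * zj j ^ k) = (\<Sum>k<M. \<Sum>j<M. a k * zj j ^ k)"
      by (rule sum.swap)
    also have "\<dots> = (\<Sum>k<M. if k = 0 then of_nat M * h z else 0)"
    proof (rule sum.cong)
      fix k assume "k \<in> {..<M}"
      show "(\<Sum>j<M. a k * zj j ^ k) = (if k = 0 then of_nat M * h z else 0)"
      proof (cases "k = 0")
        case True
        then show ?thesis by (simp add: a_def)
      next
        case False
        have "(\<Sum>j<M. a k * zj j ^ k) = a k * of_real r ^ k * (\<Sum>j<M. cis (2 * pi * real j / real M) ^ k)"
          by (simp add: zj_def power_mult_distrib sum_distrib_left mult.assoc)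
        then show ?thesis
          using False sum_roots_of_unity_power[of k M] \<open>k \<in> {..<M}\<close> by simp
      qed
    qed simp
    also have "\<dots> = of_nat M * h z"
      using M by simp
    finally show ?thesis .
  qed
  have "circle_mean M r z h - h z = (1 / real M) *\<^sub>R (\<Sum>j<M. h (z + zj j) - (\<Sum>k<M. a k * zj j ^ k))"
    unfolding circle_mean_def zj_def[symmetric] sum_subtractf poly
    using M by (simp add: scaleR_conv_of_real field_simps)
  also have "cmod \<dots> \<le> (1 / real M) * (\<Sum>j<M. 2 * B / 2 ^ M)"
  proof -
    have "cmod (\<Sum>j<M. h (z + zj j) - (\<Sum>k<M. a k * zj j ^ k)) \<le> (\<Sum>j<M. 2 * B / 2 ^ M)"
      by (rule sum_norm_le) (rule tail)
    then show ?thesis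
      unfolding norm_scaleR by (intro mult_mono) auto
  qed
  also have "\<dots> = 2 * B / 2 ^ M"
    using M by simp
  finally show ?thesis .
qed

text \<open>Quantifying over all entire weights g is a form of subharmonicity of log u. It makes the
  property stable under multiplication by moduli of entire functions, which covers both the
  quadratic factor and exponentials of linear functions.\<close>

definition submean :: "(complex \<Rightarrow> real) \<Rightarrow> complex \<Rightarrow> real \<Rightarrow> bool" where
  "submean u z r \<longleftrightarrow> (\<forall>g B. g holomorphic_on UNIV \<longrightarrow>
     (\<forall>\<zeta>\<in>sphere z r. cmod (g \<zeta>) * u \<zeta> \<le> B) \<longrightarrow> cmod (g z) * u z \<le> B)"

text \<open>One radius and one bound serve all centres near a given point. This uniformity replaces
  semicontinuity: along a maximizing sequence the centres move while the circle keeps its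
  radius.\<close>

definition log_subharmonic :: "(complex \<Rightarrow> real) \<Rightarrow> bool" where
  "log_subharmonic u \<longleftrightarrow> (\<forall>z\<^sub>0. \<exists>\<rho>>0. \<exists>K. \<forall>z\<in>ball z\<^sub>0 \<rho>. u z \<le> K \<and> (\<forall>r. 0 < r \<and> r \<le> \<rho> \<longrightarrow> submean u z r))"

text \<open>The factor \<open>exp(e |z - c|\<^sup>2)\<close> turns the weak submean inequality into a strict one, since on the
  circle it is \<open>exp(e r\<^sup>2)\<close> times the modulus of a holomorphic function.\<close>

lemma submean_exp_square:
  assumes u: "submean u z r" and r: "0 < r" and w: "w holomorphic_on UNIV" and e: "0 < e"
    and M: "\<And>\<zeta>. \<zeta> \<in> sphere z r \<Longrightarrow> cmod (w \<zeta>) * u \<zeta> * exp (e * (cmod (\<zeta> - c))\<^sup>2) \<le> M"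
  shows "cmod (w z) * u z * exp (e * (cmod (z - c))\<^sup>2) \<le> M * exp (- e * r\<^sup>2)"
proof -
  \<comment> \<open>Expand |\<zeta> - c|^2 about z: the square |\<zeta> - z|^2 is constant on the
    circle, and the cross term is the real part of a function linear in \<zeta>.\<close>
  define g where "g \<zeta> = w \<zeta> * exp (of_real (2 * e) * cnj (z - c) * (\<zeta> - z))" for \<zeta>
  have "g holomorphic_on UNIV"
    unfolding g_def by (intro holomorphic_intros w)
  moreover have "cmod (g \<zeta>) * u \<zeta> \<le> M * exp (- e * (cmod (z - c))\<^sup>2 - e * r\<^sup>2)" if \<zeta>: "\<zeta> \<in> sphere z r" for \<zeta>
  proof -
    have nr: "cmod (\<zeta> - z) = r"
      using \<zeta> by (simp add: dist_norm norm_minus_commute)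
    have id: "2 * Re (cnj (z - c) * (\<zeta> - z)) = (cmod (\<zeta> - c))\<^sup>2 - (cmod (z - c))\<^sup>2 - (cmod (\<zeta> - z))\<^sup>2"
      unfolding cmod_power2 by (simp add: power2_eq_square algebra_simps)
    have "cmod (g \<zeta>) = cmod (w \<zeta>) * exp (e * (2 * Re (cnj (z - c) * (\<zeta> - z))))"
      unfolding g_def norm_mult norm_exp_eq_Re by (simp add: algebra_simps)
    also have "\<dots> = cmod (w \<zeta>) * exp (e * (cmod (\<zeta> - c))\<^sup>2) * exp (- e * (cmod (z - c))\<^sup>2 - e * r\<^sup>2)"
      unfolding id nr by (simp add: mult.assoc exp_add[symmetric] algebra_simps)
    finally have "cmod (g \<zeta>) * u \<zeta> =
      (cmod (w \<zeta>) * u \<zeta> * exp (e * (cmod (\<zeta> - c))\<^sup>2)) * exp (- e * (cmod (z - c))\<^sup>2 - e * r\<^sup>2)"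
      by simp
    also have "\<dots> \<le> M * exp (- e * (cmod (z - c))\<^sup>2 - e * r\<^sup>2)"
      by (intro mult_right_mono M \<zeta>) auto
    finally show ?thesis .
  qed
  ultimately have "cmod (g z) * u z \<le> M * exp (- e * (cmod (z - c))\<^sup>2 - e * r\<^sup>2)"
    using u unfolding submean_def by blast
  then have "cmod (w z) * u z \<le> M * exp (- e * (cmod (z - c))\<^sup>2 - e * r\<^sup>2)"
    by (simp add: g_def)
  then have "cmod (w z) * u z * exp (e * (cmod (z - c))\<^sup>2) \<le>
    M * exp (- e * (cmod (z - c))\<^sup>2 - e * r\<^sup>2) * exp (e * (cmod (z - c))\<^sup>2)"
    by (rule mult_right_mono) simp
  then show ?thesis
    by (simp add: mult.assoc exp_add[symmetric])
qed

text \<open>On the boundary circle the factor \<open>1 + ((z - \<omega>) / r)\<^sup>2\<close> has modulus \<open>2 |Re z - \<omega>| / r\<close>, which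
  compensates the singularity of the bound on \<open>u\<close> at the line. Since \<open>u\<close> is not assumed to be
  continuous, a maximizing sequence replaces a maximum point.\<close>

lemma log_subharmonic_disc_bound:
  assumes sh: "log_subharmonic u" and nonneg: "\<And>z. 0 \<le> u z"
    and bnd: "\<And>z. Re z \<noteq> \<omega> \<Longrightarrow> u z \<le> C / \<bar>Re z - \<omega>\<bar>"
    and r: "0 < r" and e: "0 < e" and C: "0 \<le> C"
    and z: "z \<in> cball (of_real \<omega>) r"
  shows "cmod (1 + ((z - of_real \<omega>) / of_real r)\<^sup>2) * u z * exp (e * (cmod (z - of_real \<omega>))\<^sup>2)
    \<le> 2 * C / r * exp (e * r\<^sup>2)"
proof (rule ccontr)
  define c where "c = complex_of_real \<omega>"
  define D where "D = cball c r"
  define w where "w \<zeta> = 1 + ((\<zeta> - c) / of_real r)\<^sup>2" for \<zeta>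
  define v where "v \<zeta> = cmod (w \<zeta>) * u \<zeta> * exp (e * (cmod (\<zeta> - c))\<^sup>2)" for \<zeta>
  assume "\<not> ?thesis"
  then have zgt: "2 * C / r * exp (e * r\<^sup>2) < v z"
    by (simp add: v_def w_def c_def)
  have zD: "z \<in> D" using z by (simp add: D_def c_def)
  have wcont: "isCont w \<zeta>" for \<zeta>
    unfolding w_def by (intro continuous_intros) (use r in auto)
  have whol: "w holomorphic_on UNIV"
    unfolding w_def by (intro holomorphic_intros) (use r in auto)
  have v0: "0 \<le> v \<zeta>" for \<zeta>
    unfolding v_def by (intro mult_nonneg_nonneg nonneg) auto
  have expD: "exp (e * (cmod (\<zeta> - c))\<^sup>2) \<le> exp (e * r\<^sup>2)" if "\<zeta> \<in> D" for \<zeta>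
    using that e by (auto simp: D_def dist_norm norm_minus_commute intro!: power_mono)
  have loc: "\<exists>\<rho>>0. \<exists>K. \<forall>\<zeta>\<in>ball z\<^sub>0 \<rho>. u \<zeta> \<le> K \<and> (\<forall>r. 0 < r \<and> r \<le> \<rho> \<longrightarrow> submean u \<zeta> r)" for z\<^sub>0
    using sh by (simp add: log_subharmonic_def)
  have lim: "bounded (w ` D)"
    unfolding D_def using wcont by (intro compact_imp_bounded compact_continuous_image) (auto simp: continuous_at_imp_continuous_on)
  have bdd: "bdd_above (v ` D)"
  proof -
    obtain W where W: "\<And>\<zeta>. \<zeta> \<in> D \<Longrightarrow> cmod (w \<zeta>) \<le> W"
      using lim by (auto simp: bounded_iff)
    have "\<forall>z\<^sub>0. \<exists>\<rho>K. fst \<rho>K > 0 \<and> (\<forall>\<zeta>\<in>ball z\<^sub>0 (fst \<rho>K). u \<zeta> \<le> snd \<rho>K)"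
      using loc by fastforce
    then obtain \<rho>K where \<rho>K: "\<And>z\<^sub>0. fst (\<rho>K z\<^sub>0) > 0" "\<And>z\<^sub>0 \<zeta>. \<zeta> \<in> ball z\<^sub>0 (fst (\<rho>K z\<^sub>0)) \<Longrightarrow> u \<zeta> \<le> snd (\<rho>K z\<^sub>0)"
      by metis
    have "compact D" by (simp add: D_def)
    then obtain X where X: "X \<subseteq> D" "finite X" "D \<subseteq> (\<Union>x\<in>X. ball x (fst (\<rho>K x)))"
      by (rule compactE_image[where f = "\<lambda>x. ball x (fst (\<rho>K x))"]) (use \<rho>K(1) in force)+
    define K where "K = (\<Sum>x\<in>X. \<bar>snd (\<rho>K x)\<bar>)"
    have uK: "u \<zeta> \<le> K" if \<zeta>D: "\<zeta> \<in> D" for \<zeta>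
    proof -
      obtain x where x: "x \<in> X" "\<zeta> \<in> ball x (fst (\<rho>K x))"
        using subsetD[OF X(3) \<zeta>D] by (elim UN_E)
      have "u \<zeta> \<le> \<bar>snd (\<rho>K x)\<bar>" using \<rho>K(2)[OF x(2)] by linarith
      also have "\<dots> \<le> K" unfolding K_def
        by (rule member_le_sum) (use x X in auto)
      finally show ?thesis .
    qed
    have "v \<zeta> \<le> W * K * exp (e * r\<^sup>2)" if "\<zeta> \<in> D" for \<zeta>
    proof -
      have "0 \<le> W" using W[OF that] norm_ge_zero order_trans by blast
      then show ?thesis
      unfolding v_def using W[OF that] uK[OF that] expD[OF that] nonneg[of \<zeta>]
      by (intro mult_mono) auto
    qed
    then show ?thesis by (rule bdd_aboveI2)
  qed
  define M where "M = (SUP \<zeta>\<in>D. v \<zeta>)"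
  have vM: "v \<zeta> \<le> M" if "\<zeta> \<in> D" for \<zeta>
    unfolding M_def by (rule cSUP_upper[OF that bdd])
  have Mgt: "2 * C / r * exp (e * r\<^sup>2) < M"
    using zgt vM[OF zD] by linarith
  have Mpos: "0 < M"
    by (rule le_less_trans[OF _ Mgt]) (use C r in auto)
  have "\<exists>\<zeta>\<in>D. M - 1 / Suc n < v \<zeta>" for n
    unfolding M_def
    by (rule less_cSUP_iff[THEN iffD1, OF _ bdd]) (use zD in auto)
  then obtain s where sD: "\<And>n. s n \<in> D" and sM: "\<And>n. M - 1 / Suc n < v (s n)"
    by metis
  obtain l \<sigma> where l: "l \<in> D" and \<sigma>: "strict_mono \<sigma>" and lims: "(s \<circ> \<sigma>) \<longlonglongrightarrow> l"
    using compact_cball[of c r] sD unfolding compact_def D_def by metis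
  define x where "x = s \<circ> \<sigma>"
  have xD: "x n \<in> D" for n by (simp add: x_def sD)
  have xl: "x \<longlonglongrightarrow> l" using lims by (simp add: x_def)
  have vx: "(\<lambda>n. v (x n)) \<longlonglongrightarrow> M"
  proof (rule tendsto_sandwich)
    show "\<forall>\<^sub>F n in sequentially. M - 1 / Suc n \<le> v (x n)"
    proof (intro always_eventually allI)
      fix n
      have "M - 1 / Suc n \<le> M - 1 / Suc (\<sigma> n)"
        using seq_suble[OF \<sigma>, of n] by (simp add: field_simps)
      then show "M - 1 / Suc n \<le> v (x n)"
        using sM[of "\<sigma> n"] by (simp add: x_def)
    qed
    show "\<forall>\<^sub>F n in sequentially. v (x n) \<le> M"
      using vM xD by (intro always_eventually) auto
    show "(\<lambda>n. M - 1 / real (Suc n)) \<longlonglongrightarrow> M"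
      using tendsto_diff[OF tendsto_const LIMSEQ_inverse_real_of_nat, of M] by (simp add: inverse_eq_divide)
  qed auto
  have wx: "(\<lambda>n. w (x n)) \<longlonglongrightarrow> w l"
    using isCont_tendsto_compose[OF wcont xl] .
  obtain \<rho> K where \<rho>: "\<rho> > 0" and K: "\<And>\<zeta>. \<zeta> \<in> ball l \<rho> \<Longrightarrow> u \<zeta> \<le> K"
    and sm: "\<And>\<zeta> t. \<zeta> \<in> ball l \<rho> \<Longrightarrow> 0 < t \<Longrightarrow> t \<le> \<rho> \<Longrightarrow> submean u \<zeta> t"
    using loc by metis
  have ev\<rho>: "\<forall>\<^sub>F n in sequentially. x n \<in> ball l t" if "t > 0" for t
    using xl that by (simp add: tendsto_iff dist_commute)
  \<comment> \<open>In the interior the strict submean inequality contradicts maximality. On the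
    circle off the line the bound by C / |Re z - \<omega>| applies, and at the two points on the
    line the factor w tends to 0.\<close>
  consider "l \<in> ball c r" | "cmod (l - c) = r" "Re l \<noteq> \<omega>" | "cmod (l - c) = r" "Re l = \<omega>"
    using l by (force simp: D_def dist_norm norm_minus_commute)
  then show False
  proof cases
    case 1
    \<comment> \<open>With x n within t of l, the circle of radius t about x n stays inside D
      because dist c l + 2 t is at most r.\<close>
    define t where "t = min \<rho> ((r - dist c l) / 2)"
    have t: "0 < t" "t \<le> \<rho>" "2 * t \<le> r - dist c l"
      using 1 \<rho> by (auto simp: t_def min_def field_simps)
    have "\<forall>\<^sub>F n in sequentially. v (x n) \<le> M * exp (- e * t\<^sup>2)"
      using ev\<rho>[OF t(1)]
    proof eventually_elim
      case (elim n)
      have "x n \<in> ball l \<rho>" using elim t by auto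
      then have "submean u (x n) t" using sm t by blast
      moreover have "v \<zeta> \<le> M" if "\<zeta> \<in> sphere (x n) t" for \<zeta>
      proof (rule vM)
        have "dist c \<zeta> \<le> dist c l + dist l (x n) + dist (x n) \<zeta>"
          by (smt (verit) dist_triangle)
        then show "\<zeta> \<in> D"
          using elim t that by (auto simp: D_def)
      qed
      ultimately show ?case
        unfolding v_def
        by (intro submean_exp_square[OF _ t(1) whol e]) auto
    qed
    then have "M \<le> M * exp (- e * t\<^sup>2)"
      by (rule tendsto_upperbound[OF vx]) simp
    moreover have "exp (- e * t\<^sup>2) < 1"
      using e t by simp
    ultimately show False
      using Mpos by (metis mult.right_neutral mult_less_cancel_left_pos not_less)
  next
    case 2
    have "cmod (w l) = 2 * \<bar>Re l - \<omega>\<bar> / r"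
    proof -
      define p q where "p = Re l - \<omega>" and "q = Im l"
      have lc: "l - c = Complex p q"
        by (simp add: p_def q_def c_def complex_eq_iff)
      have pq: "p\<^sup>2 + q\<^sup>2 = r\<^sup>2"
        using 2(1) unfolding lc by (metis cmod_power2 complex.sel)
      \<comment> \<open>On the circle r^2 is (l - c) times its conjugate, so r^2 + (l - c)^2 factors
        as (l - c) * 2 Re (l - c).\<close>
      have rr: "complex_of_real r * complex_of_real r = Complex p q * Complex p (-q)"
        using pq by (simp add: complex_eq_iff power2_eq_square)
      have "w l = (complex_of_real r * complex_of_real r + Complex p q * Complex p q) / (of_real r)\<^sup>2"
        unfolding w_def lc using r by (simp add: power2_eq_square field_simps)
      also have "\<dots> = Complex p q * of_real (2 * p) / (of_real r)\<^sup>2"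
        unfolding rr by (simp add: complex_eq_iff algebra_simps)
      finally have "cmod (w l) = r * (2 * \<bar>p\<bar>) / r\<^sup>2"
        using 2(1) r unfolding lc by (simp add: norm_mult norm_divide norm_power)
      then show ?thesis
        using r by (simp add: p_def power2_eq_square)
    qed
    moreover have "(\<lambda>n. cmod (w (x n)) * (C / \<bar>Re (x n) - \<omega>\<bar>) * exp (e * r\<^sup>2)) \<longlonglongrightarrow>
        cmod (w l) * (C / \<bar>Re l - \<omega>\<bar>) * exp (e * r\<^sup>2)"
      by (intro tendsto_intros wx xl) (use 2 in auto)
    ultimately have lim2: "(\<lambda>n. cmod (w (x n)) * (C / \<bar>Re (x n) - \<omega>\<bar>) * exp (e * r\<^sup>2)) \<longlonglongrightarrow>
        2 * C / r * exp (e * r\<^sup>2)"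
      using 2(2) by (simp add: field_simps)
    have "\<forall>\<^sub>F n in sequentially. v (x n) \<le> cmod (w (x n)) * (C / \<bar>Re (x n) - \<omega>\<bar>) * exp (e * r\<^sup>2)"
    proof -
      have "(\<lambda>n. Re (x n)) \<longlonglongrightarrow> Re l" by (intro tendsto_intros xl)
      then have "\<forall>\<^sub>F n in sequentially. Re (x n) \<noteq> \<omega>"
        using 2(2) by (rule tendsto_imp_eventually_ne)
      then show ?thesis
      proof eventually_elim
        case (elim n)
        show ?case unfolding v_def
          using bnd[OF elim] expD[OF xD[of n]] nonneg[of "x n"] C
          by (intro mult_mono mult_left_mono) auto
      qed
    qed
    then have "M \<le> 2 * C / r * exp (e * r\<^sup>2)"
      by (intro tendsto_le[OF _ lim2 vx]) auto
    then show False using Mgt by simp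
  next
    case 3
    have "w l = 0"
    proof -
      have lc: "l - c = \<i> * of_real (Im l)"
        using 3 by (simp add: c_def complex_eq_iff)
      then have "(Im l)\<^sup>2 = r\<^sup>2"
        using 3(1) by (metis norm_mult norm_ii norm_of_real mult_1 power2_abs)
      then have "(complex_of_real (Im l))\<^sup>2 = (of_real r)\<^sup>2"
        by (metis of_real_power)
      then show ?thesis
        unfolding w_def lc using r by (simp add: power_divide power_mult_distrib)
    qed
    then have "(\<lambda>n. cmod (w (x n)) * K * exp (e * r\<^sup>2)) \<longlonglongrightarrow> cmod 0 * K * exp (e * r\<^sup>2)"
      using wx by (intro tendsto_intros) simp
    then have lim3: "(\<lambda>n. cmod (w (x n)) * K * exp (e * r\<^sup>2)) \<longlonglongrightarrow> 0"
      by simp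
    have "\<forall>\<^sub>F n in sequentially. v (x n) \<le> cmod (w (x n)) * K * exp (e * r\<^sup>2)"
      using ev\<rho>[OF \<rho>]
    proof eventually_elim
      case (elim n)
      have "0 \<le> K" using K[OF elim] nonneg[of "x n"] by linarith
      then show ?case unfolding v_def
        using K[OF elim] expD[OF xD[of n]] nonneg[of "x n"]
        by (intro mult_mono mult_left_mono) auto
    qed
    then have "M \<le> 0"
      by (intro tendsto_le[OF _ lim3 vx]) auto
    then show False using Mpos by simp
  qed
qed

lemma log_subharmonic_eq_0:
  assumes sh: "log_subharmonic u" and nonneg: "\<And>z. 0 \<le> u z"
    and bnd: "\<And>z. Re z \<noteq> \<omega> \<Longrightarrow> u z \<le> C / \<bar>Re z - \<omega>\<bar>" and C: "0 \<le> C"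
  shows "u z = 0"
proof -
  define c where "c = complex_of_real \<omega>"
  have le: "cmod (1 + ((z - c) / of_real r)\<^sup>2) * u z \<le> 2 * C / r" if r: "cmod (z - c) < r" for r
  proof -
    have r0: "0 < r" using r norm_ge_zero le_less_trans by blast
    \<comment> \<open>The auxiliary exponential is removed first, at fixed r; only then may r tend
      to infinity, where the right-hand side is 2 C / r and the quadratic factor tends to 1.\<close>
    have lim1: "((\<lambda>e. 2 * C / r * exp (e * r\<^sup>2)) \<longlongrightarrow> 2 * C / r * exp (0 * r\<^sup>2)) (at_right 0)"
      by (intro tendsto_intros)
    have "\<forall>\<^sub>F e in at_right 0. cmod (1 + ((z - c) / of_real r)\<^sup>2) * u z \<le> 2 * C / r * exp (e * r\<^sup>2)"
      using eventually_at_right_less[of "0::real"]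
    proof eventually_elim
      case (elim e)
      have "cmod (1 + ((z - c) / of_real r)\<^sup>2) * u z \<le>
        cmod (1 + ((z - c) / of_real r)\<^sup>2) * u z * exp (e * (cmod (z - c))\<^sup>2)"
        using mult_left_mono[of 1 "exp (e * (cmod (z - c))\<^sup>2)" "cmod (1 + ((z - c) / of_real r)\<^sup>2) * u z"]
          nonneg[of z] elim by simp
      also have "\<dots> \<le> 2 * C / r * exp (e * r\<^sup>2)"
        using log_subharmonic_disc_bound[OF sh nonneg bnd r0 elim C, of z] r
        by (simp add: c_def dist_norm norm_minus_commute)
      finally show ?case .
    qed
    then show ?thesis
      using tendsto_lowerbound[OF lim1] by simp
  qed
  have "filterlim complex_of_real at_infinity at_top"
    by (rule filterlim_of_real_at_infinity)
  then have "((\<lambda>r. (z - c) / complex_of_real r) \<longlongrightarrow> 0) at_top"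
    by (intro tendsto_divide_0[OF tendsto_const])
  then have l1: "((\<lambda>r. cmod (1 + ((z - c) / complex_of_real r)\<^sup>2) * u z) \<longlongrightarrow> cmod (1 + 0\<^sup>2) * u z) at_top"
    by (intro tendsto_intros)
  have l2: "((\<lambda>r. 2 * C / r) \<longlongrightarrow> 0) at_top"
    by (rule tendsto_divide_0[OF tendsto_const]) (simp add: filterlim_at_top_imp_at_infinity filterlim_ident)
  have "cmod (1 + 0\<^sup>2) * u z \<le> 0"
    by (rule tendsto_le[OF _ l2 l1]) (use eventually_mono[OF eventually_gt_at_top le] in auto)
  then show ?thesis using nonneg[of z] by simp
qed

section \<open>The limit superior of norms as a seminorm\<close>

definition limsup_norm :: "(real \<Rightarrow> 'b :: real_normed_vector) \<Rightarrow> real" where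
  "limsup_norm F = Inf {c. 0 \<le> c \<and> (\<forall>\<^sub>F t in at_top. norm (F t) \<le> c)}"

lemma limsup_norm_le:
  assumes "0 \<le> c" "\<And>e. 0 < e \<Longrightarrow> \<forall>\<^sub>F t in at_top. norm (F t) \<le> c + e"
  shows "limsup_norm F \<le> c"
proof (rule field_le_epsilon)
  fix e :: real assume "0 < e"
  then show "limsup_norm F \<le> c + e"
    unfolding limsup_norm_def using assms
    by (intro cInf_lower bdd_belowI[of _ 0]) auto
qed

lemma limsup_norm_le_eventually:
  assumes "0 \<le> c" "\<forall>\<^sub>F t in at_top. norm (F t) \<le> c"
  shows "limsup_norm F \<le> c"
  by (rule limsup_norm_le[OF assms(1)]) (use assms(2) in \<open>auto elim: eventually_mono\<close>)

text \<open>The eventual bound guarantees that the set of admissible constants is nonempty; for an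
  unbounded family the infimum would be taken over the empty set and carry no information.\<close>

lemma limsup_norm_nonneg:
  assumes "\<forall>\<^sub>F t in at_top. norm (F t) \<le> K"
  shows "0 \<le> limsup_norm F"
  unfolding limsup_norm_def
proof (rule cInf_greatest)
  have "\<forall>\<^sub>F t in at_top. norm (F t) \<le> \<bar>K\<bar>"
    using assms by (auto elim: eventually_mono)
  then show "{c. 0 \<le> c \<and> (\<forall>\<^sub>F t in at_top. norm (F t) \<le> c)} \<noteq> {}"
    by (auto intro!: exI[of _ "\<bar>K\<bar>"])
qed auto

lemma eventually_limsup_norm:
  assumes "\<forall>\<^sub>F t in at_top. norm (F t) \<le> K" "0 < e"
  shows "\<forall>\<^sub>F t in at_top. norm (F t) \<le> limsup_norm F + e"
proof -
  let ?S = "{c. 0 \<le> c \<and> (\<forall>\<^sub>F t in at_top. norm (F t) \<le> c)}"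
  have "\<forall>\<^sub>F t in at_top. norm (F t) \<le> \<bar>K\<bar>"
    using assms by (auto elim: eventually_mono)
  then have "?S \<noteq> {}"
    by (auto intro!: exI[of _ "\<bar>K\<bar>"])
  moreover have "Inf ?S < limsup_norm F + e"
    using assms(2) by (simp add: limsup_norm_def)
  ultimately obtain c where "c \<in> ?S" "c < limsup_norm F + e"
    by (meson cInf_lessD)
  then show ?thesis by (auto elim: eventually_mono)
qed

lemma limsup_norm_diff_le:
  assumes "\<forall>\<^sub>F t in at_top. norm (F t) \<le> K" "((\<lambda>t. F t - G t) \<longlongrightarrow> 0) at_top"
  shows "limsup_norm G \<le> limsup_norm F"
proof (rule limsup_norm_le)
  show "0 \<le> limsup_norm F" using limsup_norm_nonneg assms(1) .
  fix e :: real assume e: "0 < e"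
  have "\<forall>\<^sub>F t in at_top. norm (F t - G t) < e/2"
    using tendstoD[OF assms(2), of "e/2"] e by simp
  moreover have "\<forall>\<^sub>F t in at_top. norm (F t) \<le> limsup_norm F + e/2"
    using eventually_limsup_norm[OF assms(1), of "e/2"] e by simp
  ultimately show "\<forall>\<^sub>F t in at_top. norm (G t) \<le> limsup_norm F + e"
  proof eventually_elim
    case (elim t)
    have "norm (G t) \<le> norm (F t) + norm (F t - G t)"
      by (metis norm_minus_commute norm_triangle_sub)
    then show ?case using elim by linarith
  qed
qed

lemma limsup_norm_cong:
  assumes "\<forall>\<^sub>F t in at_top. norm (F t) \<le> K" "\<forall>\<^sub>F t in at_top. norm (G t) \<le> K'"
    "((\<lambda>t. F t - G t) \<longlongrightarrow> 0) at_top"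
  shows "limsup_norm F = limsup_norm G"
proof (rule antisym)
  have "((\<lambda>t. G t - F t) \<longlongrightarrow> 0) at_top"
    using tendsto_minus[OF assms(3)] by simp
  then show "limsup_norm F \<le> limsup_norm G"
    using limsup_norm_diff_le assms(2) by blast
qed (rule limsup_norm_diff_le[OF assms(1,3)])

text \<open>The number M of nodes is chosen before t. Only finitely many eventual inequalities, one
  per node, must then hold at the same time, and the triangle inequality for the finite mean passes
  to the limit superior.\<close>

lemma submean_limsup_norm:
  fixes \<Phi> :: "complex \<Rightarrow> real \<Rightarrow> 'b :: complex_normed_vector"
  assumes bounded: "\<And>\<zeta>. \<zeta> \<in> insert z (sphere z r) \<Longrightarrow> \<exists>K. \<forall>\<^sub>F t in at_top. norm (\<Phi> \<zeta> t) \<le> K"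
    and r: "0 < r"
    and mean: "\<And>g e. g holomorphic_on UNIV \<Longrightarrow> 0 < e \<Longrightarrow>
      \<exists>M>0. \<forall>\<^sub>F t in at_top. norm (circle_mean M r z (\<lambda>\<zeta>. g \<zeta> *\<^sub>C \<Phi> \<zeta> t) - g z *\<^sub>C \<Phi> z t) \<le> e"
    and u: "\<And>\<zeta>. \<zeta> \<in> insert z (sphere z r) \<Longrightarrow> u \<zeta> = limsup_norm (\<Phi> \<zeta>)"
  shows "submean u z r"
  unfolding submean_def
proof (intro allI impI)
  fix g B assume g: "g holomorphic_on UNIV" and B: "\<forall>\<zeta>\<in>sphere z r. cmod (g \<zeta>) * u \<zeta> \<le> B"
  have Bnn: "0 \<le> B"
  proof -
    have "z + of_real r \<in> sphere z r" using r by (simp add: dist_norm)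
    moreover from this have "0 \<le> u (z + of_real r)"
      using u bounded limsup_norm_nonneg by (metis insertCI)
    ultimately show ?thesis using B
      by (meson mult_nonneg_nonneg norm_ge_zero order_trans)
  qed
  show "cmod (g z) * u z \<le> B"
  proof (rule field_le_epsilon)
    fix e :: real assume e: "0 < e"
    obtain M where M: "0 < M" and mM: "\<forall>\<^sub>F t in at_top.
      norm (circle_mean M r z (\<lambda>\<zeta>. g \<zeta> *\<^sub>C \<Phi> \<zeta> t) - g z *\<^sub>C \<Phi> z t) \<le> e/2"
      using mean[OF g, of "e/2"] e by auto
    define zj where "zj j = z + of_real r * cis (2 * pi * real j / real M)" for j
    have zj: "zj j \<in> sphere z r" for j
      using r by (simp add: zj_def dist_norm norm_mult)
    have "\<forall>\<^sub>F t in at_top. cmod (g (zj j)) * norm (\<Phi> (zj j) t) \<le> B + e/2" for j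
    proof -
      \<comment> \<open>Chosen so that the weight times d is at most e/2; the added 1 keeps the
        denominator positive when the weight vanishes at the node.\<close>
      define d where "d = e / (2 * (cmod (g (zj j)) + 1))"
      have cp: "0 < cmod (g (zj j)) + 1" by (smt (verit) norm_ge_zero)
      have d: "0 < d" using e cp unfolding d_def by auto
      obtain K where "\<forall>\<^sub>F t in at_top. norm (\<Phi> (zj j) t) \<le> K"
        using bounded zj by blast
      from eventually_limsup_norm[OF this d]
      show ?thesis
      proof eventually_elim
        case (elim t)
        have "cmod (g (zj j)) * norm (\<Phi> (zj j) t) \<le> cmod (g (zj j)) * (u (zj j) + d)"
          using elim u zj by (intro mult_left_mono) auto
        also have "\<dots> = cmod (g (zj j)) * u (zj j) + cmod (g (zj j)) * d"
          by (simp add: algebra_simps)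
        also have "\<dots> \<le> B + e/2"
        proof (rule add_mono)
          show "cmod (g (zj j)) * u (zj j) \<le> B" using B zj by blast
          have "cmod (g (zj j)) * d \<le> (cmod (g (zj j)) + 1) * d" using d by simp
          also have "\<dots> = e/2" using cp by (simp add: d_def divide_simps)
          finally show "cmod (g (zj j)) * d \<le> e/2" .
        qed
        finally show ?case .
      qed
    qed
    then have "\<forall>\<^sub>F t in at_top. \<forall>j\<in>{..<M}. cmod (g (zj j)) * norm (\<Phi> (zj j) t) \<le> B + e/2"
      by (intro eventually_ball_finite) auto
    then have ev: "\<forall>\<^sub>F t in at_top. cmod (g z) * norm (\<Phi> z t) \<le> B + e"
      using mM
    proof eventually_elim
      case (elim t)
      have "norm (circle_mean M r z (\<lambda>\<zeta>. g \<zeta> *\<^sub>C \<Phi> \<zeta> t)) \<le> (1 / real M) * (\<Sum>j<M. B + e/2)"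
      proof -
        have "norm (\<Sum>j<M. g (zj j) *\<^sub>C \<Phi> (zj j) t) \<le> (\<Sum>j<M. B + e/2)"
          by (rule sum_norm_le) (use elim(1) in \<open>simp add: norm_scaleC\<close>)
        then show ?thesis
          unfolding circle_mean_def norm_scaleR zj_def[symmetric]
          by (intro mult_mono) auto
      qed
      also have "\<dots> = B + e/2" using M by simp
      finally have "norm (g z *\<^sub>C \<Phi> z t) \<le> B + e/2 + e/2"
        using elim(2) by (smt (verit) norm_minus_commute norm_triangle_sub)
      then show ?case by (simp add: norm_scaleC)
    qed
    show "cmod (g z) * u z \<le> B + e"
    proof (cases "g z = 0")
      case True
      then show ?thesis using Bnn e by simp
    next
      case False
      have "limsup_norm (\<Phi> z) \<le> (B + e) / cmod (g z)"
      proof (rule limsup_norm_le)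
        show "0 \<le> (B + e) / cmod (g z)" using Bnn e by simp
        fix d :: real assume "0 < d"
        show "\<forall>\<^sub>F t in at_top. norm (\<Phi> z t) \<le> (B + e) / cmod (g z) + d"
          using ev
        proof eventually_elim
          case (elim t)
          then have "norm (\<Phi> z t) \<le> (B + e) / cmod (g z)"
            using False by (simp add: field_simps)
          then show ?case using \<open>0 < d\<close> by linarith
        qed
      qed
      then show ?thesis
        using u False by (simp add: field_simps)
    qed
  qed
qed

section \<open>Complex scalars\<close>

lemma bounded_bilinear_scaleC:
  "bounded_bilinear (scaleC :: complex \<Rightarrow> 'b :: complex_normed_vector \<Rightarrow> 'b)"
proof
  fix a b :: complex and x y :: 'b and r :: real
  show "(a + b) *\<^sub>C x = a *\<^sub>C x + b *\<^sub>C x" by (rule scaleC_add_left)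
  show "a *\<^sub>C (x + y) = a *\<^sub>C x + a *\<^sub>C y" by (rule scaleC_add_right)
  show "(r *\<^sub>R a) *\<^sub>C x = r *\<^sub>R a *\<^sub>C x"
    by (simp add: scaleR_conv_of_real scaleC_scaleC[symmetric] scaleC_of_real)
  show "a *\<^sub>C r *\<^sub>R x = r *\<^sub>R a *\<^sub>C x"
    by (metis scaleC_of_real scaleC_scaleC mult.commute)
  show "\<exists>K. \<forall>a (x::'b). norm (a *\<^sub>C x) \<le> norm a * norm x * K"
    by (rule exI[of _ 1]) (simp add: norm_scaleC)
qed

interpretation scaleC: bounded_bilinear "scaleC :: complex \<Rightarrow> 'b :: complex_normed_vector \<Rightarrow> 'b"
  by (rule bounded_bilinear_scaleC)

lemmas tendsto_scaleC [tendsto_intros] = scaleC.tendsto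
  and continuous_on_scaleC [continuous_intros] = scaleC.continuous_on
  and has_vector_derivative_scaleC = scaleC.has_vector_derivative

lemma scaleC_one [simp]: "1 *\<^sub>C x = (x :: 'b :: complex_normed_vector)"
  using scaleC_of_real[of 1 x] by simp

lemma scaleC_scaleR_commute: "a *\<^sub>C r *\<^sub>R x = r *\<^sub>R a *\<^sub>C (x :: 'b :: complex_normed_vector)"
  by (rule scaleC.scaleR_right)

lemma blinfun_scaleC_apply [simp]: "blinfun_apply (c *\<^sub>C F) x = c *\<^sub>C blinfun_apply F x"
  by (simp add: scaleC_blinfun.rep_eq)

lemma complex_linear_scaleC: "complex_linear F \<Longrightarrow> blinfun_apply F (c *\<^sub>C x) = c *\<^sub>C blinfun_apply F x"
  by (simp add: complex_linear_def)

lemma complex_linear_compose_scaleC: "complex_linear F \<Longrightarrow> F o\<^sub>L (c *\<^sub>C G) = c *\<^sub>C (F o\<^sub>L G)"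
  by (rule blinfun_eqI) (simp add: complex_linear_scaleC)

lemma scaleC_compose: "(c *\<^sub>C F) o\<^sub>L G = c *\<^sub>C (F o\<^sub>L G)"
  by (rule blinfun_eqI) simp

section \<open>Semigroups dominated by a scalar function\<close>

text \<open>Connects derivatives supplied by the fundamental theorem of calculus with the one-sided
  difference quotients that define the generator.\<close>

lemma has_vector_derivative_imp_at_right:
  fixes W :: "real \<Rightarrow> 'b :: real_normed_vector"
  assumes "(W has_vector_derivative W') (at u within {0..b})" "0 \<le> u" "u < b"
  shows "((\<lambda>h. (W (u + h) - W u) /\<^sub>R h) \<longlongrightarrow> W') (at_right 0)"
proof -
  have *: "((\<lambda>y. norm (W y - W u - (y - u) *\<^sub>R W') / norm (y - u)) \<longlongrightarrow> 0) (at u within {0..b})"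
    using assms(1) tendsto_norm_zero
    by (fastforce simp: has_vector_derivative_def has_derivative_within diff_diff_eq)
  have "filterlim (\<lambda>h. u + h) (at u within {0..b}) (at_right 0)"
    unfolding filterlim_at
  proof
    show "\<forall>\<^sub>F h in at_right 0. u + h \<in> {0..b} \<and> u + h \<noteq> u"
      using eventually_at_right_real[of 0 "b - u"] assms(2,3)
      by (auto elim: eventually_mono)
    show "((\<lambda>h. u + h) \<longlongrightarrow> u) (at_right 0)"
      using tendsto_add[OF tendsto_const tendsto_ident_at, of u 0 "{0<..}"] by simp
  qed
  from filterlim_compose[OF * this]
  have "((\<lambda>h. norm (W (u + h) - W u - h *\<^sub>R W') / norm h) \<longlongrightarrow> 0) (at_right 0)"
    by simp
  then have "((\<lambda>h. norm ((W (u + h) - W u) /\<^sub>R h - W')) \<longlongrightarrow> 0) (at_right 0)"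
  proof (rule Lim_transform_eventually)
    show "\<forall>\<^sub>F h in at_right 0. norm (W (u + h) - W u - h *\<^sub>R W') / norm h = norm ((W (u + h) - W u) /\<^sub>R h - W')"
      using eventually_at_right_less[of "0::real"]
    proof eventually_elim
      case (elim h)
      have "(W (u + h) - W u) /\<^sub>R h - W' = (W (u + h) - W u - h *\<^sub>R W') /\<^sub>R h"
        using elim by (simp add: algebra_simps)
      then show ?case by (simp add: divide_inverse_commute)
    qed
  qed
  then show ?thesis
    using Lim_null tendsto_norm_zero_iff by blast
qed

text \<open>The bound does not involve the length t of the interval, which is what allows t to tend
  to infinity later.\<close>

lemma integral_exp_bound:
  fixes F :: "real \<Rightarrow> 'b :: banach"
  assumes "continuous_on {0..t} F" "0 < \<kappa>" "0 \<le> t" "\<And>s. s \<in> {0..t} \<Longrightarrow> norm (F s) \<le> G * exp (- \<kappa> * s)"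
  shows "norm (integral {0..t} F) \<le> G / \<kappa>"
proof -
  have "0 \<le> norm (F 0)" by simp
  also have "\<dots> \<le> G" using assms(4)[of 0] assms(3) by simp
  finally have G: "0 \<le> G" .
  have "((\<lambda>s. G * exp (- \<kappa> * s)) has_integral (G * (- exp (- \<kappa> * t) / \<kappa>) - G * (- exp (- \<kappa> * 0) / \<kappa>))) {0..t}"
  proof (rule fundamental_theorem_of_calculus)
    fix s assume "s \<in> {0..t}"
    show "((\<lambda>s. G * (- exp (- \<kappa> * s) / \<kappa>)) has_vector_derivative G * exp (- \<kappa> * s)) (at s within {0..t})"
      unfolding has_real_derivative_iff_has_vector_derivative[symmetric]
      using assms(2) by (auto intro!: derivative_eq_intros)
  qed (rule assms)
  then have hi: "((\<lambda>s. G * exp (- \<kappa> * s)) has_integral (G * (1 - exp (- \<kappa> * t)) / \<kappa>)) {0..t}"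
    by (simp add: diff_divide_distrib right_diff_distrib)
  have "norm (integral {0..t} F) \<le> integral {0..t} (\<lambda>s. G * exp (- \<kappa> * s))"
    by (rule integral_norm_bound_integral)
      (use assms hi in \<open>auto intro: integrable_continuous_real\<close>)
  also have "\<dots> = G * (1 - exp (- \<kappa> * t)) / \<kappa>"
    using hi by (rule integral_unique)
  also have "\<dots> \<le> G / \<kappa>"
    using assms(2) G by (intro divide_right_mono mult_left_le) auto
  finally show ?thesis .
qed

lemma integral_exp_bound':
  fixes F :: "real \<Rightarrow> 'b :: banach"
  assumes "continuous_on {0..t} F" "0 < \<kappa>" "0 \<le> t" "\<And>s. s \<in> {0..t} \<Longrightarrow> norm (F s) \<le> G * exp (- \<kappa> * (t - s))"
  shows "norm (integral {0..t} F) \<le> G / \<kappa>"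
proof -
  have "integral {0..t} F = integral {0..t} (\<lambda>s. F (t - s))"
  proof -
    have "integral {0..t} (\<lambda>s. F (t - s)) = integral {-t..0} (\<lambda>s. F (t + s))"
      using Henstock_Kurzweil_Integration.integral_reflect_real[of 0 "-t" "\<lambda>s. F (t + s)"] by simp
    also have "\<dots> = integral {0..t} F"
      using integral_shift_real_ivl[of 0 t t F] by (simp add: add.commute)
    finally show ?thesis by simp
  qed
  also have "norm \<dots> \<le> G / \<kappa>"
  proof (rule integral_exp_bound[OF _ assms(2,3)])
    show "continuous_on {0..t} (\<lambda>s. F (t - s))"
      by (rule continuous_on_compose2[OF assms(1)]) (auto intro!: continuous_intros)
  qed (use assms(4)[of "t - _"] in auto)
  finally show ?thesis .
qed

text \<open>The two slope conditions express the consequences of log-concavity in multiplicative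
  form: increments of log f have slope at least \<omega> everywhere and at most \<omega> +
  \<epsilon> from some time on.\<close>

locale dominated_semigroup =
  fixes T :: "real \<Rightarrow> 'a :: complex_banach \<Rightarrow>\<^sub>L 'a" and f :: "real \<Rightarrow> real" and \<omega> :: real
  assumes semigroup: "C0_semigroup T"
    and f_pos: "0 \<le> t \<Longrightarrow> 0 < f t"
    and T_le: "0 \<le> t \<Longrightarrow> norm (T t) \<le> f t"
    and f_lower: "0 \<le> s \<Longrightarrow> s \<le> t \<Longrightarrow> f s * exp (\<omega> * (t - s)) \<le> f t"
    and f_upper: "0 < \<epsilon> \<Longrightarrow> \<exists>s\<^sub>0\<ge>0. \<forall>s\<ge>s\<^sub>0. \<forall>t\<ge>s. f t \<le> f s * exp ((\<omega> + \<epsilon>) * (t - s))"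
begin

lemma T_0 [simp]: "T 0 = id_blinfun"
  and T_add: "0 \<le> s \<Longrightarrow> 0 \<le> t \<Longrightarrow> T (s + t) = T s o\<^sub>L T t"
  and T_linear: "0 \<le> t \<Longrightarrow> complex_linear (T t)"
  and T_at_0: "((\<lambda>t. blinfun_apply (T t) x) \<longlongrightarrow> x) (at_right 0)"
  using semigroup by (auto simp: C0_semigroup_def)

lemma T_apply_le: "0 \<le> t \<Longrightarrow> norm (T t x) \<le> f t * norm x"
  using T_le[of t] norm_blinfun[of "T t" x] mult_right_mono[of "norm (T t)" "f t" "norm x"] by simp

lemma T_commute: "0 \<le> s \<Longrightarrow> 0 \<le> t \<Longrightarrow> T s (T t x) = T t (T s x)"
  using T_add[of s t] T_add[of t s] by (metis add.commute blinfun_apply_blinfun_compose)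

text \<open>As \<omega> may be negative, f need not increase; the factor exp(|\<omega>| b) absorbs
  the possible decay over the interval. This bounds the semigroup uniformly on compact time
  intervals.\<close>

lemma f_le_on_interval: "0 \<le> s \<Longrightarrow> s \<le> b \<Longrightarrow> f s \<le> f b * exp (\<bar>\<omega>\<bar> * b)"
proof -
  assume s: "0 \<le> s" "s \<le> b"
  have "f s \<le> f s * exp (\<omega> * (b - s)) * exp (\<bar>\<omega>\<bar> * b)"
  proof -
    have "0 \<le> \<omega> * (b - s) + \<bar>\<omega>\<bar> * b"
      using s mult_right_mono[of "-\<bar>\<omega>\<bar>" \<omega> "b - s"] mult_left_mono[of "b - s" b "\<bar>\<omega>\<bar>"]
        abs_ge_minus_self[of \<omega>] by simp
    then have "1 \<le> exp (\<omega> * (b - s)) * exp (\<bar>\<omega>\<bar> * b)"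
      by (simp add: exp_add[symmetric])
    then show ?thesis
      using f_pos[OF s(1)] by (simp add: mult.assoc)
  qed
  also have "\<dots> \<le> f b * exp (\<bar>\<omega>\<bar> * b)"
    using f_lower[OF s] by simp
  finally show ?thesis .
qed

lemma T_diff_le:
  assumes "0 \<le> s" "s \<le> t" "t \<le> b"
  shows "norm (T t x - T s x) \<le> f b * exp (\<bar>\<omega>\<bar> * b) * norm (T (t - s) x - x)"
proof -
  have "T t x = T s (T (t - s) x)"
    using T_add[of s "t - s"] assms by simp
  then have "norm (T t x - T s x) = norm (T s (T (t - s) x - x))"
    by (simp add: blinfun.diff_right)
  also have "\<dots> \<le> f s * norm (T (t - s) x - x)"
    by (rule T_apply_le) (rule assms)
  also have "\<dots> \<le> f b * exp (\<bar>\<omega>\<bar> * b) * norm (T (t - s) x - x)"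
    by (intro mult_right_mono f_le_on_interval) (use assms in auto)
  finally show ?thesis .
qed

lemma continuous_on_T: "continuous_on {0..} (\<lambda>t. T t x)"
  unfolding continuous_on_iff
proof (intro ballI allI impI)
  fix t e :: real assume t: "t \<in> {0..}" and e: "0 < e"
  \<comment> \<open>Admissible times s satisfy |s - t| < 1, so [0, t + 1] contains both; C bounds
    the operator split off at the earlier of the two times.\<close>
  define C where "C = f (t + 1) * exp (\<bar>\<omega>\<bar> * (t + 1))"
  have C: "0 < C" using f_pos[of "t + 1"] t by (simp add: C_def)
  have "\<forall>\<^sub>F h in at_right 0. dist (T h x) x < e / C"
    using tendstoD[OF T_at_0] e C by simp
  then obtain d where d: "0 < d" "\<And>h. 0 < h \<Longrightarrow> h < d \<Longrightarrow> dist (T h x) x < e / C"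
    by (auto simp: eventually_at_right_field)
  have d': "norm (T h x - x) < e / C" if "0 \<le> h" "h < d" for h
    using d(2)[of h] that e C by (cases "h = 0") (auto simp: dist_norm)
  show "\<exists>d>0. \<forall>s\<in>{0..}. dist s t < d \<longrightarrow> dist (T s x) (T t x) < e"
  proof (intro exI[of _ "min d 1"] conjI ballI impI)
    show "0 < min d 1" using d by simp
    fix s assume s: "s \<in> {0..}" "dist s t < min d 1"
    have "norm (T s x - T t x) \<le> C * norm (T \<bar>s - t\<bar> x - x)"
    proof (cases "s \<le> t")
      case True
      then show ?thesis
        using T_diff_le[of s t "t + 1" x] s t by (simp add: C_def norm_minus_commute)
    next
      case False
      then show ?thesis
        using T_diff_le[of t s "t + 1" x] s t by (simp add: C_def dist_norm)
    qed
    also have "\<dots> < C * (e / C)"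
      using d'[of "\<bar>s - t\<bar>"] s C by (intro mult_strict_left_mono) (auto simp: dist_norm)
    finally show "dist (T s x) (T t x) < e"
      using C by (simp add: dist_norm)
  qed
qed

lemma continuous_on_T_interval [continuous_intros]: "continuous_on {0..t} (\<lambda>s. T s x)"
  by (rule continuous_on_subset[OF continuous_on_T]) auto

section \<open>Convolutions of the semigroup with scalar kernels\<close>

definition conv :: "(real \<Rightarrow> complex) \<Rightarrow> real \<Rightarrow> 'a \<Rightarrow>\<^sub>L 'a" where
  "conv k t = Blinfun (\<lambda>x. integral {0..t} (\<lambda>s. k (t - s) *\<^sub>C T s x))"

lemma continuous_on_conv_integrand:
  assumes "continuous_on UNIV k"
  shows "continuous_on {0..t} (\<lambda>s. k (t - s) *\<^sub>C T s x)"
  by (intro continuous_intros continuous_on_compose2[OF assms]) auto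

text \<open>The semigroup is only strongly continuous, so the integral is formed vector by vector.
  The bound on compact time intervals shows the result to be a bounded operator, which gives
  \<open>Blinfun\<close> in the definition its intended meaning.\<close>

lemma conv_apply:
  assumes k: "continuous_on UNIV k" and t: "0 \<le> t"
  shows "conv k t x = integral {0..t} (\<lambda>s. k (t - s) *\<^sub>C T s x)"
proof -
  have int: "(\<lambda>s. k (t - s) *\<^sub>C T s x) integrable_on {0..t}" for x
    by (intro integrable_continuous_real continuous_on_conv_integrand k)
  have "bounded (k ` {0..t})"
    by (intro compact_imp_bounded compact_continuous_image continuous_on_subset[OF k]) auto
  then obtain B where B: "\<And>s. s \<in> {0..t} \<Longrightarrow> cmod (k s) \<le> B"
    by (metis bounded_iff imageI)
  have "bounded_linear (\<lambda>x. integral {0..t} (\<lambda>s. k (t - s) *\<^sub>C T s x))"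
  proof (rule bounded_linear_intro)
    fix x y
    show "integral {0..t} (\<lambda>s. k (t - s) *\<^sub>C T s (x + y)) =
      integral {0..t} (\<lambda>s. k (t - s) *\<^sub>C T s x) + integral {0..t} (\<lambda>s. k (t - s) *\<^sub>C T s y)"
      by (simp add: blinfun.add_right scaleC_add_right integral_add int)
    fix r :: real
    show "integral {0..t} (\<lambda>s. k (t - s) *\<^sub>C T s (r *\<^sub>R x)) =
      r *\<^sub>R integral {0..t} (\<lambda>s. k (t - s) *\<^sub>C T s x)"
      by (simp add: blinfun.scaleR_right scaleC_scaleR_commute)
    have "norm (integral {0..t} (\<lambda>s. k (t - s) *\<^sub>C T s x)) \<le>
      (B * (f t * exp (\<bar>\<omega>\<bar> * t)) * norm x) * (t - 0)"
    proof (rule integral_bound)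
      fix s assume s: "s \<in> {0..t}"
      have "norm (k (t - s) *\<^sub>C T s x) \<le> B * ((f t * exp (\<bar>\<omega>\<bar> * t)) * norm x)"
        unfolding norm_scaleC
        by (intro mult_mono order_trans[OF T_apply_le] mult_right_mono f_le_on_interval)
          (use s B[of "t - s"] order_trans[OF norm_ge_zero B[of "t - s"]] in auto)
      then show "norm (k (t - s) *\<^sub>C T s x) \<le> B * (f t * exp (\<bar>\<omega>\<bar> * t)) * norm x"
        by (simp add: mult.assoc)
    qed (use t k continuous_on_conv_integrand in auto)
    then show "norm (integral {0..t} (\<lambda>s. k (t - s) *\<^sub>C T s x)) \<le>
      norm x * ((B * (f t * exp (\<bar>\<omega>\<bar> * t))) * t)"
      by (simp add: mult_ac)
  qed
  then show ?thesis
    by (simp add: conv_def bounded_linear_Blinfun_apply)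
qed

lemma T_conv:
  assumes k: "continuous_on UNIV k" and t: "0 \<le> t" and h: "0 \<le> h"
  shows "T h (conv k t x) = integral {0..t} (\<lambda>s. k (t - s) *\<^sub>C T (h + s) x)"
proof -
  have "T h (conv k t x) = integral {0..t} (blinfun_apply (T h) \<circ> (\<lambda>s. k (t - s) *\<^sub>C T s x))"
    unfolding conv_apply[OF k t]
    by (intro integral_linear[symmetric] integrable_continuous_real continuous_on_conv_integrand k
        blinfun.bounded_linear_right)
  also have "\<dots> = integral {0..t} (\<lambda>s. k (t - s) *\<^sub>C T (h + s) x)"
    by (rule integral_cong) (use h in \<open>simp add: complex_linear_scaleC T_linear T_add\<close>)
  finally show ?thesis .
qed

lemma conv_T:
  assumes k: "continuous_on UNIV k" and t: "0 \<le> t" and h: "0 \<le> h"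
  shows "conv k t (T h x) = T h (conv k t x)"
proof -
  have "conv k t (T h x) = integral {0..t} (\<lambda>s. k (t - s) *\<^sub>C T (h + s) x)"
    unfolding conv_apply[OF k t]
    by (rule integral_cong) (use h in \<open>simp add: T_add T_commute\<close>)
  then show ?thesis by (simp add: T_conv[OF assms])
qed

section \<open>The generator on its domain\<close>

definition D where "D = fst (generator T)"
definition A where "A = snd (generator T)"

lemma generatorI:
  assumes "((\<lambda>h. (T h x - x) /\<^sub>R h) \<longlongrightarrow> y) (at_right 0)"
  shows "x \<in> D" "A x = y"
  using assms tendsto_Lim[OF trivial_limit_at_right_real assms]
  by (auto simp: D_def A_def generator_def)

lemma generatorD:
  assumes "x \<in> D"
  shows "((\<lambda>h. (T h x - x) /\<^sub>R h) \<longlongrightarrow> A x) (at_right 0)"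
  using assms generatorI(2) by (auto simp: D_def generator_def)

lemma A_scaleC: "x \<in> D \<Longrightarrow> c *\<^sub>C x \<in> D \<and> A (c *\<^sub>C x) = c *\<^sub>C A x"
proof -
  assume "x \<in> D"
  then have "((\<lambda>h. c *\<^sub>C ((T h x - x) /\<^sub>R h)) \<longlongrightarrow> c *\<^sub>C A x) (at_right 0)"
    by (intro tendsto_intros generatorD)
  moreover have "\<forall>\<^sub>F h in at_right 0. c *\<^sub>C ((T h x - x) /\<^sub>R h) = (T h (c *\<^sub>C x) - c *\<^sub>C x) /\<^sub>R h"
    using eventually_at_right_less[of "0::real"]
    by eventually_elim (simp add: scaleC_scaleR_commute scaleC.diff_right complex_linear_scaleC T_linear)
  ultimately have "((\<lambda>h. (T h (c *\<^sub>C x) - c *\<^sub>C x) /\<^sub>R h) \<longlongrightarrow> c *\<^sub>C A x) (at_right 0)"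
    by (rule Lim_transform_eventually)
  then show ?thesis using generatorI by blast
qed

lemma A_T: "x \<in> D \<Longrightarrow> 0 \<le> t \<Longrightarrow> T t x \<in> D \<and> A (T t x) = T t (A x)"
proof -
  assume "x \<in> D" and t: "0 \<le> t"
  then have "((\<lambda>h. T t ((T h x - x) /\<^sub>R h)) \<longlongrightarrow> T t (A x)) (at_right 0)"
    by (intro blinfun.tendsto tendsto_const generatorD)
  moreover have "\<forall>\<^sub>F h in at_right 0. T t ((T h x - x) /\<^sub>R h) = (T h (T t x) - T t x) /\<^sub>R h"
    using eventually_at_right_less[of "0::real"]
    by eventually_elim (use t in \<open>simp add: blinfun.scaleR_right blinfun.diff_right T_commute\<close>)
  ultimately have "((\<lambda>h. (T h (T t x) - T t x) /\<^sub>R h) \<longlongrightarrow> T t (A x)) (at_right 0)"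
    by (rule Lim_transform_eventually)
  then show ?thesis using generatorI by blast
qed

section \<open>Truncated Laplace integrals\<close>

definition E :: "complex \<Rightarrow> real \<Rightarrow> 'a \<Rightarrow>\<^sub>L 'a" where
  "E z t = conv (\<lambda>s. exp (z * of_real s)) t"

lemma continuous_on_exp_kernel: "continuous_on UNIV (\<lambda>s. exp (z * complex_of_real s))"
  by (intro continuous_intros)

lemma E_apply: "0 \<le> t \<Longrightarrow> E z t x = integral {0..t} (\<lambda>s. exp (z * of_real (t - s)) *\<^sub>C T s x)"
  unfolding E_def by (rule conv_apply[OF continuous_on_exp_kernel])

text \<open>Pulling exp(z t) out of the integral leaves an integrand without t, and the product rule
  yields the inhomogeneous equation E' = z E + T.\<close>

lemma has_vector_derivative_E:
  assumes "0 \<le> u" "u \<le> b"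
  shows "((\<lambda>t. E z t x) has_vector_derivative z *\<^sub>C E z u x + T u x) (at u within {0..b})"
proof -
  define F where "F t = integral {0..t} (\<lambda>s. exp (- z * of_real s) *\<^sub>C T s x)" for t
  have EF: "E z t x = exp (z * of_real t) *\<^sub>C F t" if "0 \<le> t" for t
  proof -
    have "exp (z * of_real t) *\<^sub>C F t = integral {0..t} ((\<lambda>y. exp (z * of_real t) *\<^sub>C y) \<circ> (\<lambda>s. exp (- z * of_real s) *\<^sub>C T s x))"
      unfolding F_def by (intro integral_linear[symmetric] integrable_continuous_real scaleC.bounded_linear_right continuous_intros)
    also have "\<dots> = E z t x"
      unfolding E_apply[OF that] by (rule integral_cong) (simp add: scaleC_scaleC exp_add[symmetric] algebra_simps)
    finally show ?thesis by simp
  qed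
  have F': "(F has_vector_derivative exp (- z * of_real u) *\<^sub>C T u x) (at u within {0..b})"
    unfolding F_def by (rule integral_has_vector_derivative) (use assms in \<open>auto intro!: continuous_intros\<close>)
  have ex: "((\<lambda>t. exp (z * of_real t)) has_vector_derivative z * exp (z * of_real u)) (at u within {0..b})"
    by (rule has_vector_derivative_real_field) (auto intro!: derivative_eq_intros)
  have "((\<lambda>t. exp (z * of_real t) *\<^sub>C F t) has_vector_derivative
      exp (z * of_real u) *\<^sub>C (exp (- z * of_real u) *\<^sub>C T u x) + (z * exp (z * of_real u)) *\<^sub>C F u) (at u within {0..b})"
    by (rule has_vector_derivative_scaleC[OF ex F'])
  also have "exp (z * of_real u) *\<^sub>C (exp (- z * of_real u) *\<^sub>C T u x) + (z * exp (z * of_real u)) *\<^sub>C F u =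
      z *\<^sub>C E z u x + T u x"
    using assms by (simp add: EF scaleC_scaleC exp_add[symmetric])
  finally show ?thesis
    by (rule has_vector_derivative_transform[rotated -1]) (use assms in \<open>auto simp: EF\<close>)
qed

text \<open>Shifting the integration variable by h turns T(h) E(z,t) into the integral over
  [h, t + h], that is, the full integral over [0, t + h] minus its initial piece.\<close>

lemma T_E:
  assumes "0 \<le> h" "0 \<le> t"
  shows "T h (E z t x) = E z (t + h) x - exp (z * of_real t) *\<^sub>C E z h x"
proof -
  let ?k = "\<lambda>s. exp (z * of_real (t + h - s)) *\<^sub>C T s x"
  have int: "?k integrable_on {0..t + h}"
    by (intro integrable_continuous_real continuous_intros)
  have "T h (E z t x) = integral {0..t} (\<lambda>s. ?k (s + h))"
    unfolding E_def T_conv[OF continuous_on_exp_kernel assms(2,1)]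
    by (rule integral_cong) (simp add: algebra_simps)
  also have "\<dots> = integral {h..t + h} ?k"
    using integral_shift_real_ivl[of h h "t + h" ?k] by simp
  also have "\<dots> = integral {0..t + h} ?k - integral {0..h} ?k"
    using Henstock_Kurzweil_Integration.integral_combine[of 0 h "t + h" ?k] int assms by (simp add: algebra_simps)
  also have "integral {0..t + h} ?k = E z (t + h) x"
    using assms by (simp add: E_apply)
  also have "integral {0..h} ?k = integral {0..h} ((\<lambda>y. exp (z * of_real t) *\<^sub>C y) \<circ> (\<lambda>s. exp (z * of_real (h - s)) *\<^sub>C T s x))"
    by (rule integral_cong) (simp add: scaleC_scaleC exp_add[symmetric] algebra_simps)
  also have "\<dots> = exp (z * of_real t) *\<^sub>C E z h x"
    unfolding E_apply[OF assms(1)]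
    by (intro integral_linear integrable_continuous_real scaleC.bounded_linear_right continuous_intros)
  finally show ?thesis .
qed

text \<open>Divide the shift identity for T(h) E(z,t) by h: one part is the t-derivative of E, the
  other the derivative of E at 0 multiplied by exp(z t). The outcome (A - z) E(z,t) = T(t) - exp(z
  t) holds for every z, without reference to the spectrum.\<close>

lemma E_generator:
  assumes "0 \<le> t"
  shows "E z t x \<in> D" "A (E z t x) = z *\<^sub>C E z t x + T t x - exp (z * of_real t) *\<^sub>C x"
proof -
  have d1: "((\<lambda>h. (E z (t + h) x - E z t x) /\<^sub>R h) \<longlongrightarrow> z *\<^sub>C E z t x + T t x) (at_right 0)"
    by (rule has_vector_derivative_imp_at_right[OF has_vector_derivative_E[of t "t + 1"]]) (use assms in auto)
  have E0: "E z 0 x = 0"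
    by (simp add: E_apply)
  have d0: "((\<lambda>h. E z h x /\<^sub>R h) \<longlongrightarrow> x) (at_right 0)"
    using has_vector_derivative_imp_at_right[OF has_vector_derivative_E[of 0 1 z x]] by (simp add: E0 scaleC.zero_right)
  have "((\<lambda>h. (E z (t + h) x - E z t x) /\<^sub>R h - exp (z * of_real t) *\<^sub>C (E z h x /\<^sub>R h)) \<longlongrightarrow>
      z *\<^sub>C E z t x + T t x - exp (z * of_real t) *\<^sub>C x) (at_right 0)"
    by (intro tendsto_intros d1 d0)
  moreover have "\<forall>\<^sub>F h in at_right 0. (E z (t + h) x - E z t x) /\<^sub>R h - exp (z * of_real t) *\<^sub>C (E z h x /\<^sub>R h) =
      (T h (E z t x) - E z t x) /\<^sub>R h"
    using eventually_at_right_less[of "0::real"]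
    by eventually_elim (use assms in \<open>simp add: T_E scaleC_scaleR_commute algebra_simps\<close>)
  ultimately have "((\<lambda>h. (T h (E z t x) - E z t x) /\<^sub>R h) \<longlongrightarrow>
      z *\<^sub>C E z t x + T t x - exp (z * of_real t) *\<^sub>C x) (at_right 0)"
    by (rule Lim_transform_eventually)
  then show "E z t x \<in> D" "A (E z t x) = z *\<^sub>C E z t x + T t x - exp (z * of_real t) *\<^sub>C x"
    by (rule generatorI)+
qed

lemma E_scaleC: "0 \<le> t \<Longrightarrow> E z t (c *\<^sub>C x) = c *\<^sub>C E z t x"
proof -
  assume t: "0 \<le> t"
  have "E z t (c *\<^sub>C x) = integral {0..t} ((\<lambda>y. c *\<^sub>C y) \<circ> (\<lambda>s. exp (z * of_real (t - s)) *\<^sub>C T s x))"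
    unfolding E_apply[OF t]
    by (rule integral_cong) (simp add: complex_linear_scaleC T_linear scaleC_scaleC mult.commute)
  also have "\<dots> = c *\<^sub>C E z t x"
    unfolding E_apply[OF t]
    by (intro integral_linear integrable_continuous_real scaleC.bounded_linear_right continuous_intros)
  finally show ?thesis .
qed

text \<open>E(z,t) commutes with the semigroup, so it can be applied to the difference quotients of
  x; boundedness of E(z,t) carries the limit through, which gives A E x = E A x.\<close>

lemma E_A:
  assumes x: "x \<in> D" and t: "0 \<le> t"
  shows "E z t (A x - z *\<^sub>C x) = T t x - exp (z * of_real t) *\<^sub>C x"
proof -
  have "((\<lambda>h. E z t ((T h x - x) /\<^sub>R h)) \<longlongrightarrow> E z t (A x)) (at_right 0)"
    by (intro blinfun.tendsto tendsto_const generatorD x)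
  moreover have "\<forall>\<^sub>F h in at_right 0. E z t ((T h x - x) /\<^sub>R h) = (T h (E z t x) - E z t x) /\<^sub>R h"
    using eventually_at_right_less[of "0::real"]
    by eventually_elim
      (use t in \<open>simp add: E_def blinfun.scaleR_right blinfun.diff_right conv_T[OF continuous_on_exp_kernel]\<close>)
  ultimately have "((\<lambda>h. (T h (E z t x) - E z t x) /\<^sub>R h) \<longlongrightarrow> E z t (A x)) (at_right 0)"
    by (rule Lim_transform_eventually)
  then have "A (E z t x) = E z t (A x)"
    by (rule generatorI)
  then show ?thesis
    using E_generator(2)[OF t, of z x] by (simp add: blinfun.diff_right E_scaleC t algebra_simps)
qed

end

section \<open>Neumann series\<close>

lemma exists_power_half_le:
  fixes C e :: real
  assumes "0 < e"
  shows "\<exists>M>0. C / 2 ^ M \<le> e"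
proof -
  have "(\<lambda>M. C / 2 ^ M) \<longlonglongrightarrow> 0"
    using tendsto_mult[OF tendsto_const LIMSEQ_power_zero[of "1/2 :: real"], of C]
    by (simp add: power_divide)
  then have "\<forall>\<^sub>F M in sequentially. C / 2 ^ M < e"
    using assms by (rule order_tendstoD(2))
  then have "\<forall>\<^sub>F M in sequentially. 0 < M \<and> C / 2 ^ M < e"
    using eventually_gt_at_top[of "0::nat"] by eventually_elim simp
  then obtain M where "0 < M \<and> C / 2 ^ M < e"
    by (auto dest: eventually_happens)
  then show ?thesis by (intro exI[of _ M]) simp
qed

primrec blinfun_power :: "'b :: complex_normed_vector \<Rightarrow>\<^sub>L 'b \<Rightarrow> nat \<Rightarrow> 'b \<Rightarrow>\<^sub>L 'b" where
  "blinfun_power R 0 = id_blinfun"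
| "blinfun_power R (Suc k) = R o\<^sub>L blinfun_power R k"

lemma blinfun_power_Suc2: "blinfun_power R (Suc k) = blinfun_power R k o\<^sub>L R"
proof (induction k)
  case (Suc k)
  have "blinfun_power R (Suc (Suc k)) = R o\<^sub>L (blinfun_power R k o\<^sub>L R)"
    using Suc by simp
  also have "\<dots> = blinfun_power R (Suc k) o\<^sub>L R"
    by (rule blinfun_eqI) simp
  finally show ?case .
qed (simp add: blinfun_eqI)

lemma norm_blinfun_power_le: "norm (blinfun_power R (Suc k)) \<le> norm R ^ Suc k"
proof (induction k)
  case 0
  then show ?case by (simp add: blinfun_eqI[of "R o\<^sub>L id_blinfun" R])
next
  case (Suc k)
  have "norm (blinfun_power R (Suc (Suc k))) \<le> norm R * norm (blinfun_power R (Suc k))"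
    using norm_blinfun_compose[of R "blinfun_power R (Suc k)"] by simp
  also have "\<dots> \<le> norm R * norm R ^ Suc k"
    by (intro mult_left_mono Suc) auto
  finally show ?case by simp
qed

text \<open>If R is the inverse of A - w, this is R (I - c R)^(-1), the series for the inverse of A
  - (w + c).\<close>

definition neumann :: "'b :: complex_banach \<Rightarrow>\<^sub>L 'b \<Rightarrow> complex \<Rightarrow> 'b \<Rightarrow>\<^sub>L 'b" where
  "neumann R c = (\<Sum>k. c ^ k *\<^sub>C blinfun_power R (Suc k))"

lemma neumann_term_le: "norm (c ^ k *\<^sub>C blinfun_power R (Suc k)) \<le> norm R * (cmod c * norm R) ^ k"
proof -
  have "norm (c ^ k *\<^sub>C blinfun_power R (Suc k)) \<le> cmod c ^ k * norm R ^ Suc k"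
    unfolding norm_scaleC norm_power by (intro mult_left_mono norm_blinfun_power_le) auto
  then show ?thesis by (simp add: power_mult_distrib mult_ac)
qed

lemma neumann_sums:
  fixes R :: "'b :: complex_banach \<Rightarrow>\<^sub>L 'b"
  assumes "cmod c * norm R < 1"
  shows "(\<lambda>k. c ^ k *\<^sub>C blinfun_power R (Suc k)) sums neumann R c"
proof -
  have "summable (\<lambda>k. norm R * (cmod c * norm R) ^ k)"
    using assms by (intro summable_mult summable_geometric) simp
  then have "summable (\<lambda>k. c ^ k *\<^sub>C blinfun_power R (Suc k))"
    by (rule summable_comparison_test'[where N = 0]) (rule neumann_term_le)
  then show ?thesis
    unfolding neumann_def by (rule summable_sums)
qed

lemma norm_neumann_le:
  fixes R :: "'b :: complex_banach \<Rightarrow>\<^sub>L 'b"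
  assumes "cmod c * norm R \<le> 1/2"
  shows "norm (neumann R c) \<le> 2 * norm R"
proof (rule norm_sums_le)
  show "(\<lambda>k. c ^ k *\<^sub>C blinfun_power R (Suc k)) sums neumann R c"
    using assms by (intro neumann_sums) simp
  show "(\<lambda>k. norm R * (1/2) ^ k) sums (2 * norm R)"
    using sums_mult[OF geometric_sums[of "1/2 :: real"], of "norm R"] by (simp add: mult.commute)
  fix k
  have "norm (c ^ k *\<^sub>C blinfun_power R (Suc k)) \<le> norm R * (cmod c * norm R) ^ k"
    by (rule neumann_term_le)
  also have "\<dots> \<le> norm R * (1/2) ^ k"
    by (intro mult_left_mono power_mono) (use assms in auto)
  finally show "norm (c ^ k *\<^sub>C blinfun_power R (Suc k)) \<le> norm R * (1/2) ^ k" .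
qed

text \<open>The shifted series is the series minus its first term, and a factor c R can be split off
  on either side. The two fixed point equations later yield a right and a left inverse.\<close>

lemma neumann_eq:
  fixes R :: "'b :: complex_banach \<Rightarrow>\<^sub>L 'b"
  assumes c: "cmod c * norm R < 1" and R: "complex_linear R"
  shows "neumann R c = R + (R o\<^sub>L (c *\<^sub>C neumann R c))"
    and "neumann R c = R + (neumann R c o\<^sub>L (c *\<^sub>C R))"
proof -
  let ?N = "neumann R c"
  note s = neumann_sums[OF c]
  have R0: "blinfun_power R (Suc 0) = R" by (simp add: blinfun_eqI)
  have tail: "(\<lambda>k. c ^ Suc k *\<^sub>C blinfun_power R (Suc (Suc k))) sums (?N - R)"
    using sums_split_initial_segment[OF s, of 1] R0 by simp
  have "(\<lambda>k. R o\<^sub>L (c *\<^sub>C (c ^ k *\<^sub>C blinfun_power R (Suc k)))) sums (R o\<^sub>L (c *\<^sub>C ?N))"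
    by (intro bounded_linear.sums[OF bounded_linear_compose[OF bounded_bilinear.bounded_linear_right[OF
      bounded_bilinear_blinfun_compose] scaleC.bounded_linear_right]] s)
  moreover have "R o\<^sub>L (c *\<^sub>C (c ^ k *\<^sub>C blinfun_power R (Suc k))) = c ^ Suc k *\<^sub>C blinfun_power R (Suc (Suc k))" for k
    by (simp add: scaleC_scaleC complex_linear_compose_scaleC[OF R])
  ultimately have "?N - R = R o\<^sub>L (c *\<^sub>C ?N)"
    using tail sums_unique2 by simp
  then show "?N = R + (R o\<^sub>L (c *\<^sub>C ?N))" by (simp add: algebra_simps)
  have "(\<lambda>k. (c ^ k *\<^sub>C blinfun_power R (Suc k)) o\<^sub>L (c *\<^sub>C R)) sums (?N o\<^sub>L (c *\<^sub>C R))"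
    by (intro bounded_linear.sums[OF bounded_bilinear.bounded_linear_left[OF bounded_bilinear_blinfun_compose]] s)
  moreover have "complex_linear (blinfun_power R k)" for k
    using R by (induction k) (auto simp: complex_linear_def)
  then have "(c ^ k *\<^sub>C blinfun_power R (Suc k)) o\<^sub>L (c *\<^sub>C R) = c ^ Suc k *\<^sub>C blinfun_power R (Suc (Suc k))" for k
    unfolding blinfun_power_Suc2[of R "Suc k"]
    by (simp add: scaleC_scaleC complex_linear_compose_scaleC scaleC_compose mult.commute del: blinfun_power.simps)
  ultimately have "?N - R = ?N o\<^sub>L (c *\<^sub>C R)"
    using tail sums_unique2 by simp
  then show "?N = R + (?N o\<^sub>L (c *\<^sub>C R))" by (simp add: algebra_simps)
qed

text \<open>The trace of operator-valued holomorphy that is needed: the discrete mean is accurate in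
  operator norm, so the error remains controlled after composition with T(t) / f(t). The entire
  weight matches the one in \<open>submean\<close>.\<close>

definition mean_value :: "(complex \<Rightarrow> 'b :: complex_normed_vector) \<Rightarrow> complex \<Rightarrow> real \<Rightarrow> bool" where
  "mean_value S z r \<longleftrightarrow> (\<forall>g e. g holomorphic_on UNIV \<longrightarrow> 0 < e \<longrightarrow>
     (\<exists>M>0. norm (circle_mean M r z (\<lambda>\<zeta>. g \<zeta> *\<^sub>C S \<zeta>) - g z *\<^sub>C S z) \<le> e))"

lemma circle_mean_scaleC: "circle_mean M r z h *\<^sub>C x = circle_mean M r z (\<lambda>\<zeta>. h \<zeta> *\<^sub>C (x :: 'b :: complex_normed_vector))"
  by (simp add: circle_mean_def scaleC.scaleR_left scaleC.sum_left)

lemma bounded_linear_circle_mean: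
  assumes "bounded_linear L"
  shows "L (circle_mean M r z F) = circle_mean M r z (\<lambda>\<zeta>. L (F \<zeta>))"
proof -
  interpret bounded_linear L by fact
  show ?thesis by (simp add: circle_mean_def scaleR sum)
qed

lemma entire_bounded_on_cball:
  assumes "g holomorphic_on UNIV"
  obtains B where "0 \<le> B" "\<And>w. w \<in> cball z r \<Longrightarrow> cmod (g w) \<le> B"
proof -
  have "bounded (g ` cball z r)"
    using assms by (intro compact_imp_bounded compact_continuous_image)
      (auto intro: holomorphic_on_imp_continuous_on continuous_on_subset)
  then obtain B where "\<And>w. w \<in> cball z r \<Longrightarrow> cmod (g w) \<le> B"
    by (metis bounded_iff imageI)
  then show thesis
    by (intro that[of "\<bar>B\<bar>"]) (auto intro: order_trans[OF _ abs_ge_self])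
qed

text \<open>The discs of radius 2 r about z lie within 3 \<rho> of the centre of expansion, whence
  the constant in the hypothesis. Each scalar coefficient function has error of order 2^(-M) times
  (3 \<rho>)^k, and the operator powers turn this into a convergent geometric series.\<close>

lemma mean_value_neumann:
  fixes R :: "'b :: complex_banach \<Rightarrow>\<^sub>L 'b"
  assumes \<rho>: "3 * \<rho> * norm R \<le> 1/2" and z: "z \<in> ball z\<^sub>0 \<rho>" and r: "0 < r" "r \<le> \<rho>"
  shows "mean_value (\<lambda>z. neumann R (z - z\<^sub>0)) z r"
  unfolding mean_value_def
proof (intro allI impI)
  fix g and e :: real assume g: "g holomorphic_on UNIV" and e: "0 < e"
  let ?C = "\<lambda>k. blinfun_power R (Suc k)"
  obtain B where B: "0 \<le> B" "\<And>w. w \<in> cball z (2 * r) \<Longrightarrow> cmod (g w) \<le> B"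
    using entire_bounded_on_cball[OF g] by metis
  obtain M where M: "0 < M" "4 * B * norm R / 2 ^ M \<le> e"
    using exists_power_half_le[OF e] by metis
  define h where "h k \<zeta> = g \<zeta> * (\<zeta> - z\<^sub>0) ^ k" for k \<zeta>
  have near: "cmod (\<zeta> - z\<^sub>0) \<le> 3 * \<rho>" if "\<zeta> \<in> cball z (2 * r)" for \<zeta>
  proof -
    have "dist \<zeta> z\<^sub>0 \<le> dist z \<zeta> + dist z\<^sub>0 z" by (metis dist_commute dist_triangle add.commute)
    also have "\<dots> \<le> 3 * \<rho>" using that z r by simp
    finally show ?thesis by (simp add: dist_norm)
  qed
  have lt: "cmod (\<zeta> - z\<^sub>0) * norm R < 1" if "\<zeta> \<in> cball z (2 * r)" for \<zeta>
    using mult_right_mono[OF near[OF that], of "norm R"] \<rho> by simp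
  have s: "(\<lambda>k. h k \<zeta> *\<^sub>C ?C k) sums (g \<zeta> *\<^sub>C neumann R (\<zeta> - z\<^sub>0))" if "\<zeta> \<in> cball z (2 * r)" for \<zeta>
    using bounded_linear.sums[OF scaleC.bounded_linear_right neumann_sums[OF lt[OF that]], of "g \<zeta>"]
    by (simp add: h_def scaleC_scaleC)
  have "(\<lambda>k. circle_mean M r z (\<lambda>\<zeta>. h k \<zeta> *\<^sub>C ?C k)) sums circle_mean M r z (\<lambda>\<zeta>. g \<zeta> *\<^sub>C neumann R (\<zeta> - z\<^sub>0))"
    unfolding circle_mean_def using r
    by (intro sums_scaleR_right sums_sum s) (simp add: dist_norm norm_mult)
  then have "(\<lambda>k. (circle_mean M r z (h k) - h k z) *\<^sub>C ?C k) sums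
      (circle_mean M r z (\<lambda>\<zeta>. g \<zeta> *\<^sub>C neumann R (\<zeta> - z\<^sub>0)) - g z *\<^sub>C neumann R (z - z\<^sub>0))"
    unfolding scaleC.diff_left circle_mean_scaleC
    by (rule sums_diff) (use s[of z] r in simp)
  moreover have "(\<lambda>k. 2 * B * norm R / 2 ^ M * (1/2) ^ k) sums (2 * B * norm R / 2 ^ M * 2)"
    using geometric_sums[of "1/2 :: real"] by (intro sums_mult) simp
  moreover have "norm ((circle_mean M r z (h k) - h k z) *\<^sub>C ?C k) \<le> 2 * B * norm R / 2 ^ M * (1/2) ^ k" for k
  proof -
    have "cmod (circle_mean M r z (h k) - h k z) \<le> 2 * (B * (3 * \<rho>) ^ k) / 2 ^ M"
    proof (rule circle_mean_holomorphic[OF _ r(1) M(1)])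
      show "h k holomorphic_on cball z (2 * r)"
        unfolding h_def by (intro holomorphic_intros holomorphic_on_subset[OF g]) auto
      show "cmod (h k w) \<le> B * (3 * \<rho>) ^ k" if "w \<in> cball z (2 * r)" for w
        unfolding h_def norm_mult norm_power
        by (intro mult_mono power_mono B near that) (use B in auto)
    qed
    then have "norm ((circle_mean M r z (h k) - h k z) *\<^sub>C ?C k) \<le> 2 * (B * (3 * \<rho>) ^ k) / 2 ^ M * norm R ^ Suc k"
      unfolding norm_scaleC using r B
      by (intro mult_mono norm_blinfun_power_le) auto
    also have "\<dots> = 2 * B * norm R / 2 ^ M * (3 * \<rho> * norm R) ^ k"
      by (simp add: power_mult_distrib)
    also have "\<dots> \<le> 2 * B * norm R / 2 ^ M * (1/2) ^ k"
      by (intro mult_left_mono power_mono \<rho>) (use B r in auto)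
    finally show ?thesis .
  qed
  ultimately have "norm (circle_mean M r z (\<lambda>\<zeta>. g \<zeta> *\<^sub>C neumann R (\<zeta> - z\<^sub>0)) - g z *\<^sub>C neumann R (z - z\<^sub>0))
      \<le> 2 * B * norm R / 2 ^ M * 2"
    by (rule norm_sums_le)
  also have "\<dots> \<le> e" using M(2) by simp
  finally show "\<exists>M>0. norm (circle_mean M r z (\<lambda>\<zeta>. g \<zeta> *\<^sub>C neumann R (\<zeta> - z\<^sub>0)) - g z *\<^sub>C neumann R (z - z\<^sub>0)) \<le> e"
    using M(1) by blast
qed

section \<open>Parametrices\<close>

context dominated_semigroup
begin

text \<open>The kernel decays faster than exp(\<omega> s) by the rate \<kappa>. The surplus \<omega>
  is spent on f(s) exp(\<omega> (t - s)) \<le> f(t), and the remaining exponential integrates to at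
  most 1 / \<kappa>.\<close>

lemma conv_norm_le:
  assumes k: "continuous_on UNIV k" and \<kappa>: "0 < \<kappa>" and t: "0 \<le> t"
    and le: "\<And>s. 0 \<le> s \<Longrightarrow> cmod (k s) \<le> C * exp ((\<omega> - \<kappa>) * s)"
  shows "norm (conv k t) \<le> C / \<kappa> * f t"
proof (rule norm_blinfun_bound)
  have "0 \<le> C * exp ((\<omega> - \<kappa>) * 0)"
    using le[of 0] norm_ge_zero order_trans by blast
  then have C: "0 \<le> C" by simp
  then show "0 \<le> C / \<kappa> * f t"
    using \<kappa> f_pos[OF t] by simp
  fix x
  have "norm (integral {0..t} (\<lambda>s. k (t - s) *\<^sub>C T s x)) \<le> C * f t * norm x / \<kappa>"
  proof (rule integral_exp_bound'[OF continuous_on_conv_integrand[OF k] \<kappa> t])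
    fix s assume s: "s \<in> {0..t}"
    have "norm (k (t - s) *\<^sub>C T s x) \<le> (C * exp ((\<omega> - \<kappa>) * (t - s))) * (f s * norm x)"
      unfolding norm_scaleC by (intro mult_mono le T_apply_le) (use s C in auto)
    also have "\<dots> = (C * exp (- \<kappa> * (t - s)) * norm x) * (f s * exp (\<omega> * (t - s)))"
      by (simp add: algebra_simps exp_add[symmetric] exp_diff)
    also have "\<dots> \<le> (C * exp (- \<kappa> * (t - s)) * norm x) * f t"
      by (intro mult_left_mono f_lower) (use s C in auto)
    finally show "norm (k (t - s) *\<^sub>C T s x) \<le> C * f t * norm x * exp (- \<kappa> * (t - s))"
      by (simp add: mult_ac)
  qed
  then show "norm (conv k t x) \<le> C / \<kappa> * f t * norm x"
    by (simp add: conv_apply[OF k t])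
qed

lemma conv_diff:
  assumes "continuous_on UNIV k" "continuous_on UNIV l" "0 \<le> t"
  shows "conv (\<lambda>s. k s - l s) t = conv k t - conv l t"
proof (rule blinfun_eqI)
  fix x
  have "continuous_on UNIV (\<lambda>s. k s - l s)" by (intro continuous_intros assms)
  from conv_apply[OF this assms(3)] show "conv (\<lambda>s. k s - l s) t x = (conv k t - conv l t) x"
    by (simp add: blinfun.diff_left conv_apply assms scaleC.diff_left integral_diff
        integrable_continuous_real continuous_on_conv_integrand)
qed

lemma conv_sum:
  assumes "finite J" "\<And>j. j \<in> J \<Longrightarrow> continuous_on UNIV (k j)" "0 \<le> t"
  shows "conv (\<lambda>s. \<Sum>j\<in>J. k j s) t = (\<Sum>j\<in>J. conv (k j) t)"
proof (rule blinfun_eqI)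
  fix x
  have "continuous_on UNIV (\<lambda>s. \<Sum>j\<in>J. k j s)" by (intro continuous_intros assms)
  from conv_apply[OF this assms(3)] show "conv (\<lambda>s. \<Sum>j\<in>J. k j s) t x = (\<Sum>j\<in>J. conv (k j) t) x"
    by (simp add: blinfun.sum_left conv_apply assms scaleC.sum_left integral_sum
        integrable_continuous_real continuous_on_conv_integrand)
qed

lemma conv_mult:
  assumes "continuous_on UNIV k" "0 \<le> t"
  shows "conv (\<lambda>s. c * k s) t = c *\<^sub>C conv k t"
proof (rule blinfun_eqI)
  fix x
  have "continuous_on UNIV (\<lambda>s. c * k s)" by (intro continuous_intros assms)
  then have "conv (\<lambda>s. c * k s) t x = integral {0..t} ((\<lambda>y. c *\<^sub>C y) \<circ> (\<lambda>s. k (t - s) *\<^sub>C T s x))"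
    by (simp add: conv_apply assms scaleC_scaleC o_def)
  also have "\<dots> = c *\<^sub>C conv k t x"
    unfolding conv_apply[OF assms]
    by (intro integral_linear integrable_continuous_real scaleC.bounded_linear_right continuous_on_conv_integrand assms)
  finally show "conv (\<lambda>s. c * k s) t x = (c *\<^sub>C conv k t) x" by simp
qed

lemma norm_E_le: "Re z < \<omega> \<Longrightarrow> 0 \<le> t \<Longrightarrow> norm (E z t) \<le> 1 / (\<omega> - Re z) * f t"
  unfolding E_def
  by (rule conv_norm_le[OF continuous_on_exp_kernel]) (auto simp: norm_exp_eq_Re)

text \<open>Convolution is linear in its kernel, so the operator error is the convolution with a
  scalar quadrature error, to which the holomorphic estimate applies pointwise in s.\<close>

lemma circle_mean_E:
  assumes t: "0 \<le> t"
  shows "circle_mean M r z (\<lambda>\<zeta>. g \<zeta> *\<^sub>C E \<zeta> t) - g z *\<^sub>C E z t =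
    conv (\<lambda>s. circle_mean M r z (\<lambda>\<zeta>. g \<zeta> * exp (\<zeta> * of_real s)) - g z * exp (z * of_real s)) t"
proof -
  have "circle_mean M r z (\<lambda>\<zeta>. g \<zeta> *\<^sub>C E \<zeta> t) =
      (of_real (1 / real M)) *\<^sub>C conv (\<lambda>s. \<Sum>j<M. g (z + of_real r * cis (2 * pi * real j / real M)) *
        exp ((z + of_real r * cis (2 * pi * real j / real M)) * of_real s)) t"
    unfolding circle_mean_def scaleC_of_real E_def using t
    by (subst conv_sum) (auto simp: conv_mult continuous_on_exp_kernel intro!: continuous_intros)
  also have "\<dots> = conv (\<lambda>s. circle_mean M r z (\<lambda>\<zeta>. g \<zeta> * exp (\<zeta> * of_real s))) t"
    unfolding circle_mean_def scaleR_conv_of_real using t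
    by (subst conv_mult) (auto intro!: continuous_intros)
  finally have 1: "circle_mean M r z (\<lambda>\<zeta>. g \<zeta> *\<^sub>C E \<zeta> t) =
      conv (\<lambda>s. circle_mean M r z (\<lambda>\<zeta>. g \<zeta> * exp (\<zeta> * of_real s))) t" .
  have 2: "g z *\<^sub>C E z t = conv (\<lambda>s. g z * exp (z * of_real s)) t"
    unfolding E_def by (rule conv_mult[symmetric]) (auto simp: continuous_on_exp_kernel t)
  have "continuous_on UNIV (\<lambda>s. circle_mean M r z (\<lambda>\<zeta>. g \<zeta> * exp (\<zeta> * of_real s)))"
    unfolding circle_mean_def by (intro continuous_intros)
  from conv_diff[OF this _ t, of "\<lambda>s. g z * exp (z * of_real s)"] show ?thesis
    unfolding 1 2 by (simp add: continuous_intros)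
qed

text \<open>A distance of 4 \<rho> from the line leaves Re \<zeta> \<le> \<omega> - \<rho> on all
  doubled discs, which reach 3 \<rho> from the centre. The kernel error then has decay rate \<rho>
  beyond \<omega>, and M can be chosen independently of t.\<close>

lemma E_mean_value:
  assumes \<rho>: "0 < \<rho>" "Re z\<^sub>0 + 4 * \<rho> \<le> \<omega>" and z: "z \<in> ball z\<^sub>0 \<rho>" and r: "0 < r" "r \<le> \<rho>"
    and g: "g holomorphic_on UNIV" and e: "0 < e"
  shows "\<exists>M>0. \<forall>t\<ge>0. norm (circle_mean M r z (\<lambda>\<zeta>. g \<zeta> *\<^sub>C E \<zeta> t) - g z *\<^sub>C E z t) \<le> e * f t"
proof -
  obtain B where B: "0 \<le> B" "\<And>w. w \<in> cball z (2 * r) \<Longrightarrow> cmod (g w) \<le> B"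
    using entire_bounded_on_cball[OF g] by metis
  obtain M where M: "0 < M" "2 * B / \<rho> / 2 ^ M \<le> e"
    using exists_power_half_le[OF e] by metis
  have near: "Re \<zeta> \<le> \<omega> - \<rho>" if "\<zeta> \<in> cball z (2 * r)" for \<zeta>
  proof -
    have "dist \<zeta> z\<^sub>0 \<le> dist z \<zeta> + dist z\<^sub>0 z" by (metis dist_commute dist_triangle add.commute)
    also have "\<dots> \<le> 3 * \<rho>" using that z r by simp
    finally have "Re (\<zeta> - z\<^sub>0) \<le> 3 * \<rho>"
      using complex_Re_le_cmod[of "\<zeta> - z\<^sub>0"] by (simp add: dist_norm)
    then show ?thesis using \<rho> by simp
  qed
  have "norm (circle_mean M r z (\<lambda>\<zeta>. g \<zeta> *\<^sub>C E \<zeta> t) - g z *\<^sub>C E z t) \<le> e * f t" if t: "0 \<le> t" for t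
  proof -
    have "norm (circle_mean M r z (\<lambda>\<zeta>. g \<zeta> *\<^sub>C E \<zeta> t) - g z *\<^sub>C E z t) \<le> (2 * B / 2 ^ M) / \<rho> * f t"
      unfolding circle_mean_E[OF t]
    proof (rule conv_norm_le[OF _ \<rho>(1) t])
      show "continuous_on UNIV (\<lambda>s. circle_mean M r z (\<lambda>\<zeta>. g \<zeta> * exp (\<zeta> * of_real s)) - g z * exp (z * of_real s))"
        unfolding circle_mean_def by (intro continuous_intros)
      fix s :: real assume s: "0 \<le> s"
      have "cmod (circle_mean M r z (\<lambda>\<zeta>. g \<zeta> * exp (\<zeta> * of_real s)) - g z * exp (z * of_real s)) \<le>
          2 * (B * exp ((\<omega> - \<rho>) * s)) / 2 ^ M"
      proof (rule circle_mean_holomorphic[OF _ r(1) M(1)])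
        show "(\<lambda>\<zeta>. g \<zeta> * exp (\<zeta> * of_real s)) holomorphic_on cball z (2 * r)"
          by (intro holomorphic_intros holomorphic_on_subset[OF g]) auto
        show "cmod (g w * exp (w * of_real s)) \<le> B * exp ((\<omega> - \<rho>) * s)" if "w \<in> cball z (2 * r)" for w
          unfolding norm_mult norm_exp_eq_Re
          by (intro mult_mono B that) (use near[OF that] s B in \<open>auto intro: mult_right_mono\<close>)
      qed
      then show "cmod (circle_mean M r z (\<lambda>\<zeta>. g \<zeta> * exp (\<zeta> * of_real s)) - g z * exp (z * of_real s)) \<le>
          2 * B / 2 ^ M * exp ((\<omega> - \<rho>) * s)"
        by simp
    qed
    also have "\<dots> \<le> e * f t"
      using M(2) f_pos[OF t] by (intro mult_right_mono) (auto simp: field_simps)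
    finally show ?thesis .
  qed
  then show ?thesis using M(1) by blast
qed

section \<open>Negligible operators and inverses modulo them\<close>

definition negligible_op :: "'a \<Rightarrow>\<^sub>L 'a \<Rightarrow> bool" where
  "negligible_op P \<longleftrightarrow> ((\<lambda>t. norm (T t o\<^sub>L P) / f t) \<longlongrightarrow> 0) at_top"

text \<open>A two-sided inverse of A - z up to the same defect P on both sides. Commutation with the
  semigroup is included because comparing two parametrices requires moving T(t) past S onto the
  defect.\<close>

definition parametrix :: "complex \<Rightarrow> 'a \<Rightarrow>\<^sub>L 'a \<Rightarrow> 'a \<Rightarrow>\<^sub>L 'a \<Rightarrow> bool" where
  "parametrix z S P \<longleftrightarrow>
     (\<forall>x. S x \<in> D \<and> A (S x) - z *\<^sub>C S x = x - P x) \<and>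
     (\<forall>x\<in>D. S (A x - z *\<^sub>C x) = x - P x) \<and>
     (\<forall>t\<ge>0. \<forall>x. S (T t x) = T t (S x)) \<and> negligible_op P"

lemma negligible_op_0 [simp]: "negligible_op 0"
  by (simp add: negligible_op_def)

lemma eventually_f_pos: "\<forall>\<^sub>F t in at_top. 0 < f t"
  using eventually_ge_at_top[of 0] by eventually_elim (rule f_pos)

lemma eventually_T_compose_le: "\<forall>\<^sub>F t in at_top. norm ((T t o\<^sub>L S) /\<^sub>R f t) \<le> norm S"
  using eventually_ge_at_top[of 0]
proof eventually_elim
  case (elim t)
  have "norm (T t o\<^sub>L S) \<le> f t * norm S"
    using norm_blinfun_compose[of "T t" S] T_le[OF elim] mult_right_mono[of "norm (T t)" "f t" "norm S"] by simp
  then show ?case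
    using f_pos[OF elim] by (simp add: field_simps)
qed

lemma eventually_E_le:
  assumes "Re z < \<omega>"
  shows "\<forall>\<^sub>F t in at_top. norm (E z t /\<^sub>R f t) \<le> 1 / (\<omega> - Re z)"
  using eventually_ge_at_top[of 0]
proof eventually_elim
  case (elim t)
  then show ?case
    using norm_E_le[OF assms elim] f_pos[OF elim] by (simp add: field_simps)
qed

lemma parametrix_E:
  assumes "parametrix z S P" "0 \<le> t"
  shows "E z t (x - P x) = T t (S x) - exp (z * of_real t) *\<^sub>C S x"
  using assms E_A[of "S x" t z] by (auto simp: parametrix_def)

lemma exp_over_f_tendsto_0:
  assumes "b < \<omega>"
  shows "((\<lambda>t. exp (b * t) / f t) \<longlongrightarrow> 0) at_top"
proof (rule tendsto_sandwich)
  show "\<forall>\<^sub>F t in at_top. 0 \<le> exp (b * t) / f t"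
    using eventually_f_pos by eventually_elim simp
  show "\<forall>\<^sub>F t in at_top. exp (b * t) / f t \<le> exp (- (\<omega> - b) * t) / f 0"
    using eventually_ge_at_top[of 0]
  proof eventually_elim
    case (elim t)
    have "f 0 * exp (\<omega> * t) \<le> f t" using f_lower[of 0 t] elim by simp
    then have "exp (b * t) / f t \<le> exp (b * t) / (f 0 * exp (\<omega> * t))"
      using f_pos[of 0] f_pos[OF elim] by (intro divide_left_mono) auto
    also have "\<dots> = exp (- (\<omega> - b) * t) / f 0"
      by (simp add: left_diff_distrib exp_diff exp_minus field_simps)
    finally show ?case .
  qed
  have "((\<lambda>t. exp (- (\<omega> - b) * t)) \<longlongrightarrow> 0) at_top"
    using assms by (intro filterlim_compose[OF exp_at_bot] filterlim_tendsto_neg_mult_at_bot[OF tendsto_const] filterlim_ident) auto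
  then show "((\<lambda>t. exp (- (\<omega> - b) * t) / f 0) \<longlongrightarrow> 0) at_top"
    using tendsto_divide[OF _ tendsto_const, of _ 0 at_top "f 0"] f_pos[of 0] by simp
qed auto

text \<open>T(s) P is small relative to f(s) for late s. Its early part is dominated by a multiple
  of exp(\<beta> s) with \<beta> < \<omega>. Since Re z < \<beta>, convolution with exp(z s)
  preserves both orders of magnitude, and exp(\<beta> t) is o(f(t)).\<close>

lemma E_negligible:
  assumes P: "negligible_op P" and z: "Re z < \<omega>"
  shows "((\<lambda>t. norm (E z t o\<^sub>L P) / f t) \<longlongrightarrow> 0) at_top"
proof (rule tendstoI)
  fix e :: real assume e: "0 < e"
  \<comment> \<open>Any exponent strictly between Re z and \<omega> would do: above Re z for the
    convolution to converge, below \<omega> for the result to be negligible.\<close>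
  define \<beta> where "\<beta> = (\<omega> + Re z) / 2"
  have \<beta>: "Re z < \<beta>" "\<beta> < \<omega>" using z by (auto simp: \<beta>_def)
  define d where "d = e * (\<omega> - Re z) / 4"
  have d: "0 < d" using e z by (simp add: d_def)
  have "\<forall>\<^sub>F t in at_top. norm (T t o\<^sub>L P) / f t < d"
    using P d unfolding negligible_op_def by (rule order_tendstoD(2))
  then obtain s\<^sub>0 where s\<^sub>0: "\<And>t. s\<^sub>0 \<le> t \<Longrightarrow> norm (T t o\<^sub>L P) / f t < d"
    by (auto simp: eventually_at_top_linorder)
  define b where "b = max s\<^sub>0 0"
  \<comment> \<open>The first factors bound T(s) P on [0, b]; the last one compensates for
    exp(\<beta> s), which is at least exp(-|\<beta>| b) there.\<close>
  define K where "K = f b * exp (\<bar>\<omega>\<bar> * b) * norm P * exp (\<bar>\<beta>\<bar> * b)"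
  have K: "0 \<le> K" using f_pos[of b] by (simp add: K_def b_def)
  have TP: "norm (T s o\<^sub>L P) \<le> d * f s + K * exp (\<beta> * s)" if s: "0 \<le> s" for s
  proof (cases "b \<le> s")
    case True
    then have "norm (T s o\<^sub>L P) \<le> d * f s"
      using s\<^sub>0[of s] f_pos[OF s] by (simp add: b_def field_simps)
    then show ?thesis using K by (simp add: add_increasing2)
  next
    case False
    have "norm (T s o\<^sub>L P) \<le> norm (T s) * norm P" by (rule norm_blinfun_compose)
    also have "\<dots> \<le> f b * exp (\<bar>\<omega>\<bar> * b) * norm P"
      using order_trans[OF T_le[OF s] f_le_on_interval[OF s, of b]] False by (intro mult_right_mono) auto
    also have "\<dots> \<le> f b * exp (\<bar>\<omega>\<bar> * b) * norm P * (exp (\<bar>\<beta>\<bar> * b) * exp (\<beta> * s))"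
    proof -
      have "\<bar>\<beta> * s\<bar> \<le> \<bar>\<beta>\<bar> * b"
        using False s by (simp add: abs_mult mult_left_mono)
      then have "1 \<le> exp (\<bar>\<beta>\<bar> * b) * exp (\<beta> * s)"
        unfolding exp_add[symmetric] by simp
      moreover have "0 \<le> f b * exp (\<bar>\<omega>\<bar> * b) * norm P"
        using f_pos[of b] by (simp add: b_def)
      ultimately show ?thesis
        using mult_left_mono by fastforce
    qed
    also have "\<dots> = K * exp (\<beta> * s)" by (simp add: K_def)
    finally show ?thesis using d f_pos[OF s] by (simp add: add_increasing)
  qed
  have bound: "norm (E z t o\<^sub>L P) \<le> d / (\<omega> - Re z) * f t + K / (\<beta> - Re z) * exp (\<beta> * t)" if t: "0 \<le> t" for t
  proof (rule norm_blinfun_bound)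
    show "0 \<le> d / (\<omega> - Re z) * f t + K / (\<beta> - Re z) * exp (\<beta> * t)"
      using d f_pos[OF t] K \<beta> z by (intro add_nonneg_nonneg mult_nonneg_nonneg divide_nonneg_nonneg) auto
    fix x
    let ?c = "\<lambda>s. exp (z * of_real (t - s))"
    have "norm (integral {0..t} (\<lambda>s. ?c s *\<^sub>C T s (P x))) \<le>
      integral {0..t} (\<lambda>s. d * norm x * f t * exp (- (\<omega> - Re z) * (t - s)) + K * norm x * exp (\<beta> * t) * exp (- (\<beta> - Re z) * (t - s)))"
    proof (rule integral_norm_bound_integral)
      show "(\<lambda>s. ?c s *\<^sub>C T s (P x)) integrable_on {0..t}"
        by (intro integrable_continuous_real continuous_intros)
      show "(\<lambda>s. d * norm x * f t * exp (- (\<omega> - Re z) * (t - s)) + K * norm x * exp (\<beta> * t) * exp (- (\<beta> - Re z) * (t - s))) integrable_on {0..t}"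
        by (intro integrable_continuous_real continuous_intros)
      fix s assume s: "s \<in> {0..t}"
      have "norm (?c s *\<^sub>C T s (P x)) = exp (Re z * (t - s)) * norm ((T s o\<^sub>L P) x)"
        by (simp add: norm_scaleC norm_exp_eq_Re)
      also have "\<dots> \<le> exp (Re z * (t - s)) * ((d * f s + K * exp (\<beta> * s)) * norm x)"
        using s by (intro mult_left_mono order_trans[OF norm_blinfun] mult_right_mono TP) auto
      also have "\<dots> = d * norm x * exp (- (\<omega> - Re z) * (t - s)) * (f s * exp (\<omega> * (t - s))) +
          K * norm x * exp (\<beta> * t) * exp (- (\<beta> - Re z) * (t - s))"
      proof -
        have e1: "exp (Re z * (t - s)) = exp (- (\<omega> - Re z) * (t - s)) * exp (\<omega> * (t - s))"
          and e2: "exp (Re z * (t - s)) * exp (\<beta> * s) = exp (\<beta> * t) * exp (- (\<beta> - Re z) * (t - s))"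
          unfolding exp_add[symmetric] by (simp_all add: algebra_simps)
        have "exp (Re z * (t - s)) * ((d * f s + K * exp (\<beta> * s)) * norm x) =
            d * norm x * f s * exp (Re z * (t - s)) + K * norm x * (exp (Re z * (t - s)) * exp (\<beta> * s))"
          by (simp add: algebra_simps)
        also have "\<dots> = d * norm x * f s * (exp (- (\<omega> - Re z) * (t - s)) * exp (\<omega> * (t - s))) +
            K * norm x * (exp (\<beta> * t) * exp (- (\<beta> - Re z) * (t - s)))"
          unfolding e2 unfolding e1 ..
        finally show ?thesis by (simp only: mult_ac)
      qed
      also have "\<dots> \<le> d * norm x * exp (- (\<omega> - Re z) * (t - s)) * f t + K * norm x * exp (\<beta> * t) * exp (- (\<beta> - Re z) * (t - s))"
        using s d by (intro add_right_mono mult_left_mono f_lower) auto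
      finally show "norm (?c s *\<^sub>C T s (P x)) \<le> d * norm x * f t * exp (- (\<omega> - Re z) * (t - s)) +
          K * norm x * exp (\<beta> * t) * exp (- (\<beta> - Re z) * (t - s))"
        by (simp add: mult_ac)
    qed
    also have "\<dots> = integral {0..t} (\<lambda>s. d * norm x * f t * exp (- (\<omega> - Re z) * (t - s))) +
        integral {0..t} (\<lambda>s. K * norm x * exp (\<beta> * t) * exp (- (\<beta> - Re z) * (t - s)))"
      by (intro integral_add integrable_continuous_real continuous_intros)
    also have "\<dots> \<le> d * norm x * f t / (\<omega> - Re z) + K * norm x * exp (\<beta> * t) / (\<beta> - Re z)"
    proof (rule add_mono)
      have "norm (integral {0..t} (\<lambda>s. d * norm x * f t * exp (- (\<omega> - Re z) * (t - s)))) \<le> d * norm x * f t / (\<omega> - Re z)"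
        by (rule integral_exp_bound') (use t z d f_pos[OF t] in \<open>auto intro!: continuous_intros simp: abs_mult\<close>)
      then show "integral {0..t} (\<lambda>s. d * norm x * f t * exp (- (\<omega> - Re z) * (t - s))) \<le> d * norm x * f t / (\<omega> - Re z)"
        by simp
      have "norm (integral {0..t} (\<lambda>s. K * norm x * exp (\<beta> * t) * exp (- (\<beta> - Re z) * (t - s)))) \<le> K * norm x * exp (\<beta> * t) / (\<beta> - Re z)"
        by (rule integral_exp_bound') (use t \<beta> K in \<open>auto intro!: continuous_intros simp: abs_mult\<close>)
      then show "integral {0..t} (\<lambda>s. K * norm x * exp (\<beta> * t) * exp (- (\<beta> - Re z) * (t - s))) \<le> K * norm x * exp (\<beta> * t) / (\<beta> - Re z)"
        by simp
    qed
    finally show "norm ((E z t o\<^sub>L P) x) \<le> (d / (\<omega> - Re z) * f t + K / (\<beta> - Re z) * exp (\<beta> * t)) * norm x"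
      by (simp add: E_apply[OF t] algebra_simps)
  qed
  have "((\<lambda>t. K / (\<beta> - Re z) * (exp (\<beta> * t) / f t)) \<longlongrightarrow> K / (\<beta> - Re z) * 0) at_top"
    by (intro tendsto_mult_left exp_over_f_tendsto_0 \<beta>)
  then have "\<forall>\<^sub>F t in at_top. K / (\<beta> - Re z) * (exp (\<beta> * t) / f t) < e / 2"
    using e by (intro order_tendstoD(2)) auto
  then show "\<forall>\<^sub>F t in at_top. dist (norm (E z t o\<^sub>L P) / f t) 0 < e"
    using eventually_ge_at_top[of 0]
  proof eventually_elim
    case (elim t)
    have "norm (E z t o\<^sub>L P) / f t \<le> (d / (\<omega> - Re z) * f t + K / (\<beta> - Re z) * exp (\<beta> * t)) / f t"
      using bound f_pos[of t] elim by (intro divide_right_mono) auto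
    also have "\<dots> = d / (\<omega> - Re z) + K / (\<beta> - Re z) * (exp (\<beta> * t) / f t)"
      using f_pos[of t] elim by (simp add: add_divide_distrib)
    also have "d / (\<omega> - Re z) = e / 4" 
      using z nonzero_mult_div_cancel_right[of "\<omega> - Re z" "e / 4"] by (simp add: d_def)
    also have "e / 4 + K / (\<beta> - Re z) * (exp (\<beta> * t) / f t) < e"
      using elim e by linarith
    finally show ?case using f_pos[of t] elim by simp
  qed
qed

section \<open>Exact inverses, comparison of parametrices and the right half-plane\<close>

definition inverts :: "complex \<Rightarrow> 'a \<Rightarrow>\<^sub>L 'a \<Rightarrow> bool" where
  "inverts z S \<longleftrightarrow> (\<forall>x. S x \<in> D \<and> A (S x) - z *\<^sub>C S x = x) \<and> (\<forall>x\<in>D. S (A x - z *\<^sub>C x) = x)"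

text \<open>Operators are real-linear by type. Here complex linearity is inherited from A: the left
  inverse property, applied to c S x, identifies it with S (c x).\<close>

lemma inverts_complex_linear:
  assumes "inverts z S"
  shows "complex_linear S"
  unfolding complex_linear_def
proof (intro allI)
  fix c x
  have Sx: "S x \<in> D" "A (S x) - z *\<^sub>C S x = x"
    using assms by (auto simp: inverts_def)
  from Sx(1) have "A (c *\<^sub>C S x) - z *\<^sub>C c *\<^sub>C S x = c *\<^sub>C (A (S x) - z *\<^sub>C S x)"
    by (simp add: A_scaleC scaleC.diff_right scaleC_scaleC mult.commute)
  then have "A (c *\<^sub>C S x) - z *\<^sub>C c *\<^sub>C S x = c *\<^sub>C x"
    by (simp add: Sx)
  then show "S (c *\<^sub>C x) = c *\<^sub>C S x"
    using assms Sx A_scaleC[OF Sx(1), of c] unfolding inverts_def by metis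
qed

lemma inverts_parametrix:
  assumes "inverts z S"
  shows "parametrix z S 0"
proof -
  have "S (T t x) = T t (S x)" if t: "0 \<le> t" for t x
  proof -
    have Sx: "S x \<in> D" "A (S x) - z *\<^sub>C S x = x"
      using assms by (auto simp: inverts_def)
    from Sx(1) have "A (T t (S x)) - z *\<^sub>C T t (S x) = T t (A (S x) - z *\<^sub>C S x)"
      using t by (simp add: A_T blinfun.diff_right complex_linear_scaleC T_linear)
    then have "A (T t (S x)) - z *\<^sub>C T t (S x) = T t x"
      by (simp add: Sx)
    then show ?thesis
      using assms Sx A_T[OF Sx(1) t] unfolding inverts_def by metis
  qed
  then show ?thesis
    using assms by (simp add: parametrix_def inverts_def)
qed

text \<open>Applying E(z,t) to (A - z) S = I - P gives T(t) S - E(z,t) = exp(z t) S - E(z,t) P. To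
  the left of the line both terms on the right are o(f(t)).\<close>

lemma parametrix_left_half_plane:
  assumes S: "parametrix z S P" and z: "Re z < \<omega>"
  shows "((\<lambda>t. (T t o\<^sub>L S) /\<^sub>R f t - E z t /\<^sub>R f t) \<longlongrightarrow> 0) at_top"
proof (rule tendsto_0_le[where K = 1])
  have "((\<lambda>t. exp (Re z * t) / f t * norm S + norm (E z t o\<^sub>L P) / f t) \<longlongrightarrow> 0 * norm S + 0) at_top"
    using S by (intro tendsto_intros exp_over_f_tendsto_0 E_negligible z) (simp add: parametrix_def)
  then show "((\<lambda>t. exp (Re z * t) / f t * norm S + norm (E z t o\<^sub>L P) / f t) \<longlongrightarrow> 0) at_top"
    by simp
  show "\<forall>\<^sub>F t in at_top. norm ((T t o\<^sub>L S) /\<^sub>R f t - E z t /\<^sub>R f t) \<le>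
      norm (exp (Re z * t) / f t * norm S + norm (E z t o\<^sub>L P) / f t) * 1"
    using eventually_ge_at_top[of 0]
  proof eventually_elim
    case (elim t)
    have "(T t o\<^sub>L S) - E z t = exp (z * of_real t) *\<^sub>C S - (E z t o\<^sub>L P)"
      using parametrix_E[OF S elim] by (intro blinfun_eqI) (simp add: blinfun.diff_left blinfun.diff_right algebra_simps)
    then have "norm ((T t o\<^sub>L S) - E z t) \<le> exp (Re z * t) * norm S + norm (E z t o\<^sub>L P)"
      using norm_triangle_ineq4[of "exp (z * of_real t) *\<^sub>C S" "E z t o\<^sub>L P"]
      by (simp add: norm_scaleC norm_exp_eq_Re)
    then have "norm ((T t o\<^sub>L S) - E z t) / f t \<le> (exp (Re z * t) * norm S + norm (E z t o\<^sub>L P)) / f t"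
      using f_pos[OF elim] by (intro divide_right_mono) auto
    moreover have "norm ((T t o\<^sub>L S) /\<^sub>R f t - E z t /\<^sub>R f t) = norm ((T t o\<^sub>L S) - E z t) / f t"
      using f_pos[OF elim] by (simp add: scaleR_diff_right[symmetric] divide_inverse_commute)
    ultimately show ?case
      by (simp add: add_divide_distrib)
  qed
qed

text \<open>Computing S' (A - z) S in two ways gives S - S' = P' S - S' P. After composition with
  T(t), commutation turns the last term into S' T(t) P, so each term contains a negligible
  factor.\<close>

lemma parametrix_unique:
  assumes S: "parametrix z S P" and S': "parametrix z S' P'"
  shows "((\<lambda>t. (T t o\<^sub>L S) /\<^sub>R f t - (T t o\<^sub>L S') /\<^sub>R f t) \<longlongrightarrow> 0) at_top"
proof (rule tendsto_0_le[where K = 1])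
  have "((\<lambda>t. norm (T t o\<^sub>L P') / f t * norm S + norm S' * (norm (T t o\<^sub>L P) / f t)) \<longlongrightarrow> 0 * norm S + norm S' * 0) at_top"
    using S S' by (intro tendsto_intros) (auto simp: parametrix_def negligible_op_def)
  then show "((\<lambda>t. norm (T t o\<^sub>L P') / f t * norm S + norm S' * (norm (T t o\<^sub>L P) / f t)) \<longlongrightarrow> 0) at_top"
    by simp
  show "\<forall>\<^sub>F t in at_top. norm ((T t o\<^sub>L S) /\<^sub>R f t - (T t o\<^sub>L S') /\<^sub>R f t) \<le>
      norm (norm (T t o\<^sub>L P') / f t * norm S + norm S' * (norm (T t o\<^sub>L P) / f t)) * 1"
    using eventually_ge_at_top[of 0]
  proof eventually_elim
    case (elim t)
    have "(T t o\<^sub>L S) - (T t o\<^sub>L S') = ((T t o\<^sub>L P') o\<^sub>L S) - (S' o\<^sub>L (T t o\<^sub>L P))"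
    proof (rule blinfun_eqI)
      fix x
      have "S' (x - P x) = S x - P' (S x)"
        using S S' by (metis parametrix_def)
      then have "T t (S' (x - P x)) = T t (S x - P' (S x))"
        by simp
      then have "T t (S x) - T t (S' x) = T t (P' (S x)) - T t (S' (P x))"
        by (simp add: blinfun.diff_right algebra_simps)
      also have "T t (S' (P x)) = S' (T t (P x))"
        using S' elim by (simp add: parametrix_def)
      finally show "((T t o\<^sub>L S) - (T t o\<^sub>L S')) x = (((T t o\<^sub>L P') o\<^sub>L S) - (S' o\<^sub>L (T t o\<^sub>L P))) x"
        by (simp add: blinfun.diff_left)
    qed
    then have "norm ((T t o\<^sub>L S) - (T t o\<^sub>L S')) \<le> norm (T t o\<^sub>L P') * norm S + norm S' * norm (T t o\<^sub>L P)"
      by (simp only:) (intro order_trans[OF norm_triangle_ineq4] add_mono norm_blinfun_compose)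
    then have "norm ((T t o\<^sub>L S) - (T t o\<^sub>L S')) / f t \<le> (norm (T t o\<^sub>L P') * norm S + norm S' * norm (T t o\<^sub>L P)) / f t"
      using f_pos[OF elim] by (intro divide_right_mono) auto
    moreover have "norm ((T t o\<^sub>L S) /\<^sub>R f t - (T t o\<^sub>L S') /\<^sub>R f t) = norm ((T t o\<^sub>L S) - (T t o\<^sub>L S')) / f t"
      using f_pos[OF elim] by (simp add: scaleR_diff_right[symmetric] divide_inverse_commute)
    ultimately show ?case
      by (simp add: add_divide_distrib)
  qed
qed

text \<open>Write T(t) S x as exp(-z \<tau>) times T(t + \<tau>) S x - T(t) E(z,\<tau>) x. As \<tau>
  grows the first part vanishes because Re z exceeds \<omega> + \<epsilon>; the second is a
  truncated Laplace integral bounded by f(t) ||x|| / \<kappa>.\<close>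

lemma T_inverse_le:
  assumes S: "inverts z S" and \<epsilon>: "\<omega> + \<epsilon> < Re z" and t: "0 \<le> t"
    and up: "\<And>s. 0 \<le> s \<Longrightarrow> f (t + s) \<le> f t * exp ((\<omega> + \<epsilon>) * s)"
  shows "norm (T t o\<^sub>L S) \<le> f t / (Re z - \<omega> - \<epsilon>)"
proof (rule norm_blinfun_bound)
  define \<kappa> where "\<kappa> = Re z - \<omega> - \<epsilon>"
  have \<kappa>: "0 < \<kappa>" using \<epsilon> by (simp add: \<kappa>_def)
  show "0 \<le> f t / (Re z - \<omega> - \<epsilon>)" using f_pos[OF t] \<epsilon> by simp
  fix x
  have le: "norm (T t (S x)) \<le> exp (- \<kappa> * \<tau>) * (f t * norm (S x)) + f t * norm x / \<kappa>" if \<tau>: "0 \<le> \<tau>" for \<tau>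
  proof -
    have "exp (z * of_real \<tau>) *\<^sub>C S x = T \<tau> (S x) - E z \<tau> x"
      using parametrix_E[OF inverts_parametrix[OF S] \<tau>, of x] by simp
    then have "T t (exp (z * of_real \<tau>) *\<^sub>C S x) = T (t + \<tau>) (S x) - T t (E z \<tau> x)"
      using t \<tau> by (simp add: blinfun.diff_right T_add)
    then have "norm (exp (z * of_real \<tau>) *\<^sub>C T t (S x)) \<le> norm (T (t + \<tau>) (S x)) + norm (T t (E z \<tau> x))"
      using t by (simp add: complex_linear_scaleC T_linear norm_triangle_ineq4)
    also have "norm (T (t + \<tau>) (S x)) \<le> f t * exp ((\<omega> + \<epsilon>) * \<tau>) * norm (S x)"
      using T_apply_le[of "t + \<tau>" "S x"] mult_right_mono[OF up[OF \<tau>], of "norm (S x)"] t \<tau> by simp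
    also have "norm (T t (E z \<tau> x)) \<le> exp (Re z * \<tau>) * f t * norm x / \<kappa>"
      unfolding E_def T_conv[OF continuous_on_exp_kernel \<tau> t]
    proof (rule integral_exp_bound[OF _ \<kappa> \<tau>])
      show "continuous_on {0..\<tau>} (\<lambda>s. exp (z * of_real (\<tau> - s)) *\<^sub>C T (t + s) x)"
        by (intro continuous_intros continuous_on_compose2[OF continuous_on_T]) (use t in auto)
      fix s assume s: "s \<in> {0..\<tau>}"
      have "norm (exp (z * of_real (\<tau> - s)) *\<^sub>C T (t + s) x) \<le> exp (Re z * (\<tau> - s)) * (f t * exp ((\<omega> + \<epsilon>) * s) * norm x)"
        unfolding norm_scaleC norm_exp_eq_Re
        using s t by (intro mult_mono order_trans[OF T_apply_le] mult_right_mono up) auto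
      also have "\<dots> = f t * norm x * (exp (Re z * (\<tau> - s)) * exp ((\<omega> + \<epsilon>) * s))"
        by (simp only: mult_ac)
      also have "exp (Re z * (\<tau> - s)) * exp ((\<omega> + \<epsilon>) * s) = exp (Re z * \<tau>) * exp (- \<kappa> * s)"
        unfolding exp_add[symmetric] by (simp add: \<kappa>_def algebra_simps)
      finally show "norm (exp (z * of_real (\<tau> - s)) *\<^sub>C T (t + s) x) \<le> exp (Re z * \<tau>) * f t * norm x * exp (- \<kappa> * s)"
        by (simp only: mult_ac)
    qed
    finally have "exp (Re z * \<tau>) * norm (T t (S x)) \<le>
        f t * exp ((\<omega> + \<epsilon>) * \<tau>) * norm (S x) + exp (Re z * \<tau>) * f t * norm x / \<kappa>"
      by (simp add: norm_scaleC norm_exp_eq_Re)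
    then have "exp (- (Re z * \<tau>)) * (exp (Re z * \<tau>) * norm (T t (S x))) \<le>
        exp (- (Re z * \<tau>)) * (f t * exp ((\<omega> + \<epsilon>) * \<tau>) * norm (S x) + exp (Re z * \<tau>) * f t * norm x / \<kappa>)"
      by (rule mult_left_mono) simp
    also have "\<dots> = (exp (- (Re z * \<tau>)) * exp ((\<omega> + \<epsilon>) * \<tau>)) * (f t * norm (S x)) +
        (exp (- (Re z * \<tau>)) * exp (Re z * \<tau>)) * (f t * norm x / \<kappa>)"
      by (simp add: algebra_simps)
    also have "exp (- (Re z * \<tau>)) * exp ((\<omega> + \<epsilon>) * \<tau>) = exp (- \<kappa> * \<tau>)"
      unfolding exp_add[symmetric] by (simp add: \<kappa>_def algebra_simps)
    finally show ?thesis
      by (simp add: mult.assoc[symmetric] exp_add[symmetric])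
  qed
  have "((\<lambda>\<tau>. exp (- \<kappa> * \<tau>)) \<longlongrightarrow> 0) at_top"
    using \<kappa> by (intro filterlim_compose[OF exp_at_bot] filterlim_tendsto_neg_mult_at_bot[OF tendsto_const] filterlim_ident) auto
  then have "((\<lambda>\<tau>. exp (- \<kappa> * \<tau>) * (f t * norm (S x)) + f t * norm x / \<kappa>) \<longlongrightarrow>
      0 * (f t * norm (S x)) + f t * norm x / \<kappa>) at_top"
    by (intro tendsto_intros)
  then have "norm (T t (S x)) \<le> 0 * (f t * norm (S x)) + f t * norm x / \<kappa>"
    by (rule tendsto_lowerbound) (use eventually_mono[OF eventually_ge_at_top[of 0] le] in auto)
  then show "norm ((T t o\<^sub>L S) x) \<le> f t / (Re z - \<omega> - \<epsilon>) * norm x"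
    by (simp add: \<kappa>_def)
qed

lemma limsup_norm_inverse_le:
  assumes S: "inverts z S" and z: "\<omega> < Re z"
  shows "limsup_norm (\<lambda>t. (T t o\<^sub>L S) /\<^sub>R f t) \<le> 1 / (Re z - \<omega>)"
proof (rule limsup_norm_le)
  show "0 \<le> 1 / (Re z - \<omega>)" using z by simp
  fix e :: real assume e: "0 < e"
  have "((\<lambda>\<epsilon>. 1 / (Re z - \<omega> - \<epsilon>)) \<longlongrightarrow> 1 / (Re z - \<omega> - 0)) (at_right 0)"
    by (intro tendsto_intros) (use z in auto)
  then have "\<forall>\<^sub>F \<epsilon> in at_right 0. 1 / (Re z - \<omega> - \<epsilon>) < 1 / (Re z - \<omega>) + e"
    using e by (intro order_tendstoD(2)) auto
  then have "\<forall>\<^sub>F \<epsilon> in at_right 0. 1 / (Re z - \<omega> - \<epsilon>) < 1 / (Re z - \<omega>) + e \<and> 0 < \<epsilon> \<and> \<epsilon> < Re z - \<omega>"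
    using eventually_at_right_real[of 0 "Re z - \<omega>"] z by (auto elim: eventually_elim2)
  then obtain \<epsilon> where \<epsilon>: "1 / (Re z - \<omega> - \<epsilon>) < 1 / (Re z - \<omega>) + e" "0 < \<epsilon>" "\<epsilon> < Re z - \<omega>"
    by (auto dest: eventually_happens)
  obtain s\<^sub>0 where s\<^sub>0: "s\<^sub>0 \<ge> 0" "\<And>s t. s\<^sub>0 \<le> s \<Longrightarrow> s \<le> t \<Longrightarrow> f t \<le> f s * exp ((\<omega> + \<epsilon>) * (t - s))"
    using f_upper[OF \<epsilon>(2)] by blast
  show "\<forall>\<^sub>F t in at_top. norm ((T t o\<^sub>L S) /\<^sub>R f t) \<le> 1 / (Re z - \<omega>) + e"
    using eventually_ge_at_top[of s\<^sub>0]
  proof eventually_elim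
    case (elim t)
    have t: "0 \<le> t" using elim s\<^sub>0 by simp
    have "norm (T t o\<^sub>L S) \<le> f t / (Re z - \<omega> - \<epsilon>)"
      by (rule T_inverse_le[OF S _ t]) (use \<epsilon> s\<^sub>0(2)[of t "t + _"] elim in auto)
    then have "norm (T t o\<^sub>L S) / f t \<le> f t / (Re z - \<omega> - \<epsilon>) / f t"
      using f_pos[OF t] by (intro divide_right_mono) auto
    also have "\<dots> = 1 / (Re z - \<omega> - \<epsilon>)" using f_pos[OF t] by simp
    finally show ?case using \<epsilon> f_pos[OF t] by (simp add: divide_inverse_commute)
  qed
qed

text \<open>Normalizing (A - z) E(z,\<tau>) = T(\<tau>) - exp(z \<tau>) gives (A - z) V = I - K with
  K = exp(-z \<tau>) T(\<tau>). For one large \<tau> this K is a strict contraction, so a finite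
  Laplace integral and a Neumann series produce the inverse without an improper integral.\<close>

lemma right_half_plane_inverts:
  assumes z: "\<omega> < Re z"
  shows "\<exists>S. inverts z S"
proof -
  define \<epsilon> where "\<epsilon> = (Re z - \<omega>) / 2"
  have \<epsilon>: "0 < \<epsilon>" using z by (simp add: \<epsilon>_def)
  obtain s\<^sub>0 where s\<^sub>0: "s\<^sub>0 \<ge> 0" "\<And>t. s\<^sub>0 \<le> t \<Longrightarrow> f t \<le> f s\<^sub>0 * exp ((\<omega> + \<epsilon>) * (t - s\<^sub>0))"
    using f_upper[OF \<epsilon>] by blast
  have "((\<lambda>\<tau>. exp (- \<epsilon> * \<tau>)) \<longlongrightarrow> 0) at_top"
    using \<epsilon> by (intro filterlim_compose[OF exp_at_bot] filterlim_tendsto_neg_mult_at_bot[OF tendsto_const] filterlim_ident) auto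
  then have "((\<lambda>\<tau>. f s\<^sub>0 * exp (- (\<omega> + \<epsilon>) * s\<^sub>0) * exp (- \<epsilon> * \<tau>)) \<longlongrightarrow> f s\<^sub>0 * exp (- (\<omega> + \<epsilon>) * s\<^sub>0) * 0) at_top"
    by (intro tendsto_intros)
  then have "\<forall>\<^sub>F \<tau> in at_top. f s\<^sub>0 * exp (- (\<omega> + \<epsilon>) * s\<^sub>0) * exp (- \<epsilon> * \<tau>) < 1"
    by (intro order_tendstoD(2)) auto
  then have "\<forall>\<^sub>F \<tau> in at_top. f s\<^sub>0 * exp (- (\<omega> + \<epsilon>) * s\<^sub>0) * exp (- \<epsilon> * \<tau>) < 1 \<and> s\<^sub>0 \<le> \<tau>"
    using eventually_ge_at_top[of s\<^sub>0] by eventually_elim simp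
  then obtain \<tau> where \<tau>: "f s\<^sub>0 * exp (- (\<omega> + \<epsilon>) * s\<^sub>0) * exp (- \<epsilon> * \<tau>) < 1" "s\<^sub>0 \<le> \<tau>"
    by (auto dest: eventually_happens)
  have \<tau>0: "0 \<le> \<tau>" using \<tau> s\<^sub>0 by simp
  define c where "c = exp (- z * of_real \<tau>)"
  have c: "c * exp (z * of_real \<tau>) = 1" "exp (z * of_real \<tau>) * c = 1"
    by (simp_all add: c_def exp_add[symmetric])
  define K where "K = c *\<^sub>C T \<tau>"
  have K_lin: "complex_linear K"
    using T_linear[OF \<tau>0] by (simp add: complex_linear_def K_def scaleC_scaleC mult.commute)
  have "norm K \<le> exp (- (Re z * \<tau>)) * (f s\<^sub>0 * exp ((\<omega> + \<epsilon>) * (\<tau> - s\<^sub>0)))"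
    unfolding K_def norm_scaleC c_def norm_exp_eq_Re
    using T_le[OF \<tau>0] s\<^sub>0(2)[OF \<tau>(2)] by (intro mult_mono) auto
  also have "\<dots> = f s\<^sub>0 * (exp (- (Re z * \<tau>)) * exp ((\<omega> + \<epsilon>) * (\<tau> - s\<^sub>0)))"
    by simp
  also have "exp (- (Re z * \<tau>)) * exp ((\<omega> + \<epsilon>) * (\<tau> - s\<^sub>0)) = exp (- (\<omega> + \<epsilon>) * s\<^sub>0) * exp (- \<epsilon> * \<tau>)"
    unfolding exp_add[symmetric] by (simp add: \<epsilon>_def field_simps)
  finally have K1: "norm K < 1" using \<tau>(1) by simp
  \<comment> \<open>The series in \<open>neumann\<close> starts with K itself, so adding the
    identity gives (I - K)^(-1).\<close>
  define J where "J = id_blinfun + neumann K 1"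
  have JK: "J x - J (K x) = x" for x
    using neumann_eq(2)[of 1 K] K1 K_lin by (simp add: J_def blinfun.add_left blinfun.diff_right)
      (metis (no_types, lifting) add_diff_cancel_right' blinfun.add_left blinfun_apply_blinfun_compose)
  have KJ: "J x - K (J x) = x" for x
    using neumann_eq(1)[of 1 K] K1 K_lin by (simp add: J_def blinfun.add_left blinfun.add_right)
      (metis (no_types, lifting) add_diff_cancel_right' blinfun.add_left blinfun_apply_blinfun_compose)
  define V where "V = (- c) *\<^sub>C E z \<tau>"
  have V1: "V x \<in> D" "A (V x) - z *\<^sub>C V x = x - K x" for x
  proof -
    note g = E_generator[OF \<tau>0, of z x]
    show "V x \<in> D" using A_scaleC[OF g(1)] by (simp add: V_def)
    have "A (V x) - z *\<^sub>C V x = (- c) *\<^sub>C (A (E z \<tau> x) - z *\<^sub>C E z \<tau> x)"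
      using A_scaleC[OF g(1), of "- c"] by (simp add: V_def scaleC.diff_right scaleC_scaleC mult.commute)
    also have "\<dots> = (- c) *\<^sub>C (T \<tau> x - exp (z * of_real \<tau>) *\<^sub>C x)"
      by (simp add: g)
    also have "\<dots> = x - K x"
      using c by (simp add: K_def scaleC.diff_right scaleC_scaleC scaleC.minus_left)
    finally show "A (V x) - z *\<^sub>C V x = x - K x" .
  qed
  have V2: "V (A x - z *\<^sub>C x) = x - K x" if "x \<in> D" for x
    using E_A[OF that \<tau>0, of z] c by (simp add: V_def K_def scaleC.diff_right scaleC_scaleC scaleC.minus_left blinfun.minus_left)
  have "inverts z (V o\<^sub>L J)"
    unfolding inverts_def
  proof (intro conjI allI ballI)
    fix x
    show r1: "(V o\<^sub>L J) x \<in> D" and r2: "A ((V o\<^sub>L J) x) - z *\<^sub>C (V o\<^sub>L J) x = x" for x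
      using V1[of "J x"] KJ by auto
    assume x: "x \<in> D"
    have left: "J (V (A y - z *\<^sub>C y)) = y" if "y \<in> D" for y
      unfolding V2[OF that] using JK[of y] by (simp add: blinfun.diff_right)
    \<comment> \<open>A left inverse J V and a right inverse V J must coincide; this avoids proving
      that J commutes with V.\<close>
    have "J (V (A x - z *\<^sub>C x)) = (V o\<^sub>L J) (A x - z *\<^sub>C x)"
      using left[OF r1[of "A x - z *\<^sub>C x"]] r2[of "A x - z *\<^sub>C x"] by simp
    then show "(V o\<^sub>L J) (A x - z *\<^sub>C x) = x"
      using left[OF x] by simp
  qed
  then show ?thesis by blast
qed

section \<open>Local analytic families of parametrices and their gluing\<close>

definition local_parametrix :: "complex \<Rightarrow> bool" where
  "local_parametrix z\<^sub>0 \<longleftrightarrow> (\<exists>\<rho>>0. \<exists>S P K.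
     (\<forall>z\<in>ball z\<^sub>0 (2 * \<rho>). parametrix z (S z) P \<and> norm (S z) \<le> K) \<and>
     (\<forall>z\<in>ball z\<^sub>0 \<rho>. \<forall>r. 0 < r \<and> r \<le> \<rho> \<longrightarrow> mean_value S z r))"

lemma inverts_local_parametrix:
  assumes R: "inverts z\<^sub>0 R"
  shows "local_parametrix z\<^sub>0"
proof -
  \<comment> \<open>A sixth of the reciprocal norm makes 3 \<rho> ||R|| at most 1/2; adding 1 to the
    norm covers R = 0.\<close>
  define \<rho> where "\<rho> = 1 / (6 * (norm R + 1))"
  have \<rho>: "0 < \<rho>" "3 * \<rho> * norm R \<le> 1/2"
    by (auto simp: \<rho>_def field_simps add_pos_nonneg)
  define S where "S z = neumann R (z - z\<^sub>0)" for z
  have lin: "complex_linear R" using inverts_complex_linear[OF R] .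
  have small: "cmod (z - z\<^sub>0) * norm R \<le> 1/2" if "z \<in> ball z\<^sub>0 (2 * \<rho>)" for z
  proof -
    have "cmod (z - z\<^sub>0) * norm R \<le> (3 * \<rho>) * norm R"
      using that \<rho>(1) by (intro mult_right_mono) (auto simp: dist_norm norm_minus_commute)
    then show ?thesis using \<rho>(2) by simp
  qed
  have "inverts z (S z)" if z: "z \<in> ball z\<^sub>0 (2 * \<rho>)" for z
  proof -
    define c where "c = z - z\<^sub>0"
    have lt: "cmod c * norm R < 1" using small[OF z] by (simp add: c_def)
    have eq1: "S z x = R (x + c *\<^sub>C S z x)" for x
      using arg_cong[OF neumann_eq(1)[OF lt lin], of "\<lambda>B. blinfun_apply B x"]
      by (simp add: S_def c_def blinfun.add_left blinfun.add_right)
    have eq2: "S z y = R y + S z (c *\<^sub>C R y)" for y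
      using arg_cong[OF neumann_eq(2)[OF lt lin], of "\<lambda>B. blinfun_apply B y"]
      by (simp add: S_def c_def blinfun.add_left)
    have zc: "z *\<^sub>C x = z\<^sub>0 *\<^sub>C x + c *\<^sub>C x" for x
      by (simp add: c_def scaleC.add_left[symmetric])
    show ?thesis
      unfolding inverts_def
    proof (intro conjI allI ballI)
      fix x
      show "S z x \<in> D"
        by (subst eq1) (use R in \<open>auto simp: inverts_def\<close>)
      have "A (S z x) - z\<^sub>0 *\<^sub>C S z x = x + c *\<^sub>C S z x"
        using R eq1[of x] by (metis inverts_def)
      then show "A (S z x) - z *\<^sub>C S z x = x"
        by (simp add: zc algebra_simps)
      assume "x \<in> D"
      then have Rx: "R (A x - z\<^sub>0 *\<^sub>C x) = x" using R by (simp add: inverts_def)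
      have "A x - z *\<^sub>C x = (A x - z\<^sub>0 *\<^sub>C x) - c *\<^sub>C x"
        by (simp add: zc)
      also have "S z \<dots> = S z (A x - z\<^sub>0 *\<^sub>C x) - S z (c *\<^sub>C x)"
        by (rule blinfun.diff_right)
      also have "\<dots> = x"
        using eq2[of "A x - z\<^sub>0 *\<^sub>C x"] unfolding Rx by simp
      finally show "S z (A x - z *\<^sub>C x) = x" .
    qed
  qed
  moreover have "norm (S z) \<le> 2 * norm R" if "z \<in> ball z\<^sub>0 (2 * \<rho>)" for z
    unfolding S_def by (rule norm_neumann_le[OF small[OF that]])
  moreover have "mean_value S z r" if "z \<in> ball z\<^sub>0 \<rho>" "0 < r" "r \<le> \<rho>" for z r
    using mean_value_neumann[OF \<rho>(2) that] by (simp add: S_def[abs_def])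
  ultimately show ?thesis
    unfolding local_parametrix_def
    by - (rule exI[of _ \<rho>], rule conjI[OF \<rho>(1)], rule exI[of _ S], rule exI[of _ 0],
      rule exI[of _ "2 * norm R"], auto intro: inverts_parametrix)
qed

text \<open>To the left of the line this is defined even where no parametrix exists; on the line and to its right
  \<open>SOME\<close> is used only where one exists, and the value does not depend on the choice.\<close>

definition tail_size :: "complex \<Rightarrow> real" where
  "tail_size z = (if Re z < \<omega> then limsup_norm (\<lambda>t. E z t /\<^sub>R f t)
     else limsup_norm (\<lambda>t. (T t o\<^sub>L (SOME S. \<exists>P. parametrix z S P)) /\<^sub>R f t))"

text \<open>To the left of the line any parametrix agrees with E(z,t) modulo o(f(t)), elsewhere any
  two parametrices agree. This makes locally constructed families describe one global
  function.\<close>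

lemma tail_size_parametrix:
  assumes S: "parametrix z S P"
  shows "tail_size z = limsup_norm (\<lambda>t. (T t o\<^sub>L S) /\<^sub>R f t)"
proof (cases "Re z < \<omega>")
  case True
  then show ?thesis
    using limsup_norm_cong[OF eventually_T_compose_le eventually_E_le[OF True] parametrix_left_half_plane[OF S True]]
    by (simp add: tail_size_def)
next
  case False
  have "\<exists>P. parametrix z (SOME S. \<exists>P. parametrix z S P) P"
    using S by (intro someI_ex[of "\<lambda>S. \<exists>P. parametrix z S P"]) blast
  then obtain P' where P': "parametrix z (SOME S. \<exists>P. parametrix z S P) P'" ..
  show ?thesis
    using limsup_norm_cong[OF eventually_T_compose_le eventually_T_compose_le parametrix_unique[OF P' S]] False
    by (simp only: tail_size_def if_False)
qed

lemma tail_size_left_half_plane: "Re z < \<omega> \<Longrightarrow> tail_size z \<le> 1 / (\<omega> - Re z)"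
  unfolding tail_size_def by (auto intro!: limsup_norm_le_eventually eventually_E_le)

lemma bounded_linear_T_compose: "bounded_linear (\<lambda>S. (T t o\<^sub>L S) /\<^sub>R f t)"
  by (rule bounded_linear_compose[OF bounded_linear_scaleR_right
    bounded_bilinear.bounded_linear_right[OF bounded_bilinear_blinfun_compose]])

text \<open>A ball about a point of the line also meets the left half-plane, where the value is
  defined through E. There the parametrix family gives the same value, so the mean value property of
  the family carries over to the whole ball.\<close>

lemma log_subharmonic_tail_size:
  assumes loc: "\<And>z\<^sub>0. \<omega> \<le> Re z\<^sub>0 \<Longrightarrow> local_parametrix z\<^sub>0"
  shows "log_subharmonic tail_size"
  unfolding log_subharmonic_def
proof
  fix z\<^sub>0 :: complex
  \<comment> \<open>Circles of radius at most \<rho> about centres within \<rho> reach as far as 2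
    \<rho>; hence the larger ball in \<open>local_parametrix\<close>.\<close>
  have in_ball: "\<zeta> \<in> ball z\<^sub>0 (2 * \<rho>)" if "z \<in> ball z\<^sub>0 \<rho>" "r \<le> \<rho>" "\<zeta> \<in> insert z (sphere z r)" "0 < r" for z \<zeta> :: complex and r \<rho> :: real
  proof -
    have "dist z\<^sub>0 \<zeta> \<le> dist z\<^sub>0 z + dist z \<zeta>" by (rule dist_triangle)
    then show ?thesis using that by auto
  qed
  show "\<exists>\<rho>>0. \<exists>K. \<forall>z\<in>ball z\<^sub>0 \<rho>. tail_size z \<le> K \<and> (\<forall>r. 0 < r \<and> r \<le> \<rho> \<longrightarrow> submean tail_size z r)"
  proof (cases "Re z\<^sub>0 < \<omega>")
    case True
    define \<rho> where "\<rho> = (\<omega> - Re z\<^sub>0) / 4"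
    have \<rho>: "0 < \<rho>" "Re z\<^sub>0 + 4 * \<rho> \<le> \<omega>" using True by (auto simp: \<rho>_def field_simps)
    have left: "Re \<zeta> \<le> \<omega> - 2 * \<rho>" if "\<zeta> \<in> ball z\<^sub>0 (2 * \<rho>)" for \<zeta>
    proof -
      have "Re (\<zeta> - z\<^sub>0) \<le> 2 * \<rho>"
        using complex_Re_le_cmod[of "\<zeta> - z\<^sub>0"] that by (simp add: dist_norm norm_minus_commute)
      then show ?thesis using \<rho> by simp
    qed
    show ?thesis
    proof (rule exI[of _ \<rho>], rule conjI[OF \<rho>(1)], rule exI[of _ "1 / (2 * \<rho>)"], intro ballI conjI allI impI)
      fix z assume z: "z \<in> ball z\<^sub>0 \<rho>"
      have zl: "Re z \<le> \<omega> - 2 * \<rho>" using left z \<rho>(1) by auto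
      have "tail_size z \<le> 1 / (\<omega> - Re z)"
        using zl \<rho>(1) by (intro tail_size_left_half_plane) simp
      also have "\<dots> \<le> 1 / (2 * \<rho>)"
        using zl \<rho>(1) by (intro divide_left_mono) auto
      finally show "tail_size z \<le> 1 / (2 * \<rho>)" .
      fix r assume r: "0 < r \<and> r \<le> \<rho>"
      have l: "Re \<zeta> < \<omega>" if "\<zeta> \<in> insert z (sphere z r)" for \<zeta>
        using left[OF in_ball[OF z _ that]] r \<rho>(1) by auto
      show "submean tail_size z r"
      proof (rule submean_limsup_norm[where \<Phi> = "\<lambda>\<zeta> t. E \<zeta> t /\<^sub>R f t"])
        show "\<exists>K. \<forall>\<^sub>F t in at_top. norm (E \<zeta> t /\<^sub>R f t) \<le> K" if "\<zeta> \<in> insert z (sphere z r)" for \<zeta>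
          using eventually_E_le[OF l[OF that]] by blast
        show "tail_size \<zeta> = limsup_norm (\<lambda>t. E \<zeta> t /\<^sub>R f t)" if "\<zeta> \<in> insert z (sphere z r)" for \<zeta>
          using l[OF that] by (simp add: tail_size_def)
        fix g and e :: real assume g: "g holomorphic_on UNIV" and e: "0 < e"
        obtain M where M: "M > 0" "\<And>t. t \<ge> 0 \<Longrightarrow> norm (circle_mean M r z (\<lambda>\<zeta>. g \<zeta> *\<^sub>C E \<zeta> t) - g z *\<^sub>C E z t) \<le> e * f t"
          using E_mean_value[OF \<rho> z conjunct1[OF r] conjunct2[OF r] g e] by blast
        have le: "norm (circle_mean M r z (\<lambda>\<zeta>. g \<zeta> *\<^sub>C (E \<zeta> t /\<^sub>R f t)) - g z *\<^sub>C (E z t /\<^sub>R f t)) \<le> e"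
          if t: "0 \<le> t" for t
        proof -
          have "circle_mean M r z (\<lambda>\<zeta>. g \<zeta> *\<^sub>C (E \<zeta> t /\<^sub>R f t)) - g z *\<^sub>C (E z t /\<^sub>R f t) =
              (circle_mean M r z (\<lambda>\<zeta>. g \<zeta> *\<^sub>C E \<zeta> t) - g z *\<^sub>C E z t) /\<^sub>R f t"
            by (simp add: bounded_linear_circle_mean[OF bounded_linear_scaleR_right] scaleC_scaleR_commute scaleR_diff_right)
          then show ?thesis
            using M(2)[OF t] f_pos[OF t]
            by (simp only: norm_scaleR) (simp add: inverse_eq_divide pos_divide_le_eq)
        qed
        show "\<exists>M>0. \<forall>\<^sub>F t in at_top. norm (circle_mean M r z (\<lambda>\<zeta>. g \<zeta> *\<^sub>C (E \<zeta> t /\<^sub>R f t)) - g z *\<^sub>C (E z t /\<^sub>R f t)) \<le> e"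
          by (rule exI[of _ M], rule conjI[OF M(1)], rule eventually_mono[OF eventually_ge_at_top[of 0]], rule le)
      qed (use r in auto)
    qed
  next
    case False
    then have "local_parametrix z\<^sub>0" by (intro loc) simp
    then obtain \<rho> S P K where \<rho>: "\<rho> > 0"
      and par_le: "\<forall>z\<in>ball z\<^sub>0 (2 * \<rho>). parametrix z (S z) P \<and> norm (S z) \<le> K"
      and mean: "\<forall>z\<in>ball z\<^sub>0 \<rho>. \<forall>r. 0 < r \<and> r \<le> \<rho> \<longrightarrow> mean_value S z r"
      unfolding local_parametrix_def by (elim exE conjE) (rule that)
    have par: "\<And>z. z \<in> ball z\<^sub>0 (2 * \<rho>) \<Longrightarrow> parametrix z (S z) P"
      and K: "\<And>z. z \<in> ball z\<^sub>0 (2 * \<rho>) \<Longrightarrow> norm (S z) \<le> K"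
      and mv: "\<And>z r. z \<in> ball z\<^sub>0 \<rho> \<Longrightarrow> 0 < r \<Longrightarrow> r \<le> \<rho> \<Longrightarrow> mean_value S z r"
      using par_le mean by blast+
    show ?thesis
    proof (rule exI[of _ \<rho>], rule conjI[OF \<rho>], rule exI[of _ K], intro ballI conjI allI impI)
      fix z assume z: "z \<in> ball z\<^sub>0 \<rho>"
      have z2: "z \<in> ball z\<^sub>0 (2 * \<rho>)" using z \<rho> by auto
      show "tail_size z \<le> K"
        unfolding tail_size_parametrix[OF par[OF z2]]
      proof (rule limsup_norm_le_eventually)
        show "0 \<le> K" using K[OF z2] norm_ge_zero order_trans by blast
        show "\<forall>\<^sub>F t in at_top. norm ((T t o\<^sub>L S z) /\<^sub>R f t) \<le> K"
          using eventually_T_compose_le[of "S z"] by eventually_elim (use K[OF z2] in linarith)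
      qed
      fix r assume r: "0 < r \<and> r \<le> \<rho>"
      show "submean tail_size z r"
      proof (rule submean_limsup_norm[where \<Phi> = "\<lambda>\<zeta> t. (T t o\<^sub>L S \<zeta>) /\<^sub>R f t"])
        show "\<exists>K. \<forall>\<^sub>F t in at_top. norm ((T t o\<^sub>L S \<zeta>) /\<^sub>R f t) \<le> K" for \<zeta>
          using eventually_T_compose_le by blast
        show "tail_size \<zeta> = limsup_norm (\<lambda>t. (T t o\<^sub>L S \<zeta>) /\<^sub>R f t)" if "\<zeta> \<in> insert z (sphere z r)" for \<zeta>
          by (rule tail_size_parametrix[OF par[OF in_ball[OF z conjunct2[OF r] that conjunct1[OF r]]]])
        fix g and e :: real assume g: "g holomorphic_on UNIV" and e: "0 < e"
        have "\<exists>M>0. norm (circle_mean M r z (\<lambda>\<zeta>. g \<zeta> *\<^sub>C S \<zeta>) - g z *\<^sub>C S z) \<le> e"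
          using mv[OF z conjunct1[OF r] conjunct2[OF r], unfolded mean_value_def, rule_format, OF g e] .
        then obtain M where M: "M > 0" "norm (circle_mean M r z (\<lambda>\<zeta>. g \<zeta> *\<^sub>C S \<zeta>) - g z *\<^sub>C S z) \<le> e"
          by (elim exE conjE) (rule that)
        have le: "norm (circle_mean M r z (\<lambda>\<zeta>. g \<zeta> *\<^sub>C ((T t o\<^sub>L S \<zeta>) /\<^sub>R f t)) - g z *\<^sub>C ((T t o\<^sub>L S z) /\<^sub>R f t)) \<le> e"
          if t: "0 \<le> t" "norm ((T t o\<^sub>L (circle_mean M r z (\<lambda>\<zeta>. g \<zeta> *\<^sub>C S \<zeta>) - g z *\<^sub>C S z)) /\<^sub>R f t)
            \<le> norm (circle_mean M r z (\<lambda>\<zeta>. g \<zeta> *\<^sub>C S \<zeta>) - g z *\<^sub>C S z)" for t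
        proof -
          have sc: "(T t o\<^sub>L (c *\<^sub>C B)) /\<^sub>R f t = c *\<^sub>C ((T t o\<^sub>L B) /\<^sub>R f t)" for c B
            using t by (simp add: complex_linear_compose_scaleC T_linear scaleC_scaleR_commute)
          have "circle_mean M r z (\<lambda>\<zeta>. g \<zeta> *\<^sub>C ((T t o\<^sub>L S \<zeta>) /\<^sub>R f t)) - g z *\<^sub>C ((T t o\<^sub>L S z) /\<^sub>R f t) =
              (T t o\<^sub>L (circle_mean M r z (\<lambda>\<zeta>. g \<zeta> *\<^sub>C S \<zeta>) - g z *\<^sub>C S z)) /\<^sub>R f t"
            unfolding linear_diff[OF bounded_linear.linear[OF bounded_linear_T_compose]] bounded_linear_circle_mean[OF bounded_linear_T_compose] sc ..
          then show ?thesis using t(2) M(2) by simp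
        qed
        show "\<exists>M>0. \<forall>\<^sub>F t in at_top. norm (circle_mean M r z (\<lambda>\<zeta>. g \<zeta> *\<^sub>C ((T t o\<^sub>L S \<zeta>) /\<^sub>R f t)) - g z *\<^sub>C ((T t o\<^sub>L S z) /\<^sub>R f t)) \<le> e"
          by (rule exI[of _ M], rule conjI[OF M(1)],
              rule eventually_elim2[OF eventually_ge_at_top[of 0] eventually_T_compose_le], rule le)
      qed (use r in auto)
    qed
  qed
qed

text \<open>To the right of the line exact inverses exist and supply local parametrices, which
  leaves only the line to be assumed. The two half-plane estimates then feed the Liouville argument
  with C = 1.\<close>

lemma inverse_negligible:
  assumes loc: "\<And>z\<^sub>0. Re z\<^sub>0 = \<omega> \<Longrightarrow> local_parametrix z\<^sub>0" and R: "inverts \<mu> R"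
  shows "negligible_op R"
proof -
  have loc': "local_parametrix z\<^sub>0" if "\<omega> \<le> Re z\<^sub>0" for z\<^sub>0
    using that loc[of z\<^sub>0] right_half_plane_inverts[of z\<^sub>0] inverts_local_parametrix
    by (cases "Re z\<^sub>0 = \<omega>") auto
  have nonneg: "0 \<le> tail_size z" for z
    unfolding tail_size_def
    using limsup_norm_nonneg[OF eventually_E_le] limsup_norm_nonneg[OF eventually_T_compose_le] by auto
  have bnd: "tail_size z \<le> 1 / \<bar>Re z - \<omega>\<bar>" if "Re z \<noteq> \<omega>" for z
  proof (cases "Re z < \<omega>")
    case True
    then show ?thesis
      using tail_size_left_half_plane[OF True] by simp
  next
    case False
    then have z: "\<omega> < Re z" using that by simp
    obtain S where "inverts z S" using right_half_plane_inverts[OF z] by blast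
    then show ?thesis
      using limsup_norm_inverse_le[OF _ z] tail_size_parametrix[OF inverts_parametrix] z by auto
  qed
  define z where "z = complex_of_real (\<omega> + 1)"
  obtain S where S: "inverts z S" using right_half_plane_inverts[of z] by (auto simp: z_def)
  have "limsup_norm (\<lambda>t. (T t o\<^sub>L S) /\<^sub>R f t) = 0"
    using log_subharmonic_eq_0[OF log_subharmonic_tail_size[OF loc'] nonneg bnd] tail_size_parametrix[OF inverts_parametrix[OF S]]
    by (metis zero_le_one)
  then have lim: "((\<lambda>t. norm (T t o\<^sub>L S) / f t) \<longlongrightarrow> 0) at_top"
  proof -
    assume l0: "limsup_norm (\<lambda>t. (T t o\<^sub>L S) /\<^sub>R f t) = 0"
    show ?thesis
    proof (rule tendstoI)
      fix e :: real assume e: "0 < e"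
      show "\<forall>\<^sub>F t in at_top. dist (norm (T t o\<^sub>L S) / f t) 0 < e"
        using eventually_limsup_norm[OF eventually_T_compose_le[of S] half_gt_zero[OF e]] eventually_f_pos
      proof eventually_elim
        case (elim t)
        then have "norm (T t o\<^sub>L S) / f t \<le> e / 2"
          unfolding l0 by (simp add: inverse_eq_divide)
        then have "norm (T t o\<^sub>L S) / f t < e"
          using e by linarith
        then show ?case using elim(2) by simp
      qed
    qed
  qed
  \<comment> \<open>The resolvent identity in the form R = S (I + (\<mu> - z) R): a fixed bounded
    factor on the right carries the decay from z = \<omega> + 1 to \<mu>.\<close>
  define Q where "Q = id_blinfun + (\<mu> - z) *\<^sub>C R"
  have RS: "R = S o\<^sub>L Q"
  proof (rule blinfun_eqI)
    fix x
    have Rx: "R x \<in> D" "A (R x) - \<mu> *\<^sub>C R x = x"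
      using R by (auto simp: inverts_def)
    have "A (R x) - z *\<^sub>C R x = x + (\<mu> - z) *\<^sub>C R x"
      using Rx(2) by (simp add: scaleC.diff_left algebra_simps)
    then show "R x = (S o\<^sub>L Q) x"
      using S Rx(1) by (simp add: Q_def blinfun.add_left inverts_def) metis
  qed
  show ?thesis
    unfolding negligible_op_def
  proof (rule tendsto_0_le[OF lim, of _ "norm Q"])
    show "\<forall>\<^sub>F t in at_top. norm (norm (T t o\<^sub>L R) / f t) \<le> norm (norm (T t o\<^sub>L S) / f t) * norm Q"
      using eventually_f_pos
    proof eventually_elim
      case (elim t)
      have "T t o\<^sub>L R = (T t o\<^sub>L S) o\<^sub>L Q"
        unfolding RS by (rule blinfun_eqI) simp
      then show ?case
        using norm_blinfun_compose[of "T t o\<^sub>L S" Q] elim by (simp add: divide_right_mono)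
    qed
  qed
qed

end

section \<open>Log-concave majorants and the growth bound\<close>

lemma concave_slopes:
  fixes g :: "real \<Rightarrow> real"
  assumes g: "concave_on {0..} g" and "0 \<le> x" "x < y" "y < z"
  shows "(g z - g x) / (z - x) \<le> (g y - g x) / (y - x)"
    and "(g z - g y) / (z - y) \<le> (g z - g x) / (z - x)"
proof -
  have c: "convex_on {0..} (\<lambda>t. - g t)" using g by (simp add: concave_on_def)
  have s: "x \<in> {0..}" "z \<in> {0..}" using assms by auto
  have flip: "(- g a - - g b) / (a - b) = - ((g b - g a) / (b - a))" for a b
    by (metis (no_types, opaque_lifting) minus_diff_eq minus_divide_left minus_divide_divide minus_minus diff_minus_eq_add uminus_add_conv_diff)
  show "(g z - g x) / (z - x) \<le> (g y - g x) / (y - x)"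
    using convex_on_slope_le(1)[OF c s assms(3,4)] unfolding flip by simp
  show "(g z - g y) / (z - y) \<le> (g z - g x) / (z - x)"
    using convex_on_slope_le(2)[OF c s assms(3,4)] unfolding flip by simp
qed

lemma slope_from_0_antimono:
  fixes g :: "real \<Rightarrow> real"
  assumes "concave_on {0..} g" "0 < s" "s \<le> t"
  shows "(g t - g 0) / t \<le> (g s - g 0) / s"
  using concave_slopes(1)[OF assms(1), of 0 s t] assms by (cases "s = t") auto

text \<open>Here w is the infimum of the chord slopes from 0. The slope over [s, t] is at least the
  one over [s, u] for u > t, and g(u) \<ge> g(0) + w u makes the limit inferior of the latter at
  least w. From above, the slope over [s, t] is at most the slope from 0 to t, hence at most that
  from 0 to s, which is below w + e for late s.\<close>

lemma concave_slope_limit: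
  fixes g :: "real \<Rightarrow> real"
  assumes g: "concave_on {0..} g" and w: "\<And>t. 0 < t \<Longrightarrow> w \<le> (g t - g 0) / t"
    and inf: "\<And>e. 0 < e \<Longrightarrow> \<exists>t>0. (g t - g 0) / t < w + e"
  shows "0 \<le> s \<Longrightarrow> s \<le> t \<Longrightarrow> g s + w * (t - s) \<le> g t"
    and "0 < e \<Longrightarrow> \<exists>s\<^sub>0>0. \<forall>s\<ge>s\<^sub>0. \<forall>t\<ge>s. g t \<le> g s + (w + e) * (t - s)"
    and "((\<lambda>t. g t / t) \<longlongrightarrow> w) at_top"
proof -
  show "g s + w * (t - s) \<le> g t" if st: "0 \<le> s" "s \<le> t" for s t
  proof (cases "s = t")
    case False
    have "filterlim (\<lambda>u. u - s) at_infinity at_top"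
      using filterlim_tendsto_add_at_top[OF tendsto_const[of "-s"] filterlim_ident]
      by (intro filterlim_at_top_imp_at_infinity) simp
    then have "((\<lambda>u. w + (w * s + g 0 - g s) / (u - s)) \<longlongrightarrow> w + 0) at_top"
      by (intro tendsto_intros tendsto_divide_0[OF tendsto_const])
    moreover have "\<forall>\<^sub>F u in at_top. w + (w * s + g 0 - g s) / (u - s) = (w * u + g 0 - g s) / (u - s)"
      using eventually_gt_at_top[of s] by eventually_elim (simp add: field_simps)
    ultimately have "((\<lambda>u. (w * u + g 0 - g s) / (u - s)) \<longlongrightarrow> w + 0) at_top"
      by (rule Lim_transform_eventually)
    then have "((\<lambda>u. (w * u + g 0 - g s) / (u - s)) \<longlongrightarrow> w) at_top" by simp
    moreover have "\<forall>\<^sub>F u in at_top. (w * u + g 0 - g s) / (u - s) \<le> (g t - g s) / (t - s)"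
      using eventually_gt_at_top[of t]
    proof eventually_elim
      case (elim u)
      have "w * u + g 0 \<le> g u" using w[of u] elim st by (simp add: field_simps)
      then have "(w * u + g 0 - g s) / (u - s) \<le> (g u - g s) / (u - s)"
        using elim st by (intro divide_right_mono) auto
      also have "\<dots> \<le> (g t - g s) / (t - s)"
        by (rule concave_slopes(1)[OF g]) (use elim st False in auto)
      finally show ?case .
    qed
    ultimately have "w \<le> (g t - g s) / (t - s)"
      by (intro tendsto_upperbound) auto
    then show ?thesis using st False by (simp add: field_simps)
  qed simp
  have ev: "\<exists>s\<^sub>0>0. \<forall>s\<ge>s\<^sub>0. (g s - g 0) / s < w + e" if e: "0 < e" for e
  proof -
    obtain s\<^sub>0 where s\<^sub>0: "0 < s\<^sub>0" "(g s\<^sub>0 - g 0) / s\<^sub>0 < w + e" using inf[OF e] by blast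
    then show ?thesis
      using slope_from_0_antimono[OF g s\<^sub>0(1)] by (meson le_less_trans)
  qed
  show "\<exists>s\<^sub>0>0. \<forall>s\<ge>s\<^sub>0. \<forall>t\<ge>s. g t \<le> g s + (w + e) * (t - s)" if e: "0 < e" for e
  proof -
    obtain s\<^sub>0 where s\<^sub>0: "0 < s\<^sub>0" "\<And>s. s\<^sub>0 \<le> s \<Longrightarrow> (g s - g 0) / s < w + e" using ev[OF e] by blast
    have "g t \<le> g s + (w + e) * (t - s)" if st: "s\<^sub>0 \<le> s" "s \<le> t" for s t
    proof (cases "s = t")
      case False
      have "(g t - g s) / (t - s) \<le> (g t - g 0) / (t - 0)"
        by (rule concave_slopes(2)[OF g]) (use st s\<^sub>0 False in auto)
      also have "\<dots> \<le> (g s - g 0) / s"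
        using slope_from_0_antimono[OF g, of s t] st s\<^sub>0 by simp
      also have "\<dots> \<le> w + e" using s\<^sub>0(2)[OF st(1)] by simp
      finally show ?thesis using st False by (simp add: pos_divide_le_eq algebra_simps)
    qed simp
    then show ?thesis using s\<^sub>0(1) by blast
  qed
  have m: "((\<lambda>t. (g t - g 0) / t) \<longlongrightarrow> w) at_top"
  proof (rule tendstoI)
    fix e :: real assume e: "0 < e"
    then obtain s\<^sub>0 where s\<^sub>0: "0 < s\<^sub>0" "\<And>s. s\<^sub>0 \<le> s \<Longrightarrow> (g s - g 0) / s < w + e" using ev by blast
    show "\<forall>\<^sub>F t in at_top. dist ((g t - g 0) / t) w < e"
      using eventually_ge_at_top[of s\<^sub>0]
    proof eventually_elim
      case (elim t)
      have "w \<le> (g t - g 0) / t" "(g t - g 0) / t < w + e"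
        using w[of t] s\<^sub>0(1) s\<^sub>0(2)[OF elim] elim by auto
      then show ?case unfolding dist_real_def by linarith
    qed
  qed
  have "((\<lambda>t. g 0 / t) \<longlongrightarrow> 0) at_top"
    by (intro tendsto_divide_0[OF tendsto_const] filterlim_at_top_imp_at_infinity filterlim_ident)
  from tendsto_add[OF m this] show "((\<lambda>t. g t / t) \<longlongrightarrow> w) at_top"
    by (simp add: add_divide_distrib[symmetric])
qed

lemma growth_bound_MInfty:
  assumes T_le: "\<And>t. 0 \<le> t \<Longrightarrow> norm (T t) \<le> f t"
    and f: "((\<lambda>t. ereal (ln (f t) / t)) \<longlongrightarrow> -\<infinity>) at_top"
  shows "growth_bound T = -\<infinity>"
  unfolding growth_bound_def
proof (rule tendsto_Lim)
  show "((\<lambda>t. if T t = 0 then - \<infinity> else ereal (ln (norm (T t)) / t)) \<longlongrightarrow> -\<infinity>) at_top"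
    unfolding tendsto_MInfty
  proof
    fix r :: real
    have "\<forall>\<^sub>F t in at_top. ereal (ln (f t) / t) < ereal r" using f unfolding tendsto_MInfty by blast
    then show "\<forall>\<^sub>F t in at_top. (if T t = 0 then - \<infinity> else ereal (ln (norm (T t)) / t)) < ereal r"
      using eventually_gt_at_top[of 0]
    proof eventually_elim
      case (elim t)
      have "ln (norm (T t)) / t \<le> ln (f t) / t" if "T t \<noteq> 0"
        using T_le[of t] elim that by (intro divide_right_mono ln_mono) auto
      then show ?case using elim by force
    qed
  qed
qed simp

text \<open>Were ||T(\<tau>)|| smaller than exp(\<omega> \<tau>), each shift by \<tau> would
  multiply the ratio ||T|| / f by at most some \<kappa> < 1, and its limit superior a > 0 would
  satisfy a \<le> \<kappa> a.\<close>

lemma dominated_norm_ge_exp: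
  fixes T :: "real \<Rightarrow> 'a :: complex_banach \<Rightarrow>\<^sub>L 'a"
  assumes T_add: "\<And>s t. 0 \<le> s \<Longrightarrow> 0 \<le> t \<Longrightarrow> T (s + t) = T s o\<^sub>L T t"
    and f_pos: "\<And>t. 0 \<le> t \<Longrightarrow> 0 < f t"
    and f_lower: "\<And>s t. 0 \<le> s \<Longrightarrow> s \<le> t \<Longrightarrow> f s * exp (\<omega> * (t - s)) \<le> f t"
    and limsup: "Limsup at_top (\<lambda>t. ereal (norm (T t) / f t)) = ereal a" and a: "0 < a" and \<tau>: "0 \<le> \<tau>"
  shows "exp (\<omega> * \<tau>) \<le> norm (T \<tau>)"
proof (rule ccontr)
  define \<kappa> where "\<kappa> = norm (T \<tau>) * exp (- \<omega> * \<tau>)"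
  assume "\<not> exp (\<omega> * \<tau>) \<le> norm (T \<tau>)"
  then have "norm (T \<tau>) * exp (- \<omega> * \<tau>) < exp (\<omega> * \<tau>) * exp (- \<omega> * \<tau>)"
    by (intro mult_strict_right_mono) auto
  then have \<kappa>: "0 \<le> \<kappa>" "\<kappa> < 1" by (auto simp: \<kappa>_def exp_add[symmetric])
  \<comment> \<open>Half the gap between a and \<kappa> a, so that \<kappa> (a + \<eta>) is still
    below a.\<close>
  define \<eta> where "\<eta> = a * (1 - \<kappa>) / 2"
  have \<eta>: "0 < \<eta>" using a \<kappa> by (simp add: \<eta>_def)
  have "\<kappa> * \<eta> \<le> \<eta>" using \<kappa> \<eta> by (simp add: mult_left_le_one_le)
  moreover have "2 * \<eta> = a - \<kappa> * a" by (simp add: \<eta>_def right_diff_distrib mult.commute)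
  ultimately have lt: "\<kappa> * (a + \<eta>) < a"
    using \<eta> unfolding distrib_left by linarith
  have "\<forall>\<^sub>F t in at_top. ereal (norm (T t) / f t) < ereal (a + \<eta>)"
    by (rule Limsup_lessD) (simp add: limsup \<eta>)
  then obtain b where b: "\<And>t. b \<le> t \<Longrightarrow> norm (T t) / f t < a + \<eta>"
    by (auto simp: eventually_at_top_linorder)
  have "\<forall>\<^sub>F t in at_top. ereal (norm (T t) / f t) \<le> ereal (\<kappa> * (a + \<eta>))"
    using eventually_ge_at_top[of "max 0 b + \<tau>"]
  proof eventually_elim
    case (elim t)
    define s where "s = t - \<tau>"
    have s: "0 \<le> s" "b \<le> s" "t = \<tau> + s" using elim by (auto simp: s_def)
    have "f s * exp (\<omega> * \<tau>) \<le> f t" using f_lower[of s t] s \<tau> by simp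
    have "norm (T t) \<le> norm (T \<tau>) * norm (T s)"
      unfolding s(3) T_add[OF \<tau> s(1)] by (rule norm_blinfun_compose)
    then have "norm (T t) / f t \<le> norm (T \<tau>) * norm (T s) / f t"
      using f_pos[of t] s \<tau> by (intro divide_right_mono) auto
    also have "\<dots> \<le> norm (T \<tau>) * norm (T s) / (f s * exp (\<omega> * \<tau>))"
      using f_pos[of s] f_pos[of t] s \<tau> \<open>f s * exp (\<omega> * \<tau>) \<le> f t\<close> by (intro divide_left_mono) auto
    also have "\<dots> = \<kappa> * (norm (T s) / f s)"
      by (simp add: \<kappa>_def exp_minus field_simps)
    also have "\<dots> \<le> \<kappa> * (a + \<eta>)"
      using b[OF s(2)] \<kappa> by (intro mult_left_mono) auto
    finally show ?case by simp
  qed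
  then have "ereal a \<le> ereal (\<kappa> * (a + \<eta>))"
    unfolding limsup[symmetric] by (rule Limsup_bounded)
  then show False using lt by simp
qed

text \<open>If the chord slopes of log f were unbounded below, f itself would force the growth bound
  to be -\<infinity>. Otherwise their infimum w is finite, and ||T(t)|| lies between exp(w t) and
  f(t), both of exponential rate w.\<close>

lemma growth_bound_log_concave:
  fixes T :: "real \<Rightarrow> 'a :: complex_banach \<Rightarrow>\<^sub>L 'a"
  assumes semigroup: "C0_semigroup T"
    and growth: "growth_bound T > -\<infinity>"
    and f_pos: "\<And>t. t \<ge> 0 \<Longrightarrow> f t > 0"
    and f_log_concave: "concave_on {0..} (\<lambda>t. ln (f t))"
    and bound: "\<And>t. t \<ge> 0 \<Longrightarrow> norm (T t) \<le> f t"
    and limsup: "Limsup at_top (\<lambda>t. ereal (norm (T t) / f t)) = ereal a"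
    and a_pos: "a > 0"
  obtains \<omega> where "growth_bound T = ereal \<omega>" "dominated_semigroup T f \<omega>"
proof -
  define g where "g t = ln (f t)" for t
  have g: "concave_on {0..} g" using f_log_concave by (simp add: g_def[abs_def])
  define W where "W = (\<lambda>t. (g t - g 0) / t) ` {0<..}"
  have bdd: "bdd_below W"
  proof (rule ccontr)
    assume nb: "\<not> bdd_below W"
    have "((\<lambda>t. ereal (ln (f t) / t)) \<longlongrightarrow> -\<infinity>) at_top"
      unfolding tendsto_MInfty
    proof
      fix r
      obtain s where s: "0 < s" "(g s - g 0) / s < r - 1"
      proof -
        have "\<not> (\<forall>x\<in>W. r - 1 \<le> x)" using nb unfolding bdd_below_def by blast
        then obtain x where "x \<in> W" "x < r - 1" by (auto simp: not_le)
        then show ?thesis using that by (auto simp: W_def)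
      qed
      have "((\<lambda>t. g 0 / t) \<longlongrightarrow> 0) at_top"
    by (intro tendsto_divide_0[OF tendsto_const] filterlim_at_top_imp_at_infinity filterlim_ident)
      then have "\<forall>\<^sub>F t in at_top. g 0 / t < 1" by (rule order_tendstoD(2)) simp
      then show "\<forall>\<^sub>F t in at_top. ereal (ln (f t) / t) < ereal r"
        using eventually_ge_at_top[of s]
      proof eventually_elim
        case (elim t)
        have "(g t - g 0) / t < r - 1"
          using slope_from_0_antimono[OF g s(1) elim(2)] s(2) by linarith
        then have "g t / t < r" using elim(1) by (simp add: diff_divide_distrib)
        then show ?case by (simp add: g_def)
      qed
    qed
    then have "growth_bound T = -\<infinity>"
      by (rule growth_bound_MInfty[rotated]) (rule bound)
    then show False using growth by simp
  qed
  define w where "w = Inf W"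
  have w1: "w \<le> (g t - g 0) / t" if "0 < t" for t
    unfolding w_def by (rule cInf_lower) (use that bdd in \<open>auto simp: W_def\<close>)
  have w2: "\<exists>t>0. (g t - g 0) / t < w + e" if "0 < e" for e
  proof -
    have "W \<noteq> {}" by (auto simp: W_def)
    moreover have "Inf W < w + e" using that by (simp add: w_def)
    ultimately obtain x where "x \<in> W" "x < w + e" using cInf_lessD by blast
    then show ?thesis by (auto simp: W_def)
  qed
  note slopes = concave_slope_limit[OF g w1 w2]
  have f_exp: "f t = exp (g t)" if "0 \<le> t" for t
    using f_pos[OF that] by (simp add: g_def)
  have lower: "f s * exp (w * (t - s)) \<le> f t" if "0 \<le> s" "s \<le> t" for s t
    using slopes(1)[OF _ _ that] that by (simp add: f_exp exp_add[symmetric])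
  have upper: "\<exists>s\<^sub>0\<ge>0. \<forall>s\<ge>s\<^sub>0. \<forall>t\<ge>s. f t \<le> f s * exp ((w + e) * (t - s))" if e: "0 < e" for e
  proof -
    obtain s\<^sub>0 where s\<^sub>0: "s\<^sub>0 > 0" "\<And>s t. s\<^sub>0 \<le> s \<Longrightarrow> s \<le> t \<Longrightarrow> g t \<le> g s + (w + e) * (t - s)"
      using slopes(2)[OF _ _ e] by blast
    have "f t \<le> f s * exp ((w + e) * (t - s))" if "s\<^sub>0 \<le> s" "s \<le> t" for s t
      using s\<^sub>0(2)[OF that] s\<^sub>0(1) that by (simp add: f_exp exp_add[symmetric])
    then show ?thesis using s\<^sub>0(1) by (meson less_imp_le)
  qed
  have ge: "exp (w * t) \<le> norm (T t)" if "0 \<le> t" for t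
    by (rule dominated_norm_ge_exp[OF _ f_pos lower limsup a_pos that])
      (use semigroup in \<open>auto simp: C0_semigroup_def\<close>)
  have "((\<lambda>t. ln (norm (T t)) / t) \<longlongrightarrow> w) at_top"
  proof (rule tendsto_sandwich)
    show "\<forall>\<^sub>F t in at_top. w \<le> ln (norm (T t)) / t"
      using eventually_gt_at_top[of 0]
    proof eventually_elim
      case (elim t)
      have "ln (exp (w * t)) \<le> ln (norm (T t))"
        using ge[of t] elim by (intro ln_mono) (auto intro: less_le_trans[OF exp_gt_zero])
      then show ?case using elim by (simp add: pos_le_divide_eq)
    qed
    show "\<forall>\<^sub>F t in at_top. ln (norm (T t)) / t \<le> g t / t"
      using eventually_gt_at_top[of 0]
    proof eventually_elim
      case (elim t)
      then show ?case
        unfolding g_def using bound[of t] ge[of t]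
        by (intro divide_right_mono ln_mono) (auto intro: less_le_trans[OF exp_gt_zero])
    qed
    show "((\<lambda>t. g t / t) \<longlongrightarrow> w) at_top" by (rule slopes(3))
  qed simp
  then have "((\<lambda>t. ereal (ln (norm (T t)) / t)) \<longlongrightarrow> ereal w) at_top"
    by (simp add: tendsto_ereal)
  then have "((\<lambda>t. if T t = 0 then -\<infinity> else ereal (ln (norm (T t)) / t)) \<longlongrightarrow> ereal w) at_top"
  proof (rule Lim_transform_eventually)
    show "\<forall>\<^sub>F t in at_top. ereal (ln (norm (T t)) / t) = (if T t = 0 then -\<infinity> else ereal (ln (norm (T t)) / t))"
      using eventually_ge_at_top[of 0]
    proof eventually_elim
      case (elim t)
      have "T t \<noteq> 0" using ge[OF elim] less_le_trans[OF exp_gt_zero] by fastforce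
      then show ?case by simp
    qed
  qed
  then have "growth_bound T = ereal w"
    unfolding growth_bound_def by (intro tendsto_Lim) auto
  moreover have "dominated_semigroup T f w"
    by unfold_locales (use semigroup f_pos bound lower upper in auto)
  ultimately show thesis by (rule that)
qed

section \<open>Operator-valued integrals along curves\<close>

text \<open>The operator norm topology is in general not second countable, so the Bochner integral is not
  available; moreover the derivative of the curve may be unbounded, so the integrand need not be
  a uniform limit of step functions.\<close>

lemma integrable_weighted_uniform_limit:
  fixes h :: "'n :: euclidean_space \<Rightarrow> 'b :: banach" and \<phi> :: "'n \<Rightarrow> real"
  assumes \<phi>: "\<phi> integrable_on cbox a b"
    and approx: "\<And>e. 0 < e \<Longrightarrow> \<exists>g. g integrable_on cbox a b \<and> (\<forall>x\<in>cbox a b. norm (h x - g x) \<le> e * \<phi> x)"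
  shows "h integrable_on cbox a b"
  unfolding integrable_Cauchy
proof (intro allI impI)
  fix e :: real assume e: "0 < e"
  define I where "I = integral (cbox a b) \<phi>"
  \<comment> \<open>On fine partitions the Riemann sums of \<phi> differ from I by less than 1, so
    replacing g by h changes a Riemann sum by at most d (|I| + 1) = e/4.\<close>
  define d where "d = e / (4 * (\<bar>I\<bar> + 1))"
  have d: "0 < d" using e by (simp add: d_def)
  obtain g where g: "g integrable_on cbox a b" and hg: "\<And>x. x \<in> cbox a b \<Longrightarrow> norm (h x - g x) \<le> d * \<phi> x"
    using approx[OF d] by blast
  obtain \<gamma>1 where \<gamma>1: "gauge \<gamma>1" "\<And>\<D>. \<D> tagged_division_of cbox a b \<Longrightarrow> \<gamma>1 fine \<D> \<Longrightarrow>
      norm ((\<Sum>(x,K)\<in>\<D>. measure lborel K *\<^sub>R g x) - integral (cbox a b) g) < e / 4"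
    using has_integral[THEN iffD1, OF integrable_integral[OF g], rule_format, of "e/4"] e by auto
  obtain \<gamma>2 where \<gamma>2: "gauge \<gamma>2" "\<And>\<D>. \<D> tagged_division_of cbox a b \<Longrightarrow> \<gamma>2 fine \<D> \<Longrightarrow>
      norm ((\<Sum>(x,K)\<in>\<D>. measure lborel K *\<^sub>R \<phi> x) - I) < 1"
    unfolding I_def
    using has_integral[THEN iffD1, OF integrable_integral[OF \<phi>], rule_format, of 1] by auto
  have close: "norm ((\<Sum>(x,K)\<in>\<D>. measure lborel K *\<^sub>R h x) - integral (cbox a b) g) < e / 2"
    if \<D>: "\<D> tagged_division_of cbox a b" "(\<lambda>x. \<gamma>1 x \<inter> \<gamma>2 x) fine \<D>" for \<D>
  proof -
    have f1: "\<gamma>1 fine \<D>" and f2: "\<gamma>2 fine \<D>" using \<D>(2) by (auto simp: fine_Int)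
    have "norm ((\<Sum>(x,K)\<in>\<D>. measure lborel K *\<^sub>R h x) - (\<Sum>(x,K)\<in>\<D>. measure lborel K *\<^sub>R g x)) =
        norm (\<Sum>(x,K)\<in>\<D>. measure lborel K *\<^sub>R (h x - g x))"
      by (simp add: sum_subtractf[symmetric] case_prod_unfold scaleR_diff_right)
    also have "\<dots> \<le> (\<Sum>(x,K)\<in>\<D>. d * (measure lborel K *\<^sub>R \<phi> x))"
    proof (rule sum_norm_le)
      fix p assume p: "p \<in> \<D>"
      obtain x K where xK: "p = (x, K)" by (cases p)
      have "x \<in> cbox a b" using tag_in_interval[OF \<D>(1)] p xK by blast
      then have "measure lborel K * norm (h x - g x) \<le> measure lborel K * (d * \<phi> x)"
        by (intro mult_left_mono hg) auto
      then show "norm (case p of (x, K) \<Rightarrow> measure lborel K *\<^sub>R (h x - g x)) \<le> (case p of (x, K) \<Rightarrow> d * (measure lborel K *\<^sub>R \<phi> x))"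
        by (simp add: xK mult_ac)
    qed
    also have "\<dots> = d * (\<Sum>(x,K)\<in>\<D>. measure lborel K *\<^sub>R \<phi> x)"
      by (simp add: sum_distrib_left case_prod_unfold)
    also have "\<dots> \<le> d * (\<bar>I\<bar> + 1)"
      using \<gamma>2(2)[OF \<D>(1) f2] d by (intro mult_left_mono) (auto simp: abs_less_iff)
    also have "\<dots> = e / 4" by (simp add: d_def field_simps) 
    finally have "norm ((\<Sum>(x,K)\<in>\<D>. measure lborel K *\<^sub>R h x) - (\<Sum>(x,K)\<in>\<D>. measure lborel K *\<^sub>R g x)) \<le> e / 4" .
    moreover have "norm ((\<Sum>(x,K)\<in>\<D>. measure lborel K *\<^sub>R g x) - integral (cbox a b) g) < e / 4"
      using \<gamma>1(2)[OF \<D>(1) f1] .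
    ultimately show ?thesis
      using norm_triangle_ineq[of "(\<Sum>(x,K)\<in>\<D>. measure lborel K *\<^sub>R h x) - (\<Sum>(x,K)\<in>\<D>. measure lborel K *\<^sub>R g x)"
        "(\<Sum>(x,K)\<in>\<D>. measure lborel K *\<^sub>R g x) - integral (cbox a b) g"] by simp
  qed
  show "\<exists>\<gamma>. gauge \<gamma> \<and> (\<forall>\<D>1 \<D>2. \<D>1 tagged_division_of cbox a b \<and> \<gamma> fine \<D>1 \<and>
      \<D>2 tagged_division_of cbox a b \<and> \<gamma> fine \<D>2 \<longrightarrow>
      norm ((\<Sum>(x,K)\<in>\<D>1. measure lborel K *\<^sub>R h x) - (\<Sum>(x,K)\<in>\<D>2. measure lborel K *\<^sub>R h x)) < e)"
  proof (intro exI[of _ "\<lambda>x. \<gamma>1 x \<inter> \<gamma>2 x"] conjI allI impI gauge_Int \<gamma>1(1) \<gamma>2(1))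
    fix \<D>1 \<D>2
    assume "\<D>1 tagged_division_of cbox a b \<and> (\<lambda>x. \<gamma>1 x \<inter> \<gamma>2 x) fine \<D>1 \<and>
      \<D>2 tagged_division_of cbox a b \<and> (\<lambda>x. \<gamma>1 x \<inter> \<gamma>2 x) fine \<D>2"
    then show "norm ((\<Sum>(x,K)\<in>\<D>1. measure lborel K *\<^sub>R h x) - (\<Sum>(x,K)\<in>\<D>2. measure lborel K *\<^sub>R h x)) < e"
      using close norm_triangle_half_l[of _ "integral (cbox a b) g" e] by (simp add: norm_minus_commute)
  qed
qed

text \<open>Freeze F at the left endpoints of a partition into n equal pieces. The result is a
  finite sum of scalar integrable functions times fixed vectors, and uniform continuity bounds the
  error by e |\<phi>|, the weighted form of approximation that the preceding criterion
  accepts.\<close>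

lemma integrable_scaleC_continuous:
  fixes \<phi> :: "real \<Rightarrow> complex" and F :: "real \<Rightarrow> 'b :: {complex_normed_vector, banach}"
  assumes \<phi>: "\<phi> absolutely_integrable_on {0..1}" and F: "continuous_on {0..1} F"
  shows "(\<lambda>s. \<phi> s *\<^sub>C F s) integrable_on {0..1}"
proof -
  have n\<phi>: "(\<lambda>s. norm (\<phi> s)) integrable_on cbox 0 1"
    using \<phi> by (simp add: absolutely_integrable_on_def)
  have "(\<lambda>s. \<phi> s *\<^sub>C F s) integrable_on cbox 0 1"
  proof (rule integrable_weighted_uniform_limit[OF n\<phi>])
    fix e :: real assume e: "0 < e"
    have "uniformly_continuous_on {0..1} F"
      by (rule compact_uniformly_continuous[OF F]) simp
    then obtain d where d: "0 < d" "\<And>s t. s \<in> {0..1} \<Longrightarrow> t \<in> {0..1} \<Longrightarrow> dist s t < d \<Longrightarrow> dist (F s) (F t) < e"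
      unfolding uniformly_continuous_on_def using e by (metis dist_commute)
    obtain n :: nat where n: "0 < n" "1 / real n < d"
      using d(1) by (metis nat_approx_posE zero_less_Suc)
    define idx where "idx s = nat \<lfloor>real n * s\<rfloor>" for s
    \<comment> \<open>The index n belongs to the sum because the endpoint s = 1 has index n.\<close>
    define g where "g s = (\<Sum>i\<le>n. (if idx s = i then \<phi> s else 0) *\<^sub>C F (real i / real n))" for s
    have part: "(\<lambda>s. if idx s = i then \<phi> s else 0) integrable_on {0..1}" for i
    proof -
      let ?J = "{s. idx s = i}"
      have "?J \<in> sets borel"
        unfolding idx_def by measurable
      then have "?J \<inter> {0..1} \<in> sets lebesgue" by auto
      then have "\<phi> absolutely_integrable_on (?J \<inter> {0..1})"
        by (rule set_integrable_subset[OF \<phi>]) auto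
      then have "\<phi> integrable_on (?J \<inter> {0..1})"
        by (rule set_lebesgue_integral_eq_integral(1))
      then show ?thesis
        using integrable_restrict_Int[of ?J \<phi> "{0..1}"] by simp
    qed
    have gint: "g integrable_on cbox 0 1"
      unfolding g_def
    proof (intro integrable_sum)
      fix i
      show "(\<lambda>s. (if idx s = i then \<phi> s else 0) *\<^sub>C F (real i / real n)) integrable_on cbox 0 1"
        using integrable_linear[OF part scaleC.bounded_linear_left[of "F (real i / real n)"], of i]
        by (simp add: o_def)
    qed simp
    moreover have "norm (\<phi> s *\<^sub>C F s - g s) \<le> e * norm (\<phi> s)" if s: "s \<in> cbox 0 1" for s
    proof -
      have s01: "0 \<le> s" "s \<le> 1" using s by auto
      have fl: "real (idx s) = of_int \<lfloor>real n * s\<rfloor>" using s01 by (simp add: idx_def)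
      have le: "real (idx s) \<le> real n * s" "real n * s < real (idx s) + 1"
        unfolding fl by linarith+
      have "real n * s \<le> real n" using s01 by (simp add: mult_left_le)
      then have "idx s \<le> n" using le by linarith
      then have gs: "g s = \<phi> s *\<^sub>C F (real (idx s) / real n)"
        unfolding g_def by (subst sum.remove[of _ "idx s"]) (auto simp: scaleC.zero_left intro!: sum.neutral)
      have dd: "dist s (real (idx s) / real n) < d"
      proof -
        have "\<bar>s - real (idx s) / real n\<bar> \<le> 1 / real n"
        proof -
          have "s - real (idx s) / real n = (real n * s - real (idx s)) / real n"
            using n(1) by (simp add: field_simps)
          then show ?thesis using le n(1) by (simp add: abs_divide divide_right_mono)
        qed
        then show ?thesis using n(2) by (simp add: dist_real_def)
      qed
      have "real (idx s) / real n \<in> {0..1}"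
        using \<open>idx s \<le> n\<close> n(1) by simp
      then have "dist (F s) (F (real (idx s) / real n)) < e"
        using d(2)[OF _ _ dd] s01 by simp
      then show ?thesis
        unfolding gs scaleC.diff_right[symmetric] norm_scaleC
        using mult_left_mono[of "norm (F s - F (real (idx s) / real n))" e "norm (\<phi> s)"]
        by (simp add: dist_norm mult.commute)
    qed
    ultimately show "\<exists>g. g integrable_on cbox 0 1 \<and> (\<forall>x\<in>cbox 0 1. norm (\<phi> x *\<^sub>C F x - g x) \<le> e * norm (\<phi> x))"
      by blast
  qed
  then show ?thesis by simp
qed

text \<open>Integrability comes from the fundamental theorem with finitely many exceptional points.
  It also makes the integrals over subintervals equal to increments of the curve, so rectifiability
  is bounded variation of the indefinite integral, which is absolute integrability.\<close>

lemma regular_curve_derivative: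
  assumes v: "valid_path \<gamma>" and r: "rectifiable \<gamma>"
  shows "(\<lambda>s. vector_derivative \<gamma> (at s within {0..1})) absolutely_integrable_on {0..1}"
proof -
  let ?\<gamma>' = "\<lambda>s. vector_derivative \<gamma> (at s within {0..1})"
  obtain S where S: "finite S" "\<gamma> C1_differentiable_on {0..1} - S" and cont: "continuous_on {0..1} \<gamma>"
    using v unfolding valid_path_def piecewise_C1_differentiable_on_def by blast
  have der: "(\<gamma> has_vector_derivative ?\<gamma>' s) (at s)" if "s \<in> {0<..<1} - S" for s
  proof -
    have "s \<in> {0..1} - S" using that by auto
    then obtain D where D: "(\<gamma> has_vector_derivative D) (at s)"
      using S(2) unfolding C1_differentiable_on_def by blast
    moreover have "?\<gamma>' s = D"
      by (rule vector_derivative_at_within_ivl[OF D]) (use that in auto)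
    ultimately show ?thesis by simp
  qed
  have hi: "(?\<gamma>' has_integral (\<gamma> v - \<gamma> u)) {u..v}" if "0 \<le> u" "u \<le> v" "v \<le> 1" for u v
    by (rule fundamental_theorem_of_calculus_interior_strong[OF S(1)])
      (use that der in \<open>auto intro: continuous_on_subset[OF cont]\<close>)
  obtain B where B: "\<And>d. d division_of {0..1} \<Longrightarrow> (\<Sum>K\<in>d. norm (\<gamma> (Sup K) - \<gamma> (Inf K))) \<le> B"
    using r unfolding rectifiable_def by blast
  have "?\<gamma>' absolutely_integrable_on cbox 0 1"
  proof (rule bounded_variation_absolutely_integrable_interval)
    show "?\<gamma>' integrable_on cbox 0 1" using hi[of 0 1] by (auto simp: integrable_on_def)
    fix d :: "real set set" assume d: "d division_of cbox 0 1"
    have "norm (integral K ?\<gamma>') = norm (\<gamma> (Sup K) - \<gamma> (Inf K))" if K: "K \<in> d" for K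
    proof -
      obtain u v where uv: "K = {u..v}" using division_ofD(4)[OF d K] by auto
      have "K \<noteq> {}" "K \<subseteq> {0..1}" using division_ofD(2,3)[OF d K] by auto
      then have "0 \<le> u" "u \<le> v" "v \<le> 1" unfolding uv by auto
      then show ?thesis using integral_unique[OF hi] by (simp add: uv)
    qed
    then have "(\<Sum>K\<in>d. norm (integral K ?\<gamma>')) = (\<Sum>K\<in>d. norm (\<gamma> (Sup K) - \<gamma> (Inf K)))"
      by (rule sum.cong[OF refl])
    also have "\<dots> \<le> B" by (rule B) (use d in simp)
    finally show "(\<Sum>K\<in>d. norm (integral K ?\<gamma>')) \<le> B" .
  qed
  then show ?thesis by simp
qed

section \<open>Normalized curve integrals of vector-valued functions\<close>

definition curve_integral :: "(real \<Rightarrow> complex) \<Rightarrow> (real \<Rightarrow> 'b :: {complex_normed_vector, banach}) \<Rightarrow> 'b" where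
  "curve_integral \<gamma> F = (1 / (2 * complex_of_real pi * \<i>)) *\<^sub>C
     integral {0..1} (\<lambda>s. vector_derivative \<gamma> (at s within {0..1}) *\<^sub>C F s)"

lemma curve_integral_cong:
  assumes "\<And>s. s \<in> {0..1} \<Longrightarrow> F s = G s"
  shows "curve_integral \<gamma> F = curve_integral \<gamma> G"
  unfolding curve_integral_def using assms
  by (intro arg_cong[where f = "\<lambda>x. (1 / (2 * complex_of_real pi * \<i>)) *\<^sub>C x"] integral_cong) simp

context
  fixes \<gamma> :: "real \<Rightarrow> complex"
  assumes v: "valid_path \<gamma>" and rect: "rectifiable \<gamma>"
begin

lemmas integrable_on_curve = integrable_scaleC_continuous[OF regular_curve_derivative[OF v rect]]

lemma curve_integral_add:
  assumes "continuous_on {0..1} F" "continuous_on {0..1} G"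
  shows "curve_integral \<gamma> (\<lambda>s. F s + G s) = curve_integral \<gamma> F + curve_integral \<gamma> G"
  unfolding curve_integral_def
  by (simp add: scaleC_add_right integral_add integrable_on_curve assms)

lemma curve_integral_linear:
  assumes F: "continuous_on {0..1} F" and L: "bounded_linear L" "\<And>c x. L (c *\<^sub>C x) = c *\<^sub>C L x"
  shows "curve_integral \<gamma> (\<lambda>s. L (F s)) = L (curve_integral \<gamma> F)"
proof -
  have "integral {0..1} (L \<circ> (\<lambda>s. vector_derivative \<gamma> (at s within {0..1}) *\<^sub>C F s)) =
      L (integral {0..1} (\<lambda>s. vector_derivative \<gamma> (at s within {0..1}) *\<^sub>C F s))"
    by (intro integral_linear integrable_on_curve F L)
  then show ?thesis
    unfolding curve_integral_def by (simp add: L(2) o_def)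
qed

lemma curve_integral_bound:
  "\<exists>L\<ge>0. \<forall>F B. continuous_on {0..1} F \<longrightarrow> (\<forall>s\<in>{0..1}. norm (F s) \<le> B) \<longrightarrow>
     norm (curve_integral \<gamma> F :: 'b :: {complex_normed_vector, banach}) \<le> L * B"
proof -
  let ?\<gamma>' = "\<lambda>s. vector_derivative \<gamma> (at s within {0..1})"
  have n: "(\<lambda>s. norm (?\<gamma>' s)) integrable_on {0..1}"
    using regular_curve_derivative[OF v rect] by (simp add: absolutely_integrable_on_def)
  \<comment> \<open>The length of the curve divided by 2 pi, the latter coming from the
    normalization.\<close>
  define L where "L = integral {0..1} (\<lambda>s. norm (?\<gamma>' s)) / (2 * pi)"
  have "norm (curve_integral \<gamma> F) \<le> L * B"
    if F: "continuous_on {0..1} F" and B: "\<And>s. s \<in> {0..1} \<Longrightarrow> norm (F s) \<le> B" for F :: "real \<Rightarrow> 'b" and B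
  proof -
    have "norm (integral {0..1} (\<lambda>s. ?\<gamma>' s *\<^sub>C F s)) \<le> integral {0..1} (\<lambda>s. norm (?\<gamma>' s) * B)"
      by (rule integral_norm_bound_integral[OF integrable_on_curve[OF F]])
        (use n B in \<open>auto simp: norm_scaleC intro: integrable_on_mult_left mult_left_mono\<close>)
    also have "\<dots> = integral {0..1} (\<lambda>s. norm (?\<gamma>' s)) * B" by simp
    finally show ?thesis
      unfolding curve_integral_def norm_scaleC L_def
      by (simp add: norm_divide norm_mult divide_right_mono)
  qed
  moreover have "0 \<le> L" unfolding L_def by (intro divide_nonneg_nonneg integral_nonneg n) auto
  ultimately show ?thesis by blast
qed

lemma curve_integral_const:
  assumes h: "continuous_on {0..1} h"
  shows "curve_integral \<gamma> (\<lambda>s. h s *\<^sub>C V) =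
    ((1 / (2 * complex_of_real pi * \<i>)) * integral {0..1} (\<lambda>s. vector_derivative \<gamma> (at s within {0..1}) * h s)) *\<^sub>C
      (V :: 'b :: {complex_normed_vector, banach})"
proof -
  let ?\<gamma>' = "\<lambda>s. vector_derivative \<gamma> (at s within {0..1})"
  have "(\<lambda>s. h s * ?\<gamma>' s) absolutely_integrable_on {0..1}"
  proof (rule absolutely_integrable_bounded_measurable_product[OF bilinear_conv_bounded_bilinear[THEN iffD2, OF bounded_bilinear_mult]])
    show "h \<in> borel_measurable (lebesgue_on {0..1})"
      by (rule continuous_imp_measurable_on_sets_lebesgue[OF h]) simp
    show "bounded (h ` {0..1})"
      by (intro compact_imp_bounded compact_continuous_image h) simp
  qed (use regular_curve_derivative[OF v rect] in auto)
  then have int: "(\<lambda>s. ?\<gamma>' s * h s) integrable_on {0..1}"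
    using set_lebesgue_integral_eq_integral(1) by (simp add: mult.commute)
  have "integral {0..1} ((\<lambda>c. c *\<^sub>C V) \<circ> (\<lambda>s. ?\<gamma>' s * h s)) = integral {0..1} (\<lambda>s. ?\<gamma>' s * h s) *\<^sub>C V"
    by (rule integral_linear[OF int scaleC.bounded_linear_left])
  then show ?thesis
    unfolding curve_integral_def by (simp add: o_def scaleC_scaleC)
qed

lemma curve_integral_winding:
  assumes z: "z \<notin> path_image \<gamma>" and w: "winding_number \<gamma> z = 1"
  shows "curve_integral \<gamma> (\<lambda>s. (1 / (\<gamma> s - z)) *\<^sub>C V) = (V :: 'b :: {complex_normed_vector, banach})"
proof -
  have cont: "continuous_on {0..1} (\<lambda>s. 1 / (\<gamma> s - z))"
    using z valid_path_imp_path[OF v]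
    by (intro continuous_intros) (auto simp: path_def path_image_def)
  have "integral {0..1} (\<lambda>s. vector_derivative \<gamma> (at s within {0..1}) * (1 / (\<gamma> s - z))) =
      integral {0..1} (\<lambda>s. (1 / (\<gamma> s - z)) * vector_derivative \<gamma> (at s))"
  \<comment> \<open>The one-sided and two-sided derivatives can disagree only at the endpoints of
    the parameter interval, a null set.\<close>
  proof (rule integral_spike[of "{0, 1}"])
    fix s :: real assume s: "s \<in> {0..1} - {0, 1}"
    then have "at s within {0..1} = at s"
      by (intro at_within_interior) (auto simp: interior_atLeastAtMost_real)
    then show "(1 / (\<gamma> s - z)) * vector_derivative \<gamma> (at s) = vector_derivative \<gamma> (at s within {0..1}) * (1 / (\<gamma> s - z))"
      by simp
  qed simp
  also have "\<dots> = contour_integral \<gamma> (\<lambda>w. 1 / (w - z))"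
    by (simp add: contour_integral_integral)
  finally show ?thesis
    unfolding curve_integral_const[OF cont]
    using winding_number_valid_path[OF v z] w by simp
qed

end

context dominated_semigroup
begin

section \<open>The resolvent of the generator: algebraic identities and continuity\<close>

lemma resolvent_inverts:
  assumes "\<mu> \<notin> spectrum (generator T)"
  shows "inverts \<mu> (resolvent (generator T) \<mu>)"
proof -
  have b: "bij_betw (\<lambda>x. A x - \<mu> *\<^sub>C x) D UNIV"
    and l: "bounded_linear (inv_into D (\<lambda>x. A x - \<mu> *\<^sub>C x))"
    using assms by (auto simp: spectrum_def shifted_def[abs_def] D_def A_def)
  have ap: "resolvent (generator T) \<mu> x = inv_into D (\<lambda>x. A x - \<mu> *\<^sub>C x) x" for x
    using bounded_linear_Blinfun_apply[OF l]
    by (simp add: resolvent_def shifted_def[abs_def] D_def A_def)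
  show ?thesis
    unfolding inverts_def ap
    using b f_inv_into_f[of _ "\<lambda>x. A x - \<mu> *\<^sub>C x" D] inv_into_into[of _ "\<lambda>x. A x - \<mu> *\<^sub>C x" D]
      inv_into_f_f[of "\<lambda>x. A x - \<mu> *\<^sub>C x" D]
    by (auto simp: bij_betw_def)
qed

lemma inverts_identity:
  assumes R: "inverts \<mu> R" and Q: "inverts \<nu> Q"
  shows "R - Q = (\<mu> - \<nu>) *\<^sub>C (Q o\<^sub>L R)"
proof (rule blinfun_eqI)
  fix x
  have Rx: "R x \<in> D" "A (R x) - \<mu> *\<^sub>C R x = x" using R by (auto simp: inverts_def)
  then have "A (R x) - \<nu> *\<^sub>C R x = x + (\<mu> - \<nu>) *\<^sub>C R x"
    by (simp add: scaleC.diff_left algebra_simps)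
  moreover have "Q (A (R x) - \<nu> *\<^sub>C R x) = R x" using Q Rx(1) by (simp add: inverts_def)
  ultimately have "R x = Q x + (\<mu> - \<nu>) *\<^sub>C Q (R x)"
    using inverts_complex_linear[OF Q] by (simp add: blinfun.add_right complex_linear_scaleC)
  then show "(R - Q) x = ((\<mu> - \<nu>) *\<^sub>C (Q o\<^sub>L R)) x"
    by (simp add: blinfun.diff_left algebra_simps)
qed

text \<open>For distinct points, compare the resolvent identity with its version for exchanged roles
  and cancel \<mu> - \<nu>. For equal points the identity says that the inverses coincide.\<close>

lemma inverts_commute:
  assumes R: "inverts \<mu> R" and Q: "inverts \<nu> Q"
  shows "Q o\<^sub>L R = R o\<^sub>L Q"
proof (cases "\<mu> = \<nu>")
  case True
  then have "R - Q = 0" using inverts_identity[OF R Q] by (simp add: scaleC.zero_left)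
  then show ?thesis by simp
next
  case False
  have "(\<mu> - \<nu>) *\<^sub>C (Q o\<^sub>L R) = - (Q - R)" using inverts_identity[OF R Q] by simp
  also have "\<dots> = (\<mu> - \<nu>) *\<^sub>C (R o\<^sub>L Q)"
    unfolding inverts_identity[OF Q R] by (simp add: scaleC.minus_left[symmetric])
  finally have "inverse (\<mu> - \<nu>) *\<^sub>C (\<mu> - \<nu>) *\<^sub>C (Q o\<^sub>L R) = inverse (\<mu> - \<nu>) *\<^sub>C (\<mu> - \<nu>) *\<^sub>C (R o\<^sub>L Q)"
    by simp
  then show ?thesis using False by (simp add: scaleC_scaleC)
qed

lemma continuous_on_resolvent: "continuous_on (- spectrum (generator T)) (resolvent (generator T))"
  unfolding continuous_on_iff
proof (intro ballI allI impI)
  fix \<nu> :: complex and e :: real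
  assume \<nu>: "\<nu> \<in> - spectrum (generator T)" and e: "0 < e"
  let ?R = "resolvent (generator T)"
  define N where "N = norm (?R \<nu>)"
  \<comment> \<open>The first bound lets the resolvent identity absorb half of ||R(\<mu>)|| and
    gives ||R(\<mu>)|| \<le> 2 N; the second makes the resulting difference smaller than e.\<close>
  define d where "d = min (1 / (2 * (N + 1))) (e / (2 * (N + 1)\<^sup>2))"
  have N: "0 \<le> N" by (simp add: N_def)
  have d: "0 < d" using N e by (simp add: d_def)
  show "\<exists>d>0. \<forall>\<mu>\<in>- spectrum (generator T). dist \<mu> \<nu> < d \<longrightarrow> dist (?R \<mu>) (?R \<nu>) < e"
  proof (intro exI[of _ d] conjI ballI impI d)
    fix \<mu> assume \<mu>: "\<mu> \<in> - spectrum (generator T)" and dist: "dist \<mu> \<nu> < d"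
    have "?R \<mu> - ?R \<nu> = (\<mu> - \<nu>) *\<^sub>C (?R \<nu> o\<^sub>L ?R \<mu>)"
      using \<mu> \<nu> by (intro inverts_identity resolvent_inverts) auto
    then have le: "norm (?R \<mu> - ?R \<nu>) \<le> dist \<mu> \<nu> * (N * norm (?R \<mu>))"
      using norm_blinfun_compose[of "?R \<nu>" "?R \<mu>"] by (simp add: norm_scaleC dist_norm N_def mult_left_mono)
    have "dist \<mu> \<nu> \<le> 1 / (2 * (N + 1))"
      using dist by (simp add: d_def)
    then have half: "dist \<mu> \<nu> * (N + 1) \<le> 1/2"
      using N by (simp add: pos_le_divide_eq algebra_simps)
    have "norm (?R \<mu>) \<le> N + norm (?R \<mu> - ?R \<nu>)"
      unfolding N_def by (metis norm_triangle_sub)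
    also have "\<dots> \<le> N + (dist \<mu> \<nu> * (N + 1)) * norm (?R \<mu>)"
      using le mult_right_mono[of "dist \<mu> \<nu> * N" "dist \<mu> \<nu> * (N + 1)" "norm (?R \<mu>)"] by (simp add: mult.assoc distrib_left)
    also have "\<dots> \<le> N + 1/2 * norm (?R \<mu>)"
      by (intro add_left_mono mult_right_mono half) auto
    finally have R2: "norm (?R \<mu>) \<le> 2 * N" by simp
    have "norm (?R \<mu> - ?R \<nu>) \<le> dist \<mu> \<nu> * (N * (2 * N))"
      using le R2 N by (meson mult_left_mono order_trans zero_le_dist)
    also have "\<dots> \<le> dist \<mu> \<nu> * (2 * (N + 1)\<^sup>2)"
      using N by (intro mult_left_mono) (auto simp: power2_eq_square algebra_simps)
    also have "\<dots> < d * (2 * (N + 1)\<^sup>2)"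
      using dist N by (intro mult_strict_right_mono) auto
    also have "\<dots> \<le> e / (2 * (N + 1)\<^sup>2) * (2 * (N + 1)\<^sup>2)"
      using N by (intro mult_right_mono) (auto simp: d_def)
    also have "\<dots> = e" using N by simp
    finally show "dist (?R \<mu>) (?R \<nu>) < e" by (simp add: dist_norm)
  qed
qed

end

section \<open>Parametrices from Riesz projections\<close>

context dominated_semigroup
begin

lemma bounded_linear_compose_left: "bounded_linear (\<lambda>B. (Q :: 'a \<Rightarrow>\<^sub>L 'a) o\<^sub>L B)"
  by (rule bounded_bilinear.bounded_linear_right[OF bounded_bilinear_blinfun_compose])

lemma bounded_linear_compose_right: "bounded_linear (\<lambda>B. B o\<^sub>L (Q :: 'a \<Rightarrow>\<^sub>L 'a))"
  by (rule bounded_bilinear.bounded_linear_left[OF bounded_bilinear_blinfun_compose])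

text \<open>Formally (A - z) R(w) = I + (w - z) R(w), so dividing by w - z and integrating gives I +
  Q with winding number 1. To avoid exchanging the unbounded A with the integral, everything is
  first multiplied by one bounded inverse R(\<nu>), which yields S = R(\<nu>) (I + Q + (z - \<nu>)
  S); A is applied only afterwards.\<close>

lemma curve_local_parametrix:
  assumes enc: "regular_curve_enclosing \<gamma> z\<^sub>0"
    and disj: "path_image \<gamma> \<inter> spectrum (generator T) = {}"
    and P: "negligible_op (riesz_projection (generator T) \<gamma>)"
  shows "local_parametrix z\<^sub>0"
proof -
  have v: "valid_path \<gamma>" and rect: "rectifiable \<gamma>"
    and loop: "pathfinish \<gamma> = pathstart \<gamma>" and ins: "z\<^sub>0 \<in> inside (path_image \<gamma>)" and w1: "winding_number \<gamma> z\<^sub>0 = 1"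
    using enc by (auto simp: regular_curve_enclosing_def)
  have pth: "path \<gamma>" using v by (rule valid_path_imp_path)
  have c\<gamma>: "continuous_on {0..1} \<gamma>" using pth by (simp add: path_def)
  define R where "R = resolvent (generator T)"
  have on: "\<gamma> s \<notin> spectrum (generator T)" if "s \<in> {0..1}" for s
    using disj that unfolding path_image_def by blast
  have inv: "inverts (\<gamma> s) (R (\<gamma> s))" if "s \<in> {0..1}" for s
    unfolding R_def by (rule resolvent_inverts[OF on[OF that]])
  have cR: "continuous_on {0..1} (\<lambda>s. R (\<gamma> s))"
    unfolding R_def by (rule continuous_on_compose2[OF continuous_on_resolvent c\<gamma>]) (use on in auto)
  obtain K where K: "\<And>s. s \<in> {0..1} \<Longrightarrow> norm (R (\<gamma> s)) \<le> K"
  proof -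
    have "bounded ((\<lambda>s. R (\<gamma> s)) ` {0..1})"
      by (intro compact_imp_bounded compact_continuous_image cR) simp
    then show thesis using that by (metis bounded_iff imageI)
  qed
  obtain d where d: "0 < d" "ball z\<^sub>0 d \<subseteq> inside (path_image \<gamma>)"
    using open_inside[OF closed_path_image[OF pth]] ins open_contains_ball by blast
  \<comment> \<open>An eighth keeps the discs of radius 3 \<rho>, where means are taken, at distance
    at least 5 \<rho> from the curve.\<close>
  define \<rho> where "\<rho> = d / 8"
  have \<rho>: "0 < \<rho>" using d by (simp add: \<rho>_def)
  have off: "z \<notin> path_image \<gamma>" if "z \<in> ball z\<^sub>0 d" for z
    using d(2) that inside_no_overlap[of "path_image \<gamma>"] by blast
  have far: "5 * \<rho> \<le> cmod (\<gamma> s - z)" if "z \<in> cball z\<^sub>0 (3 * \<rho>)" "s \<in> {0..1}" for z s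
  proof -
    have "\<gamma> s \<notin> ball z\<^sub>0 d" using off that(2) unfolding path_image_def by blast
    then have "8 * \<rho> \<le> dist z\<^sub>0 (\<gamma> s)" by (simp add: \<rho>_def)
    also have "\<dots> \<le> dist z\<^sub>0 z + dist z (\<gamma> s)" by (rule dist_triangle)
    finally show ?thesis using that(1) by (simp add: dist_norm norm_minus_commute)
  qed
  have ck: "continuous_on {0..1} (\<lambda>s. 1 / (\<gamma> s - z))" if "z \<in> cball z\<^sub>0 (3 * \<rho>)" for z
    using far[OF that] \<rho> by (intro continuous_intros c\<gamma>) force
  have wind: "winding_number \<gamma> z = 1" if "z \<in> ball z\<^sub>0 d" for z
  proof -
    have "winding_number \<gamma> z = winding_number \<gamma> z\<^sub>0"
      by (rule winding_number_eq[OF pth loop that, of z\<^sub>0]) (use d off in auto)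
    then show ?thesis using w1 by simp
  qed
  define S where "S z = curve_integral \<gamma> (\<lambda>s. (1 / (\<gamma> s - z)) *\<^sub>C R (\<gamma> s))" for z
  define Q where "Q = curve_integral \<gamma> (\<lambda>s. R (\<gamma> s))"
  \<comment> \<open>Q carries the opposite sign of the Riesz projection, so the defect I - (I + Q)
    is exactly that projection; it is the same for all z near the centre.\<close>
  have riesz: "riesz_projection (generator T) \<gamma> = - Q"
    by (simp add: riesz_projection_def Q_def curve_integral_def R_def)
  have cS: "continuous_on {0..1} (\<lambda>s. (1 / (\<gamma> s - z)) *\<^sub>C R (\<gamma> s))" if "z \<in> cball z\<^sub>0 (3 * \<rho>)" for z
    by (intro continuous_intros ck[OF that] cR)
  obtain L where L: "0 \<le> L" "\<And>F B. continuous_on {0..1} F \<Longrightarrow> (\<And>s. s \<in> {0..1} \<Longrightarrow> norm (F s) \<le> B) \<Longrightarrow>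
      norm (curve_integral \<gamma> F :: 'a \<Rightarrow>\<^sub>L 'a) \<le> L * B"
    using curve_integral_bound[OF v rect, where 'b = "'a \<Rightarrow>\<^sub>L 'a"] by blast
  have S_le: "norm (S z) \<le> L * (1 / (5 * \<rho>) * K)" if z: "z \<in> cball z\<^sub>0 (3 * \<rho>)" for z
    unfolding S_def
  proof (rule L(2)[OF cS[OF z]])
    fix s :: real assume s: "s \<in> {0..1}"
    have "1 / cmod (\<gamma> s - z) \<le> 1 / (5 * \<rho>)"
      using far[OF z s] \<rho> by (intro divide_left_mono mult_pos_pos) linarith+
    then show "norm ((1 / (\<gamma> s - z)) *\<^sub>C R (\<gamma> s)) \<le> 1 / (5 * \<rho>) * K"
      unfolding norm_scaleC norm_divide norm_one using K[OF s] \<rho> by (intro mult_mono) auto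
  qed
  \<comment> \<open>Any point outside the spectrum could serve as reference; the starting point of
    the curve is one.\<close>
  define \<nu> where "\<nu> = \<gamma> 0"
  have invN: "inverts \<nu> (R \<nu>)" unfolding \<nu>_def by (rule inv) simp
  have linN: "complex_linear (R \<nu>)" by (rule inverts_complex_linear[OF invN])
  have key: "(z - \<nu>) *\<^sub>C (R \<nu> o\<^sub>L ((1 / (\<gamma> s - z)) *\<^sub>C R (\<gamma> s))) + (R \<nu> o\<^sub>L R (\<gamma> s)) =
      (1 / (\<gamma> s - z)) *\<^sub>C R (\<gamma> s) - (1 / (\<gamma> s - z)) *\<^sub>C R \<nu>"
    if z: "z \<in> cball z\<^sub>0 (3 * \<rho>)" and s: "s \<in> {0..1}" for z s
  proof -
    have ne: "\<gamma> s - z \<noteq> 0" using far[OF z s] \<rho> by auto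
    have "(z - \<nu>) *\<^sub>C (R \<nu> o\<^sub>L ((1 / (\<gamma> s - z)) *\<^sub>C R (\<gamma> s))) + (R \<nu> o\<^sub>L R (\<gamma> s)) =
        ((z - \<nu>) * (1 / (\<gamma> s - z)) + 1) *\<^sub>C (R \<nu> o\<^sub>L R (\<gamma> s))"
      by (simp add: complex_linear_compose_scaleC[OF linN] scaleC_scaleC scaleC.add_left)
    also have "(z - \<nu>) * (1 / (\<gamma> s - z)) + 1 = (1 / (\<gamma> s - z)) * (\<gamma> s - \<nu>)"
      using ne by (simp add: field_simps)
    also have "\<dots> *\<^sub>C (R \<nu> o\<^sub>L R (\<gamma> s)) = (1 / (\<gamma> s - z)) *\<^sub>C (R (\<gamma> s) - R \<nu>)"
      by (simp add: inverts_identity[OF inv[OF s] invN] scaleC_scaleC)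
    finally show ?thesis by (simp add: scaleC.diff_right)
  qed
  have S_eq: "(z - \<nu>) *\<^sub>C (R \<nu> o\<^sub>L S z) + (R \<nu> o\<^sub>L Q) = S z - R \<nu>"
    if z: "z \<in> ball z\<^sub>0 (2 * \<rho>)" for z
  proof -
    have z3: "z \<in> cball z\<^sub>0 (3 * \<rho>)" and zd: "z \<in> ball z\<^sub>0 d" using z \<rho> by (auto simp: \<rho>_def)
    let ?k = "\<lambda>s. (1 / (\<gamma> s - z)) *\<^sub>C R (\<gamma> s)"
    have bl: "bounded_linear (\<lambda>B. (z - \<nu>) *\<^sub>C (R \<nu> o\<^sub>L B))"
      by (rule bounded_linear_compose[OF scaleC.bounded_linear_right bounded_linear_compose_left])
    have e1: "curve_integral \<gamma> (\<lambda>s. (z - \<nu>) *\<^sub>C (R \<nu> o\<^sub>L ?k s)) = (z - \<nu>) *\<^sub>C (R \<nu> o\<^sub>L S z)"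
      unfolding S_def
      by (rule curve_integral_linear[OF v rect cS[OF z3] bl])
        (simp add: complex_linear_compose_scaleC[OF linN] scaleC_scaleC mult.commute)
    have e2: "curve_integral \<gamma> (\<lambda>s. R \<nu> o\<^sub>L R (\<gamma> s)) = R \<nu> o\<^sub>L Q"
      unfolding Q_def
      by (rule curve_integral_linear[OF v rect cR bounded_linear_compose_left])
        (rule complex_linear_compose_scaleC[OF linN])
    have cN: "continuous_on {0..1} (\<lambda>s. - ((1 / (\<gamma> s - z)) *\<^sub>C R \<nu>))"
      by (intro continuous_intros ck[OF z3])
    have e3: "curve_integral \<gamma> (\<lambda>s. - ((1 / (\<gamma> s - z)) *\<^sub>C R \<nu>)) = - R \<nu>"
    proof -
      have "curve_integral \<gamma> (\<lambda>s. (1 / (\<gamma> s - z)) *\<^sub>C (- R \<nu>)) = - R \<nu>"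
        by (rule curve_integral_winding[OF v rect off[OF zd] wind[OF zd]])
      then show ?thesis by (simp add: scaleC.minus_right)
    qed
    have "(z - \<nu>) *\<^sub>C (R \<nu> o\<^sub>L S z) + (R \<nu> o\<^sub>L Q) =
        curve_integral \<gamma> (\<lambda>s. (z - \<nu>) *\<^sub>C (R \<nu> o\<^sub>L ?k s) + (R \<nu> o\<^sub>L R (\<gamma> s)))"
      unfolding e1[symmetric] e2[symmetric]
      by (intro curve_integral_add[symmetric] v rect bounded_linear.continuous_on[OF bl] cS[OF z3]
          bounded_linear.continuous_on[OF bounded_linear_compose_left] cR)
    also have "\<dots> = curve_integral \<gamma> (\<lambda>s. ?k s + - ((1 / (\<gamma> s - z)) *\<^sub>C R \<nu>))"
      by (rule curve_integral_cong) (simp add: key[OF z3])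
    also have "\<dots> = S z + - R \<nu>"
      unfolding S_def e3[symmetric] by (rule curve_integral_add[OF v rect cS[OF z3] cN])
    finally show ?thesis by simp
  qed
  have comN: "S z o\<^sub>L R \<nu> = R \<nu> o\<^sub>L S z" if z: "z \<in> cball z\<^sub>0 (3 * \<rho>)" for z
  proof -
    have "S z o\<^sub>L R \<nu> = curve_integral \<gamma> (\<lambda>s. ((1 / (\<gamma> s - z)) *\<^sub>C R (\<gamma> s)) o\<^sub>L R \<nu>)"
      unfolding S_def
      by (rule curve_integral_linear[OF v rect cS[OF z] bounded_linear_compose_right, symmetric]) (rule scaleC_compose)
    also have "\<dots> = curve_integral \<gamma> (\<lambda>s. R \<nu> o\<^sub>L ((1 / (\<gamma> s - z)) *\<^sub>C R (\<gamma> s)))"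
      by (rule curve_integral_cong)
        (simp add: scaleC_compose complex_linear_compose_scaleC[OF linN] inverts_commute[OF inv invN])
    also have "\<dots> = R \<nu> o\<^sub>L S z"
      unfolding S_def
      by (rule curve_integral_linear[OF v rect cS[OF z] bounded_linear_compose_left]) (rule complex_linear_compose_scaleC[OF linN])
    finally show ?thesis .
  qed
  have comQ: "Q o\<^sub>L R \<nu> = R \<nu> o\<^sub>L Q"
  proof -
    have "Q o\<^sub>L R \<nu> = curve_integral \<gamma> (\<lambda>s. R (\<gamma> s) o\<^sub>L R \<nu>)"
      unfolding Q_def
      by (rule curve_integral_linear[OF v rect cR bounded_linear_compose_right, symmetric]) (rule scaleC_compose)
    also have "\<dots> = curve_integral \<gamma> (\<lambda>s. R \<nu> o\<^sub>L R (\<gamma> s))"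
      by (rule curve_integral_cong)
        (simp add: inverts_commute[OF inv invN])
    also have "\<dots> = R \<nu> o\<^sub>L Q"
      unfolding Q_def
      by (rule curve_integral_linear[OF v rect cR bounded_linear_compose_left]) (rule complex_linear_compose_scaleC[OF linN])
    finally show ?thesis .
  qed
  have comT: "S z o\<^sub>L T t = T t o\<^sub>L S z" if z: "z \<in> cball z\<^sub>0 (3 * \<rho>)" and t: "0 \<le> t" for z t
  proof -
    have "S z o\<^sub>L T t = curve_integral \<gamma> (\<lambda>s. ((1 / (\<gamma> s - z)) *\<^sub>C R (\<gamma> s)) o\<^sub>L T t)"
      unfolding S_def
      by (rule curve_integral_linear[OF v rect cS[OF z] bounded_linear_compose_right, symmetric]) (rule scaleC_compose)
    also have "\<dots> = curve_integral \<gamma> (\<lambda>s. T t o\<^sub>L ((1 / (\<gamma> s - z)) *\<^sub>C R (\<gamma> s)))"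
      
    proof (rule curve_integral_cong)
      fix s :: real assume s: "s \<in> {0..1}"
      have "R (\<gamma> s) o\<^sub>L T t = T t o\<^sub>L R (\<gamma> s)"
        using inverts_parametrix[OF inv[OF s]] t by (intro blinfun_eqI) (simp add: parametrix_def)
      then show "((1 / (\<gamma> s - z)) *\<^sub>C R (\<gamma> s)) o\<^sub>L T t = T t o\<^sub>L ((1 / (\<gamma> s - z)) *\<^sub>C R (\<gamma> s))"
        by (simp add: scaleC_compose complex_linear_compose_scaleC[OF T_linear[OF t]])
    qed
    also have "\<dots> = T t o\<^sub>L S z"
      unfolding S_def
      by (rule curve_integral_linear[OF v rect cS[OF z] bounded_linear_compose_left])
        (rule complex_linear_compose_scaleC[OF T_linear[OF t]])
    finally show ?thesis .
  qed
  have par: "parametrix z (S z) (- Q)" if z: "z \<in> ball z\<^sub>0 (2 * \<rho>)" for z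
  proof -
    have z3: "z \<in> cball z\<^sub>0 (3 * \<rho>)" using z \<rho> by auto
    have eq: "S z x = R \<nu> (x + Q x + (z - \<nu>) *\<^sub>C S z x)" for x
      using arg_cong[OF S_eq[OF z], of "\<lambda>B. blinfun_apply B x"]
      by (simp add: blinfun.add_left blinfun.diff_left blinfun.add_right complex_linear_scaleC[OF linN] algebra_simps)
    have split: "A x - z *\<^sub>C x = (A x - \<nu> *\<^sub>C x) - (z - \<nu>) *\<^sub>C x" for x
      by (simp add: scaleC.diff_left)
    show ?thesis
      unfolding parametrix_def
    proof (intro conjI allI ballI impI)
      fix x
      show "S z x \<in> D"
        by (subst eq) (use invN in \<open>auto simp: inverts_def\<close>)
      have "A (S z x) - \<nu> *\<^sub>C S z x = x + Q x + (z - \<nu>) *\<^sub>C S z x"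
        using invN eq[of x] by (metis inverts_def)
      then show "A (S z x) - z *\<^sub>C S z x = x - (- Q) x"
        unfolding split by (simp add: blinfun.minus_left)
      show "S z (T t x) = T t (S z x)" if "0 \<le> t" for t
        using arg_cong[OF comT[OF z3 that], of "\<lambda>B. blinfun_apply B x"] by simp
      assume x: "x \<in> D"
      \<comment> \<open>Writing x as R(\<nu>) y lets the fixed point equation for S(z) y be
        rewritten in terms of x, since R(\<nu>) commutes with S(z) and Q.\<close>
      define y where "y = A x - \<nu> *\<^sub>C x"
      have Ry: "R \<nu> y = x" using invN x by (simp add: inverts_def y_def)
      have SR: "R \<nu> (S z y) = S z x" "R \<nu> (Q y) = Q x"
        using arg_cong[OF comN[OF z3], of "\<lambda>B. blinfun_apply B y"] arg_cong[OF comQ, of "\<lambda>B. blinfun_apply B y"]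
        by (simp_all add: Ry)
      have "S z y = x + Q x + (z - \<nu>) *\<^sub>C S z x"
        by (subst eq) (simp add: blinfun.add_right complex_linear_scaleC[OF linN] SR Ry)
      moreover have "S z ((z - \<nu>) *\<^sub>C x) = (z - \<nu>) *\<^sub>C S z x"
      proof -
        have lin: "complex_linear (R (\<gamma> s))" if "s \<in> {0..1}" for s
          by (rule inverts_complex_linear[OF inv[OF that]])
        \<comment> \<open>Complex linearity of S(z) is obtained by viewing multiplication by a
          scalar as a bounded operator and moving it through the integral by composition on the
          right.\<close>
        let ?M = "\<lambda>c. Blinfun (\<lambda>x :: 'a. c *\<^sub>C x)"
        have M: "blinfun_apply (?M c) = (\<lambda>x. c *\<^sub>C x)" for c
          by (rule bounded_linear_Blinfun_apply[OF bounded_linear_scaleC])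
        have "S z o\<^sub>L ?M (z - \<nu>) = curve_integral \<gamma> (\<lambda>s. ((1 / (\<gamma> s - z)) *\<^sub>C R (\<gamma> s)) o\<^sub>L ?M (z - \<nu>))"
          unfolding S_def
          by (rule curve_integral_linear[OF v rect cS[OF z3] bounded_linear_compose_right, symmetric]) (rule scaleC_compose)
        also have "\<dots> = curve_integral \<gamma> (\<lambda>s. (z - \<nu>) *\<^sub>C ((1 / (\<gamma> s - z)) *\<^sub>C R (\<gamma> s)))"
          
        proof (rule curve_integral_cong)
          fix s :: real assume s: "s \<in> {0..1}"
          show "((1 / (\<gamma> s - z)) *\<^sub>C R (\<gamma> s)) o\<^sub>L ?M (z - \<nu>) = (z - \<nu>) *\<^sub>C ((1 / (\<gamma> s - z)) *\<^sub>C R (\<gamma> s))"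
            by (rule blinfun_eqI) (simp add: M complex_linear_scaleC[OF lin[OF s]] scaleC_scaleC mult.commute)
        qed
        also have "\<dots> = (z - \<nu>) *\<^sub>C S z"
          unfolding S_def
          by (rule curve_integral_linear[OF v rect cS[OF z3] scaleC.bounded_linear_right]) (simp add: scaleC_scaleC mult.commute)
        finally have "S z o\<^sub>L ?M (z - \<nu>) = (z - \<nu>) *\<^sub>C S z" .
        from arg_cong[OF this, of "\<lambda>B. blinfun_apply B x"] show ?thesis by (simp add: M)
      qed
      ultimately show "S z (A x - z *\<^sub>C x) = x - (- Q) x"
        unfolding split y_def[symmetric] by (simp add: blinfun.diff_right blinfun.minus_left)
    next
      show "negligible_op (- Q)" using P by (simp add: riesz)
    qed
  qed
  \<comment> \<open>The dependence on \<zeta> sits entirely in the scalar g(\<zeta>) / (\<gamma> s -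
    \<zeta>), holomorphic on the doubled disc with a bound independent of s. The scalar quadrature
    error is therefore uniform along the curve and can be integrated.\<close>
  have mv: "mean_value S z r" if z: "z \<in> ball z\<^sub>0 \<rho>" and r: "0 < r" "r \<le> \<rho>" for z r
    unfolding mean_value_def
  proof (intro allI impI)
    fix g and e :: real assume g: "g holomorphic_on UNIV" and e: "0 < e"
    obtain B where B: "0 \<le> B" "\<And>w. w \<in> cball z (2 * r) \<Longrightarrow> cmod (g w) \<le> B"
      using entire_bounded_on_cball[OF g] by metis
    obtain M where M: "0 < M" "L * (2 * (B / (5 * \<rho>)) * K) / 2 ^ M \<le> e"
      using exists_power_half_le[OF e] by metis
    have near: "\<zeta> \<in> cball z\<^sub>0 (3 * \<rho>)" if "\<zeta> \<in> cball z (2 * r)" for \<zeta>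
    proof -
      have "dist z\<^sub>0 \<zeta> \<le> dist z\<^sub>0 z + dist z \<zeta>" by (rule dist_triangle)
      then show ?thesis using that z r by simp
    qed
    define zj where "zj j = z + of_real r * cis (2 * pi * real j / real M)" for j
    have zj: "zj j \<in> cball z\<^sub>0 (3 * \<rho>)" for j
      using near[of "zj j"] r by (simp add: zj_def dist_norm norm_mult)
    have zz: "z \<in> cball z\<^sub>0 (3 * \<rho>)" using near[of z] r by simp
    let ?h = "\<lambda>s \<zeta>. g \<zeta> / (\<gamma> s - \<zeta>)"
    have ch: "continuous_on {0..1} (\<lambda>s. ?h s \<zeta>)" if "\<zeta> \<in> cball z\<^sub>0 (3 * \<rho>)" for \<zeta>
      using continuous_on_mult_left[OF ck[OF that], of "g \<zeta>"] by simp
    have gS: "g \<zeta> *\<^sub>C S \<zeta> = curve_integral \<gamma> (\<lambda>s. ?h s \<zeta> *\<^sub>C R (\<gamma> s))" if "\<zeta> \<in> cball z\<^sub>0 (3 * \<rho>)" for \<zeta>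
      unfolding S_def
      by (subst curve_integral_linear[OF v rect cS[OF that] scaleC.bounded_linear_right, symmetric])
        (simp_all add: scaleC_scaleC mult.commute)
    have sum: "curve_integral \<gamma> (\<lambda>s. \<Sum>j\<in>J. ?h s (zj j) *\<^sub>C R (\<gamma> s)) = (\<Sum>j\<in>J. g (zj j) *\<^sub>C S (zj j))"
      if "finite J" for J :: "nat set"
      using that
    proof (induction J)
      case empty
      then show ?case by (simp add: curve_integral_def scaleC.zero_right)
    next
      case (insert j J)
      then show ?case
        by (simp add: curve_integral_add[OF v rect] gS[OF zj] continuous_intros ch[OF zj] cR)
    qed
    have "circle_mean M r z (\<lambda>\<zeta>. g \<zeta> *\<^sub>C S \<zeta>) = (1 / real M) *\<^sub>R curve_integral \<gamma> (\<lambda>s. \<Sum>j<M. ?h s (zj j) *\<^sub>C R (\<gamma> s))"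
      unfolding circle_mean_def zj_def[symmetric] by (simp add: sum)
    also have "\<dots> = curve_integral \<gamma> (\<lambda>s. (1 / real M) *\<^sub>R (\<Sum>j<M. ?h s (zj j) *\<^sub>C R (\<gamma> s)))"
      by (rule curve_integral_linear[OF v rect _ bounded_linear_scaleR_right, symmetric])
        (auto intro!: continuous_intros ch[OF zj] cR simp: scaleC_scaleR_commute)
    also have "\<dots> = curve_integral \<gamma> (\<lambda>s. circle_mean M r z (?h s) *\<^sub>C R (\<gamma> s))"
      unfolding circle_mean_def zj_def[symmetric] by (simp add: scaleC.sum_left scaleC.scaleR_left)
    finally have cm: "circle_mean M r z (\<lambda>\<zeta>. g \<zeta> *\<^sub>C S \<zeta>) = curve_integral \<gamma> (\<lambda>s. circle_mean M r z (?h s) *\<^sub>C R (\<gamma> s))" .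
    have ccm: "continuous_on {0..1} (\<lambda>s. circle_mean M r z (?h s) *\<^sub>C R (\<gamma> s))"
      unfolding circle_mean_def zj_def[symmetric] by (intro continuous_intros ch[OF zj] cR)
    have cz: "continuous_on {0..1} (\<lambda>s. - (?h s z *\<^sub>C R (\<gamma> s)))"
      by (intro continuous_intros ch[OF zz] cR)
    have "- (g z *\<^sub>C S z) = curve_integral \<gamma> (\<lambda>s. - (?h s z *\<^sub>C R (\<gamma> s)))"
      unfolding gS[OF zz]
      by (rule curve_integral_linear[OF v rect _ bounded_linear_minus[OF bounded_linear_ident], symmetric])
        (auto intro!: continuous_intros ch[OF zz] cR simp: scaleC.minus_right)
    then have "circle_mean M r z (\<lambda>\<zeta>. g \<zeta> *\<^sub>C S \<zeta>) - g z *\<^sub>C S z =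
        curve_integral \<gamma> (\<lambda>s. circle_mean M r z (?h s) *\<^sub>C R (\<gamma> s) + - (?h s z *\<^sub>C R (\<gamma> s)))"
      using curve_integral_add[OF v rect ccm cz] cm by simp
    also have "norm \<dots> \<le> L * (2 * (B / (5 * \<rho>)) / 2 ^ M * K)"
    proof (rule L(2)[OF continuous_on_add[OF ccm cz]])
      fix s :: real assume s: "s \<in> {0..1}"
      have "cmod (circle_mean M r z (?h s) - ?h s z) \<le> 2 * (B / (5 * \<rho>)) / 2 ^ M"
      proof (rule circle_mean_holomorphic[OF _ r(1) M(1)])
        show "?h s holomorphic_on cball z (2 * r)"
          using far[OF near s] \<rho>
          by (intro holomorphic_intros holomorphic_on_subset[OF g]) force+
        show "cmod (g w / (\<gamma> s - w)) \<le> B / (5 * \<rho>)" if "w \<in> cball z (2 * r)" for w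
          unfolding norm_divide using far[OF near[OF that] s] \<rho> B that by (intro frac_le) auto
      qed
      then have "cmod (circle_mean M r z (?h s) - ?h s z) * norm (R (\<gamma> s)) \<le> 2 * (B / (5 * \<rho>)) / 2 ^ M * K"
        using K[OF s] B(1) \<rho> by (intro mult_mono) auto
      then show "norm (circle_mean M r z (?h s) *\<^sub>C R (\<gamma> s) + - (?h s z *\<^sub>C R (\<gamma> s))) \<le> 2 * (B / (5 * \<rho>)) / 2 ^ M * K"
        by (simp add: norm_scaleC[symmetric] scaleC.diff_left)
    qed
    also have "\<dots> \<le> e" using M(2) by simp
    finally show "\<exists>M>0. norm (circle_mean M r z (\<lambda>\<zeta>. g \<zeta> *\<^sub>C S \<zeta>) - g z *\<^sub>C S z) \<le> e"
      using M(1) by blast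
  qed
  have "\<forall>z\<in>ball z\<^sub>0 (2 * \<rho>). parametrix z (S z) (- Q) \<and> norm (S z) \<le> L * (1 / (5 * \<rho>) * K)"
    using par S_le \<rho> by auto
  moreover have "\<forall>z\<in>ball z\<^sub>0 \<rho>. \<forall>r. 0 < r \<and> r \<le> \<rho> \<longrightarrow> mean_value S z r"
    using mv by blast
  ultimately show ?thesis
    unfolding local_parametrix_def
    by - (rule exI[of _ \<rho>], rule conjI[OF \<rho>], rule exI[of _ S], rule exI[of _ "- Q"], rule exI, rule conjI)
qed

end

theorem theorem3:
  fixes T :: "real \<Rightarrow> 'a :: complex_banach \<Rightarrow>\<^sub>L 'a"
    and f :: "real \<Rightarrow> real"
    and a :: real
  assumes semigroup: "C0_semigroup T"
    and growth: "growth_bound T > -\<infinity>"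
    and f_pos: "\<And>t. t \<ge> 0 \<Longrightarrow> f t > 0"
    and f_log_concave: "concave_on {0..} (\<lambda>t. ln (f t))"
    and bound: "\<And>t. t \<ge> 0 \<Longrightarrow> norm (T t) \<le> f t"
    and limsup: "Limsup at_top (\<lambda>t. ereal (norm (T t) / f t)) = ereal a"
    and a_pos: "a > 0"
    and curves: "\<And>z. z \<in> spectrum (generator T) \<inter> {z. ereal (Re z) = growth_bound T} \<Longrightarrow>
      \<exists>\<gamma>. regular_curve_enclosing \<gamma> z \<and>
          path_image \<gamma> \<inter> spectrum (generator T) = {} \<and>
          ((\<lambda>t. norm (T t o\<^sub>L riesz_projection (generator T) \<gamma>) / f t) \<longlongrightarrow> 0) at_top"
  shows "\<forall>\<mu>. \<mu> \<notin> spectrum (generator T) \<longrightarrow>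
    ((\<lambda>t. norm (T t o\<^sub>L resolvent (generator T) \<mu>) / f t) \<longlongrightarrow> 0) at_top"
proof (intro allI impI)
  fix \<mu> assume \<mu>: "\<mu> \<notin> spectrum (generator T)"
  obtain \<omega> where \<omega>: "growth_bound T = ereal \<omega>" and "dominated_semigroup T f \<omega>"
    using growth_bound_log_concave[OF semigroup growth f_pos f_log_concave bound limsup a_pos] by blast
  then interpret dominated_semigroup T f \<omega> by blast
  \<comment> \<open>On the line the Cauchy integral over the given curve is needed only at spectral
    points; elsewhere the Neumann series about the resolvent serves, with zero defect.\<close>
  have "local_parametrix z" if z: "Re z = \<omega>" for z
  proof (cases "z \<in> spectrum (generator T)")
    case True
    then obtain \<gamma> where "regular_curve_enclosing \<gamma> z" "path_image \<gamma> \<inter> spectrum (generator T) = {}"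
        "negligible_op (riesz_projection (generator T) \<gamma>)"
      using curves[of z] z \<omega> by (auto simp: negligible_op_def)
    then show ?thesis by (rule curve_local_parametrix)
  next
    case False
    then show ?thesis by (rule inverts_local_parametrix[OF resolvent_inverts])
  qed
  then show "((\<lambda>t. norm (T t o\<^sub>L resolvent (generator T) \<mu>) / f t) \<longlongrightarrow> 0) at_top"
    using inverse_negligible[OF _ resolvent_inverts[OF \<mu>]] by (simp add: negligible_op_def)
qed

end
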